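(* Let $\Gamma$ be a domain of $\mathbf{R}^d$ with continuous boundary. Then the Dirichlet form $(\frac12\mathbf{D}_\Gamma,H^1(\Gamma))$ on $L^2(\bar\Gamma)$ of the reflecting Brownian motion $B^{\bar\Gamma}$ on $\bar\Gamma$ possesses a proper regular subspace.
   Context: $\Gamma$ has continuous boundary if every $x\in\partial\Gamma$ has a neighbourhood $W$ such that $\Gamma\cap W=\{(x_1,\dots,x_d):x_d>F(x_1,\dots,x_{d-1})\}\cap W$ in some coordinate system $(x_1,\dots,x_d)$ and with some continuous function $F$. $H^1(\Gamma)=\{u\in L^2(\Gamma):\int_\Gamma|\nabla u|^2dx<\infty\}$, $\mathbf{D}_\Gamma(u,v)=\int_\Gamma\nabla u\cdot\nabla v\,dx$, $L^2(\bar\Gamma)=L^2(\bar\Gamma,1_{\bar\Gamma}(x)dx)$. For $\Gamma$ with continuous boundary, the restrictions to $\bar\Gamma$ of functions in $C_\mathrm{c}^\infty(\mathbf{R}^d)$ are dense in $H^1(\Gamma)$, so $(\frac12\mathbf{D}_\Gamma,H^1(\Gamma))$ is a regular Dirichlet form on $L^2(\bar\Gamma)$. A Dirichlet form $(\mathcal{E},\mathcal{F})$ on $L^2(E,m)$ is regular if $\mathcal{F}\cap C_\mathrm{c}(E)$ is dense in $\mathcal{F}$ in the norm $(\mathcal{E}(u,u)+\|u\|_{L^2}^2)^{1/2}$ and uniformly dense in $C_\mathrm{c}(E)$. A regular subspace of a regular Dirichlet form $(\mathcal{E},\mathcal{F})$ on $L^2(E,m)$ is a regular Dirichlet form $(\mathcal{E}',\mathcal{F}')$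 on $L^2(E,m)$ with $\mathcal{F}'\subset\mathcal{F}$ and $\mathcal{E}'=\mathcal{E}$ on $\mathcal{F}'\times\mathcal{F}'$; it is proper if $\mathcal{F}'\ne\mathcal{F}$. *)

theory Defs
  imports "HOL-Analysis.Analysis"
begin

section \<open>The space \<open>L\<^sup>2\<close>\<close>

text \<open>Elements of \<open>L\<^sup>2(m)\<close> are represented by functions; only their values on \<^term>\<open>space m\<close>
  matter, and classes modulo equality almost everywhere are not formed.\<close>

definition L2 :: "'a measure \<Rightarrow> ('a \<Rightarrow> real) set" where
  "L2 m = {u \<in> borel_measurable m. integrable m (\<lambda>x. (u x)\<^sup>2)}"

definition L2_norm :: "'a measure \<Rightarrow> ('a \<Rightarrow> real) \<Rightarrow> real" where
  "L2_norm m u = sqrt (\<integral>x. (u x)\<^sup>2 \<partial>m)"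


section \<open>Regular Dirichlet forms\<close>

definition form_norm ::
  "'a measure \<Rightarrow> (('a \<Rightarrow> real) \<Rightarrow> ('a \<Rightarrow> real) \<Rightarrow> real) \<Rightarrow> ('a \<Rightarrow> real) \<Rightarrow> real" where
  "form_norm m \<E> u = sqrt (\<E> u u + (L2_norm m u)\<^sup>2)"

text \<open>A symmetric form on \<open>L\<^sup>2(m)\<close>: a nonnegative definite symmetric bilinear form \<open>\<E>\<close> with a
  dense linear domain \<open>\<F>\<close>. Since classes are represented by functions, \<open>\<F>\<close> has to be saturated
  under equality almost everywhere and \<open>\<E>\<close> has to be invariant under it. In particular, equality
  of two domains as sets of functions is equality as subspaces of \<open>L\<^sup>2(m)\<close>.\<close>

definition symmetric_form ::
  "'a measure \<Rightarrow> (('a \<Rightarrow> real) \<Rightarrow> ('a \<Rightarrow> real) \<Rightarrow> real) \<Rightarrow> ('a \<Rightarrow> real) set \<Rightarrow> bool" where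
  "symmetric_form m \<E> \<F> \<longleftrightarrow>
     \<F> \<subseteq> L2 m \<and>
     (\<forall>u\<in>\<F>. \<forall>v\<in>L2 m. (AE x in m. u x = v x) \<longrightarrow> v \<in> \<F> \<and> (\<forall>w\<in>\<F>. \<E> u w = \<E> v w)) \<and>
     (\<lambda>x. 0) \<in> \<F> \<and>
     (\<forall>u\<in>\<F>. \<forall>v\<in>\<F>. (\<lambda>x. u x + v x) \<in> \<F>) \<and>
     (\<forall>c. \<forall>u\<in>\<F>. (\<lambda>x. c * u x) \<in> \<F>) \<and>
     (\<forall>u\<in>L2 m. \<forall>\<epsilon>>0. \<exists>v\<in>\<F>. L2_norm m (\<lambda>x. u x - v x) < \<epsilon>) \<and>
     (\<forall>u\<in>\<F>. \<forall>v\<in>\<F>. \<E> u v = \<E> v u) \<and>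
     (\<forall>u\<in>\<F>. \<forall>v\<in>\<F>. \<forall>w\<in>\<F>. \<E> (\<lambda>x. u x + v x) w = \<E> u w + \<E> v w) \<and>
     (\<forall>c. \<forall>u\<in>\<F>. \<forall>w\<in>\<F>. \<E> (\<lambda>x. c * u x) w = c * \<E> u w) \<and>
     (\<forall>u\<in>\<F>. 0 \<le> \<E> u u)"

definition closed_form ::
  "'a measure \<Rightarrow> (('a \<Rightarrow> real) \<Rightarrow> ('a \<Rightarrow> real) \<Rightarrow> real) \<Rightarrow> ('a \<Rightarrow> real) set \<Rightarrow> bool" where
  "closed_form m \<E> \<F> \<longleftrightarrow>
     (\<forall>u :: nat \<Rightarrow> 'a \<Rightarrow> real.
        (\<forall>n. u n \<in> \<F>) \<and>
        (\<forall>\<epsilon>>0. \<exists>N. \<forall>k\<ge>N. \<forall>n\<ge>N. form_norm m \<E> (\<lambda>x. u k x - u n x) < \<epsilon>) \<longrightarrow>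
        (\<exists>v\<in>\<F>. (\<lambda>n. form_norm m \<E> (\<lambda>x. u n x - v x)) \<longlonglongrightarrow> 0))"

definition markovian_form ::
  "(('a \<Rightarrow> real) \<Rightarrow> ('a \<Rightarrow> real) \<Rightarrow> real) \<Rightarrow> ('a \<Rightarrow> real) set \<Rightarrow> bool" where
  "markovian_form \<E> \<F> \<longleftrightarrow>
     (\<forall>u\<in>\<F>. let v = (\<lambda>x. min (max (u x) 0) 1) in v \<in> \<F> \<and> \<E> v v \<le> \<E> u u)"

definition dirichlet_form ::
  "'a measure \<Rightarrow> (('a \<Rightarrow> real) \<Rightarrow> ('a \<Rightarrow> real) \<Rightarrow> real) \<Rightarrow> ('a \<Rightarrow> real) set \<Rightarrow> bool" where
  "dirichlet_form m \<E> \<F> \<longleftrightarrow> symmetric_form m \<E> \<F> \<and> closed_form m \<E> \<F> \<and> markovian_form \<E> \<F>"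

text \<open>Continuous functions on \<open>E\<close> whose support is a compact subset of \<open>E\<close>;
  their values outside \<open>E\<close> are arbitrary.\<close>

definition Cc :: "'a::topological_space set \<Rightarrow> ('a \<Rightarrow> real) set" where
  "Cc E = {f. continuous_on E f \<and> (\<exists>K. compact K \<and> K \<subseteq> E \<and> (\<forall>x\<in>E - K. f x = 0))}"

definition regular_dirichlet_form ::
  "'a::topological_space measure \<Rightarrow> (('a \<Rightarrow> real) \<Rightarrow> ('a \<Rightarrow> real) \<Rightarrow> real) \<Rightarrow> ('a \<Rightarrow> real) set \<Rightarrow> bool"
  where
  "regular_dirichlet_form m \<E> \<F> \<longleftrightarrow>
     dirichlet_form m \<E> \<F> \<and>
     (\<forall>u\<in>\<F>. \<forall>\<epsilon>>0. \<exists>v \<in> \<F> \<inter> Cc (space m). form_norm m \<E> (\<lambda>x. u x - v x) < \<epsilon>) \<and>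
     (\<forall>f\<in>Cc (space m). \<forall>\<epsilon>>0. \<exists>v \<in> \<F> \<inter> Cc (space m). \<forall>x\<in>space m. \<bar>f x - v x\<bar> < \<epsilon>)"

text \<open>\<open>(\<E>', \<F>')\<close> is a regular subspace of the regular Dirichlet form \<open>(\<E>, \<F>)\<close>.\<close>

definition regular_subspace ::
  "'a::topological_space measure \<Rightarrow> (('a \<Rightarrow> real) \<Rightarrow> ('a \<Rightarrow> real) \<Rightarrow> real) \<Rightarrow> ('a \<Rightarrow> real) set \<Rightarrow>
   (('a \<Rightarrow> real) \<Rightarrow> ('a \<Rightarrow> real) \<Rightarrow> real) \<Rightarrow> ('a \<Rightarrow> real) set \<Rightarrow> bool" where
  "regular_subspace m \<E> \<F> \<E>' \<F>' \<longleftrightarrow>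
     regular_dirichlet_form m \<E> \<F> \<and> regular_dirichlet_form m \<E>' \<F>' \<and>
     \<F>' \<subseteq> \<F> \<and> (\<forall>u\<in>\<F>'. \<forall>v\<in>\<F>'. \<E>' u v = \<E> u v)"

definition proper_regular_subspace ::
  "'a::topological_space measure \<Rightarrow> (('a \<Rightarrow> real) \<Rightarrow> ('a \<Rightarrow> real) \<Rightarrow> real) \<Rightarrow> ('a \<Rightarrow> real) set \<Rightarrow>
   (('a \<Rightarrow> real) \<Rightarrow> ('a \<Rightarrow> real) \<Rightarrow> real) \<Rightarrow> ('a \<Rightarrow> real) set \<Rightarrow> bool" where
  "proper_regular_subspace m \<E> \<F> \<E>' \<F>' \<longleftrightarrow> regular_subspace m \<E> \<F> \<E>' \<F>' \<and> \<F>' \<noteq> \<F>"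


section \<open>The Sobolev space \<open>H\<^sup>1\<close> and the Dirichlet integral\<close>

primrec Ck :: "nat \<Rightarrow> ('a::euclidean_space \<Rightarrow> real) \<Rightarrow> bool" where
  "Ck 0 f \<longleftrightarrow> continuous_on UNIV f"
| "Ck (Suc k) f \<longleftrightarrow>
     (\<forall>x. f differentiable (at x)) \<and> (\<forall>v. Ck k (\<lambda>x. frechet_derivative f (at x) v))"

text \<open>\<open>C\<^sub>c\<^sup>\<infinity>(\<Gamma>)\<close>, its elements being extended by zero to the whole space.\<close>

definition test_functions :: "'a::euclidean_space set \<Rightarrow> ('a \<Rightarrow> real) set" where
  "test_functions \<Gamma> =
     {\<phi>. (\<forall>k. Ck k \<phi>) \<and> (\<exists>K. compact K \<and> K \<subseteq> \<Gamma> \<and> (\<forall>x. x \<notin> K \<longrightarrow> \<phi> x = 0))}"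

abbreviation lborel_restricted :: "'a::euclidean_space set \<Rightarrow> 'a measure" where
  "lborel_restricted S \<equiv> restrict_space lborel S"

text \<open>\<open>g\<close> is the distributional gradient on \<open>\<Gamma>\<close> of the locally integrable function \<open>u\<close>.
  Local integrability is required explicitly, because the integral of a non-integrable
  function is zero by convention.\<close>

definition has_weak_gradient ::
  "('a::euclidean_space \<Rightarrow> real) \<Rightarrow> ('a \<Rightarrow> 'a) \<Rightarrow> 'a set \<Rightarrow> bool" where
  "has_weak_gradient u g \<Gamma> \<longleftrightarrow>
     u \<in> borel_measurable (lborel_restricted \<Gamma>) \<and>
     g \<in> borel_measurable (lborel_restricted \<Gamma>) \<and>
     (\<forall>K. compact K \<and> K \<subseteq> \<Gamma> \<longrightarrow> set_integrable lborel K u \<and> set_integrable lborel K g) \<and>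
     (\<forall>\<phi>\<in>test_functions \<Gamma>. \<forall>b\<in>Basis.
        (\<integral>x. u x * frechet_derivative \<phi> (at x) b \<partial>lborel_restricted \<Gamma>) =
        - (\<integral>x. (g x \<bullet> b) * \<phi> x \<partial>lborel_restricted \<Gamma>))"

text \<open>For open \<open>\<Gamma>\<close> the weak gradient is unique up to null sets, so the choice is immaterial
  inside integrals over \<open>\<Gamma>\<close>.\<close>

definition weak_gradient :: "'a::euclidean_space set \<Rightarrow> ('a \<Rightarrow> real) \<Rightarrow> 'a \<Rightarrow> 'a" where
  "weak_gradient \<Gamma> u = (SOME g. has_weak_gradient u g \<Gamma>)"

definition H1 :: "'a::euclidean_space set \<Rightarrow> ('a \<Rightarrow> real) set" where
  "H1 \<Gamma> = {u \<in> L2 (lborel_restricted \<Gamma>).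
     \<exists>g. has_weak_gradient u g \<Gamma> \<and> integrable (lborel_restricted \<Gamma>) (\<lambda>x. (norm (g x))\<^sup>2)}"

definition dirichlet_integral ::
  "'a::euclidean_space set \<Rightarrow> ('a \<Rightarrow> real) \<Rightarrow> ('a \<Rightarrow> real) \<Rightarrow> real" where
  "dirichlet_integral \<Gamma> u v =
     (\<integral>x. weak_gradient \<Gamma> u x \<bullet> weak_gradient \<Gamma> v x \<partial>lborel_restricted \<Gamma>)"

text \<open>\<open>H\<^sup>1(\<Gamma>)\<close> as a subspace of \<open>L\<^sup>2(closure \<Gamma>)\<close>: the functions on the closure that restrict to
  elements of \<open>H\<^sup>1(\<Gamma>)\<close>. A continuous boundary is a null set, so this is the usual
  identification of \<open>L\<^sup>2(\<Gamma>)\<close> with \<open>L\<^sup>2(closure \<Gamma>)\<close>.\<close>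

definition H1_closure :: "'a::euclidean_space set \<Rightarrow> ('a \<Rightarrow> real) set" where
  "H1_closure \<Gamma> = L2 (lborel_restricted (closure \<Gamma>)) \<inter> H1 \<Gamma>"


section \<open>Domains with continuous boundary\<close>

text \<open>The Cartesian coordinates of \<open>y\<close> are the components of \<open>z = T (y - p)\<close>, where \<open>p\<close> is the
  origin and \<open>T\<close> is orthogonal; \<open>z \<bullet> b\<close> is the last coordinate \<open>x\<^sub>d\<close>, and \<open>z - (z \<bullet> b) *\<^sub>R b\<close> stands
  for \<open>(x\<^sub>1, \<dots>, x\<^sub>d\<^sub>-\<^sub>1)\<close>, the role of \<open>\<real>\<^sup>d\<^sup>-\<^sup>1\<close> being played by the hyperplane \<open>z \<bullet> b = 0\<close>.\<close>

definition continuous_boundary :: "'a::euclidean_space set \<Rightarrow> bool" where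
  "continuous_boundary \<Gamma> \<longleftrightarrow>
     (\<forall>x\<in>frontier \<Gamma>. \<exists>W p T b F.
        open W \<and> x \<in> W \<and>
        orthogonal_transformation (T :: 'a \<Rightarrow> 'a) \<and> b \<in> Basis \<and>
        continuous_on {z. z \<bullet> b = 0} (F :: 'a \<Rightarrow> real) \<and>
        \<Gamma> \<inter> W = {y. let z = T (y - p) in z \<bullet> b > F (z - (z \<bullet> b) *\<^sub>R b)} \<inter> W)"

end

theory Submission
  imports Defs
begin

text \<open>The subspace consists of functions that do not move in one coordinate direction across a fat
  Cantor set of levels. Fix a unit coordinate vector \<open>b\<close> and a compact set \<open>A\<close> of reals that contains no
  interval but has positive measure, placed so that the levels \<open>x \<bullet> b \<in> A\<close> fill a part of positive
  measure of some ball inside \<open>\<Gamma>\<close>. Let \<open>C\<close> be the set of functions in \<open>H\<^sup>1 \<inter> C\<^sub>c(closure \<Gamma>)\<close> whose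
  derivative in the direction \<open>b\<close> vanishes almost everywhere on these levels, and let \<open>F'\<close> be the closure
  of \<open>C\<close> in the form norm.

  \<^item> \<open>F'\<close> is a proper subspace (\<open>coordinate_not_flat\<close>): the vanishing of \<open>\<partial>\<^sub>b u\<close> on a set of positive
  measure survives \<open>L\<^sup>2\<close> limits of gradients, and a cut-off of the coordinate \<open>x \<bullet> b\<close> violates it.

  \<^item> \<open>C\<close> is uniformly dense in \<open>C\<^sub>c\<close> (\<open>flat_core_dense\<close>): since \<open>A\<close> contains no interval, there is a
  strictly increasing \<open>C\<^sup>1\<close> function \<open>s\<close> with \<open>s' = 0\<close> on \<open>A\<close>. Replacing the coordinate \<open>x \<bullet> b\<close> by
  \<open>s (x \<bullet> b)\<close> is an injective \<open>C\<^sup>1\<close> map \<open>\<Psi>\<close>, the functions \<open>p \<circ> \<Psi>\<close> satisfy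
  \<open>\<partial>\<^sub>b (p \<circ> \<Psi>) = s' \<cdot> (\<partial>\<^sub>b p \<circ> \<Psi>)\<close>, and they form an algebra to which the Stone--Weierstrass theorem
  applies.

  \<^item> The form closure of such a core is a regular Dirichlet form (\<open>regular_form_closure\<close>). It is closed
  because \<open>H\<^sup>1\<close> is complete, and Markovian because the unit contraction \<open>u \<mapsto> min (max u 0) 1\<close> preserves \<open>C\<close>
  and is continuous on \<open>H\<^sup>1\<close>. The latter rests on the chain rule \<open>\<nabla>(T u) = 1\<^bsub>{0 < u < 1}\<^esub> \<nabla>u\<close>
  (\<open>sobolev_unit_clip\<close>) and on the vanishing of \<open>\<nabla>u\<close> on level sets
  (\<open>gradient_zero_on_level_set\<close>). Both are obtained from difference quotients, which converge in \<open>L\<^sup>2\<close>.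

  For \<open>A = {}\<close> the core is all of \<open>H\<^sup>1 \<inter> C\<^sub>c\<close>, and the same theorem yields that \<open>H\<^sup>1\<close> itself is a regular
  Dirichlet form once \<open>H\<^sup>1 \<inter> C\<^sub>c\<close> is known to be dense in \<open>H\<^sup>1\<close> (\<open>sobolev_approx\<close>). Only here, and for the
  boundary to be a null set, does the boundary matter, and only through the segment property: near each
  point of the closure, a fixed short translation moves the closure into \<open>\<Gamma>\<close>. After a localization, \<open>u\<close>
  is first translated and then mollified, so that only values of \<open>u\<close> inside \<open>\<Gamma>\<close> enter.

  Functions on \<open>\<Gamma>\<close> are extended by zero and treated as elements of \<open>L\<^sup>2\<close> of the whole space. The analytic
  tool throughout is that averages over small translations approximate a function in \<open>L\<^sup>2\<close> (\<open>avg_close\<close>):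
  it serves for mollification, for difference quotients (averages of the derivative along a segment) and
  for the uniqueness of weak gradients.\<close>

section \<open>Square integrable functions\<close>

definition square_int :: "'a measure \<Rightarrow> ('a \<Rightarrow> 'b::euclidean_space) \<Rightarrow> bool" where
  "square_int M f \<longleftrightarrow> f \<in> borel_measurable M \<and> integrable M (\<lambda>x. (norm (f x))\<^sup>2)"

definition sq_norm :: "'a measure \<Rightarrow> ('a \<Rightarrow> 'b::euclidean_space) \<Rightarrow> real" where
  "sq_norm M f = (\<integral>x. (norm (f x))\<^sup>2 \<partial>M)"

lemma square_int_meas: "square_int M f \<Longrightarrow> f \<in> borel_measurable M"
  by (simp add: square_int_def)

lemma sq_norm_nonneg [simp]: "0 \<le> sq_norm M f"
  by (simp add: sq_norm_def)

lemma norm_add_sq_le: "(norm (a + b))\<^sup>2 \<le> 2 * (norm (a::'b::real_normed_vector))\<^sup>2 + 2 * (norm b)\<^sup>2"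
proof -
  have "(norm (a + b))\<^sup>2 \<le> (norm a + norm b)\<^sup>2"
    by (intro power_mono norm_triangle_ineq) auto
  also have "\<dots> \<le> 2 * (norm a)\<^sup>2 + 2 * (norm b)\<^sup>2"
    using sum_squares_bound[of "norm a" "norm b"] by (simp add: power2_sum)
  finally show ?thesis .
qed

lemma square_int_mono:
  assumes "square_int M f" "g \<in> borel_measurable M" "AE x in M. norm (g x) \<le> norm (f x)"
  shows "square_int M g" "sq_norm M g \<le> sq_norm M f"
proof -
  have *: "AE x in M. (norm (g x))\<^sup>2 \<le> (norm (f x))\<^sup>2"
    using assms(3) by eventually_elim (intro power_mono, auto)
  have "integrable M (\<lambda>x. (norm (g x))\<^sup>2)"
    by (rule Bochner_Integration.integrable_bound[where f="\<lambda>x. (norm (f x))\<^sup>2"])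
       (use assms * in \<open>auto simp: square_int_def\<close>)
  then show 1: "square_int M g" using assms by (simp add: square_int_def)
  show "sq_norm M g \<le> sq_norm M f"
    unfolding sq_norm_def using assms 1 * by (intro integral_mono_AE) (auto simp: square_int_def)
qed

lemma square_int_zero [simp]: "square_int M (\<lambda>x. 0)" "sq_norm M (\<lambda>x. 0) = 0"
  by (simp_all add: square_int_def sq_norm_def)

lemma square_int_add:
  assumes "square_int M f" "square_int M g"
  shows "square_int M (\<lambda>x. f x + g x)"
proof -
  have "integrable M (\<lambda>x. 2 * (norm (f x))\<^sup>2 + 2 * (norm (g x))\<^sup>2)"
    using assms by (auto simp: square_int_def)
  then have "integrable M (\<lambda>x. (norm (f x + g x))\<^sup>2)"
    by (rule Bochner_Integration.integrable_bound)
       (use assms norm_add_sq_le in \<open>auto simp: square_int_def intro!: AE_I2\<close>)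
  then show ?thesis using assms by (auto simp: square_int_def)
qed

lemma square_int_scaleR:
  assumes "square_int M f"
  shows "square_int M (\<lambda>x. c *\<^sub>R f x)" "sq_norm M (\<lambda>x. c *\<^sub>R f x) = c\<^sup>2 * sq_norm M f"
  using assms by (auto simp: square_int_def sq_norm_def power_mult_distrib)

lemma square_int_cmult:
  fixes f :: "'a \<Rightarrow> real"
  assumes "square_int M f"
  shows "square_int M (\<lambda>x. c * f x)" "sq_norm M (\<lambda>x. c * f x) = c\<^sup>2 * sq_norm M f"
  using square_int_scaleR[OF assms, of c] by auto

lemma square_int_minus:
  assumes "square_int M f"
  shows "square_int M (\<lambda>x. - f x)" "sq_norm M (\<lambda>x. - f x) = sq_norm M f"
  using assms by (auto simp: square_int_def sq_norm_def)

lemma square_int_diff: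
  assumes "square_int M f" "square_int M g"
  shows "square_int M (\<lambda>x. f x - g x)"
  using square_int_add[OF assms(1) square_int_minus(1)[OF assms(2)]] by simp

lemma sq_norm_add_le:
  assumes "square_int M f" "square_int M g"
  shows "sq_norm M (\<lambda>x. f x + g x) \<le> 2 * sq_norm M f + 2 * sq_norm M g"
proof -
  have "sq_norm M (\<lambda>x. f x + g x) \<le> (\<integral>x. 2 * (norm (f x))\<^sup>2 + 2 * (norm (g x))\<^sup>2 \<partial>M)"
    unfolding sq_norm_def
    using assms square_int_add[OF assms] by (intro integral_mono norm_add_sq_le) (auto simp: square_int_def)
  then show ?thesis using assms by (simp add: square_int_def sq_norm_def)
qed

lemma sq_norm_diff_le:
  assumes "square_int M f" "square_int M g"
  shows "sq_norm M (\<lambda>x. f x - g x) \<le> 2 * sq_norm M f + 2 * sq_norm M g"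
  using sq_norm_add_le[OF assms(1) square_int_minus(1)[OF assms(2)]] square_int_minus(2)[OF assms(2)] by simp

lemma sq_norm_triangle:
  assumes "square_int M f" "square_int M g" "square_int M h"
  shows "sq_norm M (\<lambda>x. f x - h x) \<le> 2 * sq_norm M (\<lambda>x. f x - g x) + 2 * sq_norm M (\<lambda>x. g x - h x)"
  using sq_norm_add_le[OF square_int_diff[OF assms(1,2)] square_int_diff[OF assms(2,3)]] by simp

lemma sq_norm_cong_AE:
  assumes "AE x in M. f x = g x" "f \<in> borel_measurable M" "g \<in> borel_measurable M"
  shows "sq_norm M f = sq_norm M g"
  unfolding sq_norm_def using assms by (intro integral_cong_AE) auto

lemma sq_norm_eq_0_iff:
  assumes "square_int M f"
  shows "sq_norm M f = 0 \<longleftrightarrow> (AE x in M. f x = 0)"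
  unfolding sq_norm_def using assms
  by (subst integral_nonneg_eq_0_iff_AE) (auto simp: square_int_def)

lemma inner_integrable:
  assumes "square_int M f" "square_int M g"
  shows "integrable M (\<lambda>x. f x \<bullet> g x)"
proof (rule Bochner_Integration.integrable_bound[where f="\<lambda>x. (norm (f x))\<^sup>2 + (norm (g x))\<^sup>2"])
  show "integrable M (\<lambda>x. (norm (f x))\<^sup>2 + (norm (g x))\<^sup>2)"
    using assms by (auto simp: square_int_def)
  show "(\<lambda>x. f x \<bullet> g x) \<in> borel_measurable M" using assms by (auto simp: square_int_def)
  have "\<bar>a \<bullet> b\<bar> \<le> (norm a)\<^sup>2 + (norm b)\<^sup>2" for a b :: 'b
  proof -
    have "\<bar>a \<bullet> b\<bar> \<le> norm a * norm b" by (rule Cauchy_Schwarz_ineq2)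
    moreover have "2 * (norm a * norm b) \<le> (norm a)\<^sup>2 + (norm b)\<^sup>2"
      using sum_squares_bound[of "norm a" "norm b"] by simp
    moreover have "0 \<le> norm a * norm b" by simp
    ultimately show ?thesis by linarith
  qed
  then show "AE x in M. norm (f x \<bullet> g x) \<le> norm ((norm (f x))\<^sup>2 + (norm (g x))\<^sup>2)"
    by (auto intro!: AE_I2)
qed

lemma mult_integrable:
  fixes f g :: "'a \<Rightarrow> real"
  assumes "square_int M f" "square_int M g"
  shows "integrable M (\<lambda>x. f x * g x)"
  using inner_integrable[OF assms] by simp

lemma sq_norm_diff_scaleR:
  assumes "square_int M f" "square_int M g"
  shows "sq_norm M (\<lambda>x. f x - t *\<^sub>R g x) = sq_norm M f - 2 * t * (\<integral>x. f x \<bullet> g x \<partial>M) + t\<^sup>2 * sq_norm M g"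
proof -
  have "(norm (a - t *\<^sub>R b))\<^sup>2 = (norm a)\<^sup>2 - (2 * t) * (a \<bullet> b) + t\<^sup>2 * (norm b)\<^sup>2" for a b :: 'b
    unfolding power2_norm_eq_inner
    by (simp add: inner_diff_left inner_diff_right inner_commute algebra_simps power2_eq_square)
  then show ?thesis
    unfolding sq_norm_def using assms inner_integrable[OF assms]
    by (simp add: square_int_def)
qed

lemma sq_norm_diff_expand:
  assumes "square_int M f" "square_int M g"
  shows "sq_norm M (\<lambda>x. f x - g x) = sq_norm M f - 2 * (\<integral>x. f x \<bullet> g x \<partial>M) + sq_norm M g"
  using sq_norm_diff_scaleR[OF assms, of 1] by simp

text \<open>The quadratic \<open>t \<mapsto> \<integral>|f - t g|\<^sup>2\<close> is nonnegative; it is evaluated at its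
  minimum, or far out if it degenerates to a linear function.\<close>

lemma inner_Cauchy_Schwarz:
  assumes "square_int M f" "square_int M g"
  shows "(\<integral>x. f x \<bullet> g x \<partial>M)\<^sup>2 \<le> sq_norm M f * sq_norm M g"
proof -
  let ?I = "\<integral>x. f x \<bullet> g x \<partial>M"
  have q: "0 \<le> sq_norm M f - 2 * t * ?I + t\<^sup>2 * sq_norm M g" for t
    using sq_norm_diff_scaleR[OF assms, of t] sq_norm_nonneg by metis
  show ?thesis
  proof (cases "sq_norm M g = 0")
    case True
    have "?I = 0"
    proof (rule ccontr)
      assume n: "?I \<noteq> 0"
      from q[of "(sq_norm M f + 1) / (2 * ?I)"] n True show False by simp
    qed
    then show ?thesis by simp
  next
    case False
    then have "sq_norm M g > 0" using sq_norm_nonneg[of M g] by linarith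
    then show ?thesis using q[of "?I / sq_norm M g"] by (simp add: field_simps power2_eq_square)
  qed
qed

lemma abs_inner_le:
  assumes "square_int M f" "square_int M g"
  shows "\<bar>\<integral>x. f x \<bullet> g x \<partial>M\<bar> \<le> sqrt (sq_norm M f) * sqrt (sq_norm M g)"
  using real_sqrt_le_mono[OF inner_Cauchy_Schwarz[OF assms]] by (simp add: real_sqrt_mult)

lemma inner_tendsto:
  assumes f: "\<And>n. square_int M (f n)" "square_int M f'" and g: "square_int M g"
    and lim: "(\<lambda>n. sq_norm M (\<lambda>x. f n x - f' x)) \<longlonglongrightarrow> 0"
  shows "(\<lambda>n. \<integral>x. f n x \<bullet> g x \<partial>M) \<longlonglongrightarrow> (\<integral>x. f' x \<bullet> g x \<partial>M)"
proof -
  have "(\<lambda>n. \<integral>x. (f n x - f' x) \<bullet> g x \<partial>M) \<longlonglongrightarrow> 0"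
  proof (rule Lim_null_comparison)
    show "\<forall>\<^sub>F n in sequentially. norm (\<integral>x. (f n x - f' x) \<bullet> g x \<partial>M) \<le> sqrt (sq_norm M (\<lambda>x. f n x - f' x)) * sqrt (sq_norm M g)"
      using abs_inner_le[OF square_int_diff[OF f] g] by (auto intro!: always_eventually)
    show "(\<lambda>n. sqrt (sq_norm M (\<lambda>x. f n x - f' x)) * sqrt (sq_norm M g)) \<longlonglongrightarrow> 0"
      using tendsto_mult_left_zero[OF tendsto_real_sqrt[OF lim, simplified]] by simp
  qed
  moreover have "(\<integral>x. (f n x - f' x) \<bullet> g x \<partial>M) = (\<integral>x. f n x \<bullet> g x \<partial>M) - (\<integral>x. f' x \<bullet> g x \<partial>M)" for n
    by (simp add: inner_diff_left inner_integrable f g)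
  ultimately show ?thesis by (simp add: LIM_zero_iff)
qed

lemma mult_tendsto:
  fixes f :: "nat \<Rightarrow> 'a \<Rightarrow> real"
  assumes "\<And>n. square_int M (f n)" "square_int M f'" "square_int M g"
    "(\<lambda>n. sq_norm M (\<lambda>x. f n x - f' x)) \<longlonglongrightarrow> 0"
  shows "(\<lambda>n. \<integral>x. f n x * g x \<partial>M) \<longlonglongrightarrow> (\<integral>x. f' x * g x \<partial>M)"
  using inner_tendsto[OF assms] by simp

lemma sq_norm_AE_subseq:
  assumes f: "\<And>n. square_int M (f n)" "square_int M f'"
    and lim: "(\<lambda>n. sq_norm M (\<lambda>x. f n x - f' x)) \<longlonglongrightarrow> 0"
  obtains r where "strict_mono r" "AE x in M. (\<lambda>n. f (r n) x) \<longlonglongrightarrow> f' x"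
proof -
  have i: "integrable M (\<lambda>x. (norm (f n x - f' x))\<^sup>2)" for n
    using square_int_diff[OF f, of n] by (simp add: square_int_def)
  have "(\<lambda>n. \<integral>x. norm ((norm (f n x - f' x))\<^sup>2) \<partial>M) \<longlonglongrightarrow> 0"
    using lim unfolding sq_norm_def by (simp only: real_norm_def abs_power2)
  then obtain r where r: "strict_mono r" "AE x in M. (\<lambda>n. (norm (f (r n) x - f' x))\<^sup>2) \<longlonglongrightarrow> 0"
    using tendsto_L1_AE_subseq[of M "\<lambda>n x. (norm (f n x - f' x))\<^sup>2", OF i] by blast
  have "AE x in M. (\<lambda>n. f (r n) x) \<longlonglongrightarrow> f' x"
    using r(2)
  proof eventually_elim
    case (elim x)
    then have "(\<lambda>n. sqrt ((norm (f (r n) x - f' x))\<^sup>2)) \<longlonglongrightarrow> sqrt 0" by (intro tendsto_intros)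
    then have "(\<lambda>n. norm (f (r n) x - f' x)) \<longlonglongrightarrow> 0" by simp
    then show ?case using LIM_zero_cancel tendsto_norm_zero_iff by blast
  qed
  then show ?thesis using r that by blast
qed

lemma sq_norm_dominated_convergence:
  assumes meas: "\<And>n. f n \<in> borel_measurable M" "f' \<in> borel_measurable M" and w: "square_int M w"
    and bd: "\<And>n. AE x in M. norm (f n x) \<le> norm (w x)"
    and lim: "AE x in M. (\<lambda>n. f n x) \<longlonglongrightarrow> f' x"
  shows "square_int M f'" "(\<lambda>n. sq_norm M (\<lambda>x. f n x - f' x)) \<longlonglongrightarrow> 0"
proof -
  have bd': "AE x in M. \<forall>n. norm (f n x) \<le> norm (w x)" using bd by (simp add: AE_all_countable)
  have bd2: "AE x in M. norm (f' x) \<le> norm (w x)"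
    using bd' lim
  proof eventually_elim
    case (elim x)
    show ?case by (rule LIMSEQ_le_const2[OF tendsto_norm[OF elim(2)]]) (use elim(1) in auto)
  qed
  show "square_int M f'" by (rule square_int_mono[OF w meas(2) bd2])
  have "(\<lambda>n. \<integral>x. (norm (f n x - f' x))\<^sup>2 \<partial>M) \<longlonglongrightarrow> (\<integral>x. 0 \<partial>M)"
  proof (rule integral_dominated_convergence[where w="\<lambda>x. 4 * (norm (w x))\<^sup>2"])
    show "integrable M (\<lambda>x. 4 * (norm (w x))\<^sup>2)" using w by (auto simp: square_int_def)
    show "AE x in M. (\<lambda>n. (norm (f n x - f' x))\<^sup>2) \<longlonglongrightarrow> 0"
      using lim
    proof eventually_elim
      case (elim x)
      then have "(\<lambda>n. (norm (f n x - f' x))\<^sup>2) \<longlonglongrightarrow> (norm (f' x - f' x))\<^sup>2" by (intro tendsto_intros)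
      then show ?case by simp
    qed
    show "AE x in M. norm ((norm (f n x - f' x))\<^sup>2) \<le> 4 * (norm (w x))\<^sup>2" for n
      using bd' bd2
    proof eventually_elim
      case (elim x)
      have "norm (f n x - f' x) \<le> 2 * norm (w x)"
        using norm_triangle_ineq4[of "f n x" "f' x"] elim(1)[rule_format, of n] elim(2) by linarith
      then have "(norm (f n x - f' x))\<^sup>2 \<le> (2 * norm (w x))\<^sup>2" by (intro power_mono) auto
      then show ?case by (simp add: power_mult_distrib)
    qed
  qed (use meas in auto)
  then show "(\<lambda>n. sq_norm M (\<lambda>x. f n x - f' x)) \<longlonglongrightarrow> 0" by (simp add: sq_norm_def)
qed

text \<open>Dominated convergence in \<open>L\<^sup>2\<close> with moving majorants \<open>q\<^sub>n\<close>. The excess of \<open>|f\<^sub>n - f|\<close> over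
  \<open>|q\<^sub>n - q|\<close> is bounded by the fixed function \<open>2 |q|\<close>.\<close>

lemma sq_norm_moving_dominated_convergence:
  assumes meas: "\<And>n. f n \<in> borel_measurable M" "f' \<in> borel_measurable M"
    and q: "\<And>n. square_int M (q n)" "square_int M q'" "(\<lambda>n. sq_norm M (\<lambda>x. q n x - q' x)) \<longlonglongrightarrow> 0"
    and bd: "\<And>n. AE x in M. norm (f n x) \<le> norm (q n x)"
    and bd': "AE x in M. norm (f' x) \<le> norm (q' x)"
    and lim: "AE x in M. (\<lambda>n. f n x) \<longlonglongrightarrow> f' x"
  shows "(\<lambda>n. sq_norm M (\<lambda>x. f n x - f' x)) \<longlonglongrightarrow> 0"
proof -
  define e where "e n x = max 0 (norm (f n x - f' x) - norm (q n x - q' x))" for n x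
  have qm[measurable]: "q n \<in> borel_measurable M" "q' \<in> borel_measurable M" for n using q by (auto simp: square_int_def)
  note meas[measurable]
  have f: "square_int M (f n)" "square_int M f'" for n
    using square_int_mono[OF q(1) meas(1) bd] square_int_mono[OF q(2) meas(2) bd'] by auto
  have e: "e n \<in> borel_measurable M" for n unfolding e_def by measurable
  have w: "square_int M (\<lambda>x. 2 *\<^sub>R q' x)" by (rule square_int_scaleR[OF q(2)])
  have ebd: "AE x in M. norm (e n x) \<le> norm (2 *\<^sub>R q' x)" for n
    using bd[of n] bd'
  proof eventually_elim
    case (elim x)
    have "norm (f n x - f' x) \<le> norm (f n x) + norm (f' x)" by (rule norm_triangle_ineq4)
    moreover have "norm (q n x) \<le> norm (q n x - q' x) + norm (q' x)"
      using norm_triangle_ineq[of "q n x - q' x" "q' x"] by simp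
    ultimately show ?case using elim by (auto simp: e_def max_def)
  qed
  have elim0: "AE x in M. (\<lambda>n. e n x) \<longlonglongrightarrow> 0"
    using lim
  proof eventually_elim
    case (elim x)
    have "(\<lambda>n. norm (f n x - f' x)) \<longlonglongrightarrow> 0" using elim LIM_zero tendsto_norm_zero by blast
    then show ?case by (rule Lim_null_comparison[rotated]) (auto simp: e_def)
  qed
  have E: "(\<lambda>n. sq_norm M (e n)) \<longlonglongrightarrow> 0"
    using sq_norm_dominated_convergence(2)[OF e _ w ebd elim0] by simp
  have en: "square_int M (e n)" for n by (rule square_int_mono[OF w e ebd])
  have qn: "square_int M (\<lambda>x. norm (q n x - q' x))" for n
    using square_int_diff[OF q(1,2)] by (auto simp: square_int_def)
  show ?thesis
  proof (rule Lim_null_comparison)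
    show "\<forall>\<^sub>F n in sequentially. norm (sq_norm M (\<lambda>x. f n x - f' x)) \<le> 2 * sq_norm M (e n) + 2 * sq_norm M (\<lambda>x. q n x - q' x)"
    proof (intro always_eventually allI)
      fix n
      have "sq_norm M (\<lambda>x. f n x - f' x) \<le> sq_norm M (\<lambda>x. e n x + norm (q n x - q' x))"
      proof (rule square_int_mono(2)[OF square_int_add[OF en qn] _ AE_I2])
        fix x show "norm (f n x - f' x) \<le> norm (e n x + norm (q n x - q' x))"
          by (auto simp: e_def max_def)
      qed auto
      also have "\<dots> \<le> 2 * sq_norm M (e n) + 2 * sq_norm M (\<lambda>x. norm (q n x - q' x))" by (rule sq_norm_add_le[OF en qn])
      finally show "norm (sq_norm M (\<lambda>x. f n x - f' x)) \<le> 2 * sq_norm M (e n) + 2 * sq_norm M (\<lambda>x. q n x - q' x)"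
        by (simp add: sq_norm_def)
    qed
    show "(\<lambda>n. 2 * sq_norm M (e n) + 2 * sq_norm M (\<lambda>x. q n x - q' x)) \<longlonglongrightarrow> 0"
      by (rule tendsto_eq_intros E q(3) refl | simp)+
  qed
qed

text \<open>Riesz--Fischer. Multiplying by a positive square integrable weight turns a Cauchy sequence in
  \<open>L\<^sup>2\<close> into one in \<open>L\<^sup>1\<close>, which has an almost everywhere convergent subsequence; Fatou's lemma
  then gives convergence in \<open>L\<^sup>2\<close>.\<close>

lemma square_int_complete:
  fixes f :: "nat \<Rightarrow> 'a \<Rightarrow> 'b::euclidean_space"
  assumes sf: "sigma_finite_measure M" and f: "\<And>n. square_int M (f n)"
    and cau: "\<And>e. e > 0 \<Longrightarrow> \<exists>N. \<forall>k\<ge>N. \<forall>n\<ge>N. sq_norm M (\<lambda>x. f k x - f n x) < e"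
  obtains f' where "square_int M f'" "(\<lambda>n. sq_norm M (\<lambda>x. f n x - f' x)) \<longlonglongrightarrow> 0"
proof -
  \<comment> \<open>The square root \<open>v\<close> of an integrable positive function is the
    weight.\<close>
  obtain w :: "'a \<Rightarrow> real" where w: "w \<in> borel_measurable M" "\<And>x. w x > 0" "\<And>x. w x \<le> 1" "integrable M w"
    using sigma_finite_measure.obtain_positive_integrable_function[OF sf] by metis
  have fm[measurable]: "f n \<in> borel_measurable M" for n using f by (auto simp: square_int_def)
  note w(1)[measurable]
  define v where "v x = sqrt (w x)" for x
  have v: "square_int M v" "\<And>x. v x > 0" using w by (auto simp: square_int_def v_def[abs_def] less_imp_le)
  then have vm[measurable]: "v \<in> borel_measurable M" by (simp add: square_int_def)
  have nf: "square_int M (\<lambda>x. norm (f n x))" "square_int M (\<lambda>x. norm (f n x - f k x))" for n k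
    using f[of n] square_int_diff[OF f f] by (auto simp: square_int_def)
  define s where "s n x = v x *\<^sub>R f n x" for n x
  have si: "integrable M (s n)" for n
    unfolding s_def
    by (rule Bochner_Integration.integrable_bound[OF mult_integrable[OF v(1) nf(1)[of n]]]) (auto intro: AE_I2)
  have bound: "(LINT x|M. norm (s i x - s j x)) \<le> sqrt (sq_norm M v) * sqrt (sq_norm M (\<lambda>x. f i x - f j x))" for i j
  proof -
    have "(LINT x|M. norm (s i x - s j x)) = (LINT x|M. v x \<bullet> norm (f i x - f j x))"
    proof (rule Bochner_Integration.integral_cong[OF refl])
      fix x show "norm (s i x - s j x) = v x \<bullet> norm (f i x - f j x)"
        using v(2)[of x] by (simp add: s_def real_vector.scale_right_diff_distrib[symmetric])
    qed
    also have "\<dots> \<le> sqrt (sq_norm M v) * sqrt (sq_norm M (\<lambda>x. norm (f i x - f j x)))"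
      using abs_inner_le[OF v(1) nf(2)[of i j]] by linarith
    finally show ?thesis by (simp add: sq_norm_def)
  qed
  have "\<exists>N. \<forall>i\<ge>N. \<forall>j\<ge>N. (LINT x|M. norm (s i x - s j x)) < e" if "e > 0" for e
  proof -
    let ?d = "e / (sqrt (sq_norm M v) + 1)"
    have d: "?d > 0" using that by (intro divide_pos_pos add_nonneg_pos) auto
    then obtain N where N: "\<forall>k\<ge>N. \<forall>n\<ge>N. sq_norm M (\<lambda>x. f k x - f n x) < ?d\<^sup>2" using cau[of "?d\<^sup>2"] zero_less_power by blast
    have "(LINT x|M. norm (s i x - s j x)) < e" if ij: "i \<ge> N" "j \<ge> N" for i j
    proof -
      have "sqrt (sq_norm M (\<lambda>x. f i x - f j x)) < ?d"
        using N ij d by (metis real_less_lsqrt less_imp_le)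
      then have "sqrt (sq_norm M v) * sqrt (sq_norm M (\<lambda>x. f i x - f j x)) \<le> sqrt (sq_norm M v) * ?d"
        by (intro mult_left_mono) auto
      also have "\<dots> < (sqrt (sq_norm M v) + 1) * ?d" using d by (simp only: mult_less_cancel_right_pos less_add_one)
      also have "\<dots> = e" using real_sqrt_ge_zero[OF sq_norm_nonneg[of M v]] by (auto simp: add_nonneg_eq_0_iff)
      finally show ?thesis using bound[of i j] by linarith
    qed
    then show ?thesis by blast
  qed
  then obtain r where r: "strict_mono r" "AE x in M. Cauchy (\<lambda>i. s (r i) x)"
    using cauchy_L1_AE_cauchy_subseq[of M s, OF si] by metis
  have conv: "AE x in M. convergent (\<lambda>i. f (r i) x)"
    using r(2)
  proof eventually_elim
    case (elim x)
    then obtain l where "(\<lambda>i. s (r i) x) \<longlonglongrightarrow> l" using Cauchy_convergent convergent_def by blast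
    then have "(\<lambda>i. (1 / v x) *\<^sub>R s (r i) x) \<longlonglongrightarrow> (1 / v x) *\<^sub>R l" by (intro tendsto_intros)
    then have "convergent (\<lambda>i. (1 / v x) *\<^sub>R s (r i) x)" by (auto simp: convergent_def)
    moreover have "(1 / v x) *\<^sub>R s (r i) x = f (r i) x" for i using v(2)[of x] by (simp add: s_def)
    ultimately show ?case by simp
  qed
  define f' where "f' x = lim (\<lambda>i. f (r i) x)" for x
  have f'm[measurable]: "f' \<in> borel_measurable M" unfolding f'_def by measurable
  have lim: "AE x in M. (\<lambda>i. f (r i) x) \<longlonglongrightarrow> f' x"
    using conv by eventually_elim (simp add: f'_def convergent_LIMSEQ_iff)
  have main: "square_int M (\<lambda>x. f n x - f' x) \<and> sq_norm M (\<lambda>x. f n x - f' x) \<le> e"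
    if N: "\<forall>k\<ge>N. \<forall>n\<ge>N. sq_norm M (\<lambda>x. f k x - f n x) < e" "n \<ge> N" for N e n
  proof -
    have e0: "0 \<le> e" using N sq_norm_nonneg by (metis less_eq_real_def order_le_less_trans)
    have "(\<integral>\<^sup>+x. ennreal ((norm (f n x - f' x))\<^sup>2) \<partial>M) \<le> (\<integral>\<^sup>+x. liminf (\<lambda>i. ennreal ((norm (f n x - f (r i) x))\<^sup>2)) \<partial>M)"
    proof (rule nn_integral_mono_AE, use lim in eventually_elim)
      case (elim x)
      have "(\<lambda>i. ennreal ((norm (f n x - f (r i) x))\<^sup>2)) \<longlonglongrightarrow> ennreal ((norm (f n x - f' x))\<^sup>2)"
        using elim by (intro tendsto_intros)
      then show ?case by (metis lim_imp_Liminf order_refl trivial_limit_sequentially)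
    qed
    also have "\<dots> \<le> liminf (\<lambda>i. \<integral>\<^sup>+x. ennreal ((norm (f n x - f (r i) x))\<^sup>2) \<partial>M)"
      by (rule nn_integral_liminf) auto
    also have "\<dots> \<le> ennreal e"
    proof -
      have "\<forall>\<^sub>F i in sequentially. (\<integral>\<^sup>+x. ennreal ((norm (f n x - f (r i) x))\<^sup>2) \<partial>M) \<le> ennreal e"
        using eventually_ge_at_top[of N]
      proof eventually_elim
        case (elim i)
        then have "r i \<ge> N" using seq_suble[OF r(1)] le_trans by blast
        then have "sq_norm M (\<lambda>x. f n x - f (r i) x) \<le> e" using N by (simp add: less_imp_le)
        moreover have "(\<integral>\<^sup>+x. ennreal ((norm (f n x - f (r i) x))\<^sup>2) \<partial>M) = ennreal (sq_norm M (\<lambda>x. f n x - f (r i) x))"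
          unfolding sq_norm_def using square_int_diff[OF f f, of n "r i"]
          by (intro nn_integral_eq_integral) (auto simp: square_int_def)
        ultimately show ?case using ennreal_leI by simp
      qed
      then have "limsup (\<lambda>i. \<integral>\<^sup>+x. ennreal ((norm (f n x - f (r i) x))\<^sup>2) \<partial>M) \<le> ennreal e"
        by (rule Limsup_bounded)
      then show ?thesis using Liminf_le_Limsup[of sequentially] by (meson order_trans sequentially_bot)
    qed
    finally have le: "(\<integral>\<^sup>+x. ennreal ((norm (f n x - f' x))\<^sup>2) \<partial>M) \<le> ennreal e" .
    have int: "integrable M (\<lambda>x. (norm (f n x - f' x))\<^sup>2)"
    proof (rule integrableI_bounded)
      show "(\<integral>\<^sup>+ x. ennreal (norm ((norm (f n x - f' x))\<^sup>2)) \<partial>M) < \<infinity>"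
        using le by (simp add: le_less_trans[OF _ ennreal_less_top])
    qed auto
    moreover have "sq_norm M (\<lambda>x. f n x - f' x) \<le> e"
    proof -
      have "ennreal (sq_norm M (\<lambda>x. f n x - f' x)) = (\<integral>\<^sup>+x. ennreal ((norm (f n x - f' x))\<^sup>2) \<partial>M)"
        unfolding sq_norm_def by (rule nn_integral_eq_integral[symmetric, OF int]) auto
      then show ?thesis using le e0 by (metis ennreal_le_iff)
    qed
    ultimately show ?thesis by (auto simp: square_int_def)
  qed
  obtain N where N: "\<forall>k\<ge>N. \<forall>n\<ge>N. sq_norm M (\<lambda>x. f k x - f n x) < 1" using cau[of 1] by auto
  have "square_int M (\<lambda>x. f N x - (f N x - f' x))"
    by (rule square_int_diff[OF f]) (use main[OF N, of N] in auto)
  then have "square_int M f'" by simp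
  moreover have "(\<lambda>n. sq_norm M (\<lambda>x. f n x - f' x)) \<longlonglongrightarrow> 0"
  proof (rule LIMSEQ_I)
    fix e :: real assume "e > 0"
    then obtain N where N: "\<forall>k\<ge>N. \<forall>n\<ge>N. sq_norm M (\<lambda>x. f k x - f n x) < e / 2" using cau[of "e/2"] by auto
    have "\<forall>n\<ge>N. norm (sq_norm M (\<lambda>x. f n x - f' x) - 0) < e"
    proof (intro allI impI)
      fix n assume "n \<ge> N"
      from main[OF N this] have "sq_norm M (\<lambda>x. f n x - f' x) \<le> e / 2" by blast
      then show "norm (sq_norm M (\<lambda>x. f n x - f' x) - 0) < e" using \<open>e > 0\<close> by simp
    qed
    then show "\<exists>N. \<forall>n\<ge>N. norm (sq_norm M (\<lambda>x. f n x - f' x) - 0) < e" by blast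
  qed
  ultimately show ?thesis using that by blast
qed

section \<open>Continuity of translations in \<open>L\<^sup>2\<close>\<close>

definition cont_cs :: "('a::euclidean_space \<Rightarrow> real) \<Rightarrow> bool" where
  "cont_cs f \<longleftrightarrow> continuous_on UNIV f \<and> (\<exists>R. \<forall>x. norm x > R \<longrightarrow> f x = 0)"

lemma cont_cs_bounded:
  assumes "cont_cs f"
  obtains B where "\<And>x. \<bar>f x\<bar> \<le> B"
proof -
  obtain R where R: "\<And>x. norm x > R \<Longrightarrow> f x = 0" using assms by (auto simp: cont_cs_def)
  have "compact (f ` cball 0 R)"
    using assms by (intro compact_continuous_image) (auto simp: cont_cs_def intro: continuous_on_subset)
  then obtain B where B: "\<forall>y\<in>f ` cball 0 R. norm y \<le> B" using compact_imp_bounded bounded_iff by metis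
  have "\<bar>f x\<bar> \<le> max B 0" for x using B R[of x] by (cases "norm x > R") (auto simp: le_max_iff_disj)
  then show ?thesis using that by blast
qed

lemma square_int_indicator:
  assumes "A \<in> sets M" "emeasure M A < \<infinity>"
  shows "square_int M (\<lambda>x. c * indicator A x :: real)"
proof (rule square_int_cmult)
  have "integrable M (indicator A :: _ \<Rightarrow> real)" using assms by (simp add: integrable_indicator_iff)
  moreover have "(\<lambda>x. (norm (indicator A x :: real))\<^sup>2) = indicator A" by (auto split: split_indicator)
  ultimately show "square_int M (indicator A :: _ \<Rightarrow> real)" using assms by (simp add: square_int_def)
qed

lemma bounded_support_square_int:
  fixes f :: "'a::euclidean_space \<Rightarrow> 'b::euclidean_space"
  assumes "f \<in> borel_measurable borel" "\<And>x. norm (f x) \<le> B" "\<And>x. norm x > R \<Longrightarrow> f x = 0"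
  shows "square_int lborel f"
proof (rule square_int_mono(1))
  show "square_int lborel (\<lambda>x. B * indicator (cball 0 R) x :: real)"
    using emeasure_bounded_finite[OF bounded_cball] by (intro square_int_indicator) simp_all
  show "AE x in lborel. norm (f x) \<le> norm (B * indicator (cball 0 R) x :: real)"
  proof (rule AE_I2)
    fix x show "norm (f x) \<le> norm (B * indicator (cball 0 R) x :: real)"
      using assms(2)[of x] assms(3)[of x] by (auto split: split_indicator)
  qed
qed (use assms in simp)

lemma cont_cs_square_int:
  assumes "cont_cs f" shows "square_int lborel f"
proof -
  obtain B where "\<And>x. \<bar>f x\<bar> \<le> B" using cont_cs_bounded[OF assms] by blast
  moreover obtain R where "\<And>x. norm x > R \<Longrightarrow> f x = 0" using assms by (auto simp: cont_cs_def)
  ultimately show ?thesis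
    using assms by (intro bounded_support_square_int[of f B R]) (auto simp: cont_cs_def intro: borel_measurable_continuous_onI)
qed

lemma cont_cs_zero: "cont_cs (\<lambda>x. 0)"
  by (simp add: cont_cs_def)

lemma cont_cs_add: "cont_cs f \<Longrightarrow> cont_cs g \<Longrightarrow> cont_cs (\<lambda>x. f x + g x)"
proof -
  assume "cont_cs f" "cont_cs g"
  then obtain R R' where R: "\<And>x. norm x > R \<Longrightarrow> f x = 0" "\<And>x. norm x > R' \<Longrightarrow> g x = 0"
    "continuous_on UNIV f" "continuous_on UNIV g" by (auto simp: cont_cs_def)
  then show ?thesis unfolding cont_cs_def
    by (intro conjI continuous_intros exI[of _ "max R R'"]) auto
qed

lemma cont_cs_cmult: "cont_cs f \<Longrightarrow> cont_cs (\<lambda>x. c * f x)"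
  unfolding cont_cs_def by (auto intro!: continuous_intros)

text \<open>The closure of the continuous functions with compact support in \<open>L\<^sup>2\<close>. It is shown to
  contain indicators of compact sets, of bounded Borel sets, and finally every square integrable function.\<close>

definition cs_approx :: "('a::euclidean_space \<Rightarrow> real) \<Rightarrow> bool" where
  "cs_approx f \<longleftrightarrow> square_int lborel f \<and> (\<forall>e>0. \<exists>\<phi>. cont_cs \<phi> \<and> sq_norm lborel (\<lambda>x. f x - \<phi> x) < e)"

lemma cs_approx_cont_cs: "cont_cs f \<Longrightarrow> cs_approx f"
  unfolding cs_approx_def by (auto intro!: exI[of _ f] cont_cs_square_int)

lemma cs_approx_closed:
  assumes "square_int lborel f" "\<And>e. e > 0 \<Longrightarrow> \<exists>g. cs_approx g \<and> sq_norm lborel (\<lambda>x. f x - g x) < e"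
  shows "cs_approx f"
  unfolding cs_approx_def
proof (intro conjI assms allI impI)
  fix e :: real assume e: "e > 0"
  then obtain g where g: "cs_approx g" "sq_norm lborel (\<lambda>x. f x - g x) < e / 4" using assms(2)[of "e/4"] by auto
  then obtain \<phi> where p: "cont_cs \<phi>" "sq_norm lborel (\<lambda>x. g x - \<phi> x) < e / 4"
    using e unfolding cs_approx_def by (metis zero_less_divide_iff zero_less_numeral)
  have "sq_norm lborel (\<lambda>x. f x - \<phi> x) \<le> 2 * sq_norm lborel (\<lambda>x. f x - g x) + 2 * sq_norm lborel (\<lambda>x. g x - \<phi> x)"
    using g assms p by (intro sq_norm_triangle) (auto simp: cs_approx_def intro: cont_cs_square_int)
  then show "\<exists>\<phi>. cont_cs \<phi> \<and> sq_norm lborel (\<lambda>x. f x - \<phi> x) < e"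
    using p g by (intro exI[of _ \<phi>]) auto
qed

lemma cs_approx_lim:
  assumes "square_int lborel f" "\<And>n. cs_approx (g n)" "(\<lambda>n. sq_norm lborel (\<lambda>x. g n x - f x)) \<longlonglongrightarrow> 0"
  shows "cs_approx f"
proof (rule cs_approx_closed[OF assms(1)])
  fix e :: real assume "e > 0"
  then have "\<forall>\<^sub>F n in sequentially. sq_norm lborel (\<lambda>x. g n x - f x) < e"
    using order_tendstoD(2)[OF assms(3)] by auto
  then obtain n where "sq_norm lborel (\<lambda>x. g n x - f x) < e"
    using eventually_happens trivial_limit_sequentially by blast
  moreover have "sq_norm lborel (\<lambda>x. g n x - f x) = sq_norm lborel (\<lambda>x. f x - g n x)"
    by (simp add: sq_norm_def power2_commute)
  ultimately show "\<exists>g. cs_approx g \<and> sq_norm lborel (\<lambda>x. f x - g x) < e" using assms(2) by auto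
qed

lemma cs_approx_add:
  assumes "cs_approx f" "cs_approx g"
  shows "cs_approx (\<lambda>x. f x + g x)"
  unfolding cs_approx_def
proof (intro conjI allI impI)
  show "square_int lborel (\<lambda>x. f x + g x)" using assms by (intro square_int_add) (auto simp: cs_approx_def)
  fix e :: real assume "e > 0"
  then have e: "e / 4 > 0" by simp
  obtain \<phi> \<psi> where p: "cont_cs \<phi>" "sq_norm lborel (\<lambda>x. f x - \<phi> x) < e / 4" "cont_cs \<psi>" "sq_norm lborel (\<lambda>x. g x - \<psi> x) < e / 4"
    using assms e unfolding cs_approx_def by metis
  have "sq_norm lborel (\<lambda>x. (f x - \<phi> x) + (g x - \<psi> x)) \<le> 2 * sq_norm lborel (\<lambda>x. f x - \<phi> x) + 2 * sq_norm lborel (\<lambda>x. g x - \<psi> x)"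
    using assms p by (intro sq_norm_add_le square_int_diff) (auto simp: cs_approx_def intro: cont_cs_square_int)
  then have "sq_norm lborel (\<lambda>x. (f x + g x) - (\<phi> x + \<psi> x)) < e" using p by (simp add: algebra_simps)
  then show "\<exists>\<phi>. cont_cs \<phi> \<and> sq_norm lborel (\<lambda>x. (f x + g x) - \<phi> x) < e" using cont_cs_add[OF p(1,3)] by blast
qed

lemma cs_approx_cmult:
  assumes "cs_approx f"
  shows "cs_approx (\<lambda>x. c * f x)"
proof (rule cs_approx_closed)
  show "square_int lborel (\<lambda>x. c * f x)" using assms by (intro square_int_cmult) (auto simp: cs_approx_def)
  fix e :: real assume "e > 0"
  then have e: "e / (c\<^sup>2 + 1) > 0" by (intro divide_pos_pos) (auto intro: add_nonneg_pos)
  obtain \<phi> where p: "cont_cs \<phi>" "sq_norm lborel (\<lambda>x. f x - \<phi> x) < e / (c\<^sup>2 + 1)"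
    using assms e unfolding cs_approx_def by metis
  have "sq_norm lborel (\<lambda>x. c * f x - c * \<phi> x) = c\<^sup>2 * sq_norm lborel (\<lambda>x. f x - \<phi> x)"
    using square_int_cmult(2)[OF square_int_diff[of lborel f \<phi>], of c] assms cont_cs_square_int[OF p(1)]
    by (simp add: right_diff_distrib cs_approx_def)
  also have "\<dots> \<le> (c\<^sup>2 + 1) * sq_norm lborel (\<lambda>x. f x - \<phi> x)" by (intro mult_right_mono) auto
  also have "\<dots> < e" using p(2) by (subst mult.commute, subst (asm) pos_less_divide_eq) (auto intro: add_nonneg_pos)
  finally show "\<exists>g. cs_approx g \<and> sq_norm lborel (\<lambda>x. c * f x - g x) < e"
    using cs_approx_cont_cs[OF cont_cs_cmult[OF p(1)]] by blast
qed

text \<open>The indicator of \<open>K\<close> is the decreasing limit of the functions \<open>max 0 (1 - n dist(x,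
  K))\<close>.\<close>

lemma cs_approx_compact:
  fixes K :: "'a::euclidean_space set"
  assumes "compact K" shows "cs_approx (indicator K :: 'a \<Rightarrow> real)"
proof (cases "K = {}")
  case True
  have "cs_approx (\<lambda>x. 0)" by (rule cs_approx_cont_cs[OF cont_cs_zero])
  moreover have "indicator K = (\<lambda>x. 0 :: real)" using True by auto
  ultimately show ?thesis by simp
next
  case False
  define g where "g n x = max 0 (1 - real (Suc n) * infdist x K)" for n :: nat and x
  obtain R where R: "\<And>x. x \<in> K \<Longrightarrow> norm x \<le> R"
    using compact_imp_bounded[OF assms] bounded_iff by metis
  have g0: "g n x = 0" if "norm x > R + 1" for n x
  proof -
    obtain k where k: "k \<in> K" "infdist x K = dist x k"
      using infdist_attains_inf[OF compact_imp_closed[OF assms] False] by metis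
    have "norm x \<le> norm k + dist x k" by (metis dist_norm norm_triangle_sub)
    then have "infdist x K \<ge> 1" using that R[OF k(1)] k by linarith
    then have "real (Suc n) * infdist x K \<ge> 1 * 1" by (intro mult_mono) auto
    then show ?thesis by (simp add: g_def)
  qed
  have gc: "cont_cs (g n)" for n
    unfolding cont_cs_def using g0 by (auto simp: g_def intro!: continuous_intros exI[of _ "R+1"])
  have bd: "norm (g n x) \<le> norm (g 0 x)" for n x
  proof -
    have "1 * infdist x K \<le> real (Suc n) * infdist x K" by (intro mult_right_mono) (auto simp: infdist_nonneg)
    then show ?thesis by (simp add: g_def)
  qed
  have lim: "(\<lambda>n. g n x) \<longlonglongrightarrow> indicator K x" for x
  proof (cases "x \<in> K")
    case True then show ?thesis by (simp add: g_def)
  next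
    case False
    then have d: "infdist x K > 0"
      using infdist_pos_not_in_closed[OF compact_imp_closed[OF assms] \<open>K \<noteq> {}\<close>] by blast
    obtain N where "1 / infdist x K < real N" using reals_Archimedean2 by blast
    then have N: "1 < real N * infdist x K" using d by (simp add: field_simps)
    have "\<forall>\<^sub>F n in sequentially. g n x = 0"
      using eventually_ge_at_top[of N]
    proof eventually_elim
      case (elim n)
      then have "real N * infdist x K \<le> real (Suc n) * infdist x K" using d by (intro mult_right_mono) auto
      then show ?case using N by (simp add: g_def)
    qed
    then show ?thesis using False by (simp add: tendsto_eventually)
  qed
  have m: "indicator K \<in> borel_measurable lborel" using borel_compact[OF assms] by (simp add: borel_measurable_indicator)
  have gm: "g n \<in> borel_measurable lborel" for n by (rule square_int_meas[OF cont_cs_square_int[OF gc]])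
  have ae: "AE x in lborel. norm (g n x) \<le> norm (g 0 x)" "AE x in lborel. (\<lambda>n. g n x) \<longlonglongrightarrow> indicator K x" for n
    using bd lim by (auto intro!: AE_I2)
  note dc = sq_norm_dominated_convergence[OF gm m cont_cs_square_int[OF gc] ae]
  show ?thesis by (rule cs_approx_lim[OF dc(1) cs_approx_cont_cs[OF gc] dc(2)])
qed

lemma cs_approx_indicator:
  fixes A :: "'a::euclidean_space set"
  assumes A: "A \<in> sets borel" "bounded A" shows "cs_approx (indicator A :: 'a \<Rightarrow> real)"
proof (rule cs_approx_closed)
  have fin: "emeasure lborel S < \<infinity>" if "bounded S" for S :: "'a set"
    using emeasure_bounded_finite[OF that] by simp
  show "square_int lborel (indicator A :: 'a \<Rightarrow> real)"
    using square_int_indicator[of A lborel 1] A fin by simp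
  fix e :: real assume e: "e > 0"
  obtain T where T: "closed T" "T \<subseteq> A" "emeasure lebesgue (A - T) < ennreal e"
  proof -
    have "A \<in> sets lebesgue" using A by simp
    then show ?thesis using sets_lebesgue_inner_closed[OF _ e] that by metis
  qed
  have "compact T" using T A by (meson bounded_subset compact_eq_bounded_closed)
  then have "cs_approx (indicator T :: 'a \<Rightarrow> real)" by (rule cs_approx_compact)
  moreover have "sq_norm lborel (\<lambda>x. indicator A x - indicator T x :: real) < e"
  proof -
    have s: "A - T \<in> sets borel" using A T by auto
    have "(\<lambda>x. (norm (indicator A x - indicator T x :: real))\<^sup>2) = indicator (A - T)"
    proof
      fix x show "(norm (indicator A x - indicator T x :: real))\<^sup>2 = indicator (A - T) x"
        using T(2) by (auto simp: indicator_def)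
    qed
    then have eq: "sq_norm lborel (\<lambda>x. indicator A x - indicator T x :: real) = measure lborel (A - T)"
      using s by (simp add: sq_norm_def)
    have "emeasure lborel (A - T) < ennreal e" using T(3) s by simp
    moreover from this have "emeasure lborel (A - T) = ennreal (measure lborel (A - T))"
      by (intro emeasure_eq_ennreal_measure) auto
    ultimately have "measure lborel (A - T) < e" by (simp add: ennreal_less_iff)
    then show ?thesis using eq by simp
  qed
  ultimately show "\<exists>g. cs_approx g \<and> sq_norm lborel (\<lambda>x. indicator A x - g x :: real) < e" by blast
qed

lemma cs_approx_sum:
  assumes "finite I" "\<And>i. i \<in> I \<Longrightarrow> cs_approx (f i)"
  shows "cs_approx (\<lambda>x. \<Sum>i\<in>I. f i x)"
  using assms by (induction I rule: finite_induct) (auto intro: cs_approx_add cs_approx_cont_cs[OF cont_cs_zero])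

text \<open>Truncation reduces to functions with bounded support, and these are limits of dominated simple functions,
  whose level sets off zero are bounded Borel sets.\<close>

proposition continuous_dense_in_L2:
  fixes f :: "'a::euclidean_space \<Rightarrow> real"
  assumes "square_int lborel f" "e > 0"
  obtains \<phi> where "cont_cs \<phi>" "sq_norm lborel (\<lambda>x. f x - \<phi> x) < e"
proof -
  have fm[measurable]: "f \<in> borel_measurable borel" using assms by (simp add: square_int_def)
  have bs: "cs_approx h" if h: "square_int lborel h" "\<And>x. norm x > R \<Longrightarrow> h x = 0" for h :: "'a \<Rightarrow> real" and R
  proof -
    have hm: "h \<in> borel_measurable lborel" using h by (simp add: square_int_def)
    obtain F where F': "\<forall>i. simple_function lborel (F i)" "\<forall>x\<in>space lborel. (\<lambda>i. F i x) \<longlonglongrightarrow> h x"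
        "\<forall>i. \<forall>x\<in>space lborel. dist (F i x) 0 \<le> 2 * dist (h x) 0"
      using borel_measurable_implies_sequence_metric[OF hm, of 0] by blast
    then have F: "\<And>i. simple_function lborel (F i)" "\<And>x. (\<lambda>i. F i x) \<longlonglongrightarrow> h x" "\<And>i x. \<bar>F i x\<bar> \<le> \<bar>2 * h x\<bar>"
      by (auto simp: abs_mult)
    have Fa: "cs_approx (F i)" for i
    proof -
      have fin: "finite (range (F i))" using simple_functionD(1)[OF F(1)[of i]] by simp
      have "cs_approx (\<lambda>x. y * indicator (F i -` {y}) x)" for y
      proof (cases "y = 0")
        case True
        show ?thesis unfolding True mult_zero_left by (rule cs_approx_cont_cs[OF cont_cs_zero])
      next
        case False
        have "F i -` {y} \<subseteq> cball 0 R"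
        proof
          fix x assume "x \<in> F i -` {y}"
          then have "h x \<noteq> 0" using F(3)[of i x] False by auto
          then show "x \<in> cball 0 R" using h(2)[of x] by (auto simp: not_less[symmetric])
        qed
        then have "bounded (F i -` {y})" using bounded_cball bounded_subset by blast
        moreover have "F i -` {y} \<in> sets borel" using simple_functionD(2)[OF F(1)[of i], of "{y}"] by simp
        ultimately show ?thesis by (intro cs_approx_cmult cs_approx_indicator)
      qed
      then have "cs_approx (\<lambda>x. \<Sum>y\<in>range (F i). y * indicator (F i -` {y}) x)"
        using fin by (intro cs_approx_sum)
      moreover have "(\<lambda>x. \<Sum>y\<in>range (F i). y * indicator (F i -` {y}) x) = F i"
      proof
        fix x
        have "y * indicator (F i -` {y}) x = (if y = F i x then y else 0)" for y by (auto simp: indicator_def)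
        then show "(\<Sum>y\<in>range (F i). y * indicator (F i -` {y}) x) = F i x"
          by (simp only: sum.delta[OF fin]) simp
      qed
      ultimately show ?thesis by simp
    qed
    have w: "square_int lborel (\<lambda>x. 2 * h x)" by (rule square_int_cmult[OF h(1)])
    have Fm: "F i \<in> borel_measurable lborel" for i using Fa by (simp add: cs_approx_def square_int_def)
    have ae: "AE x in lborel. norm (F i x) \<le> norm (2 * h x)" "AE x in lborel. (\<lambda>i. F i x) \<longlonglongrightarrow> h x" for i
      using F by (auto intro!: AE_I2)
    show ?thesis by (rule cs_approx_lim[OF h(1) Fa sq_norm_dominated_convergence(2)[OF Fm hm w ae]])
  qed
  define g where "g n x = indicator (cball 0 (real n)) x * f x" for n x
  have gm: "g n \<in> borel_measurable lborel" for n
    unfolding g_def using fm by (intro borel_measurable_times borel_measurable_indicator) auto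
  have gb: "norm (g n x) \<le> norm (f x)" for n x by (auto simp: g_def split: split_indicator)
  have gs: "square_int lborel (g n)" for n by (rule square_int_mono(1)[OF assms(1) gm AE_I2]) (rule gb)
  have ga: "cs_approx (g n)" for n
    by (rule bs[OF gs, of "real n"]) (auto simp: g_def)
  have glim: "(\<lambda>n. g n x) \<longlonglongrightarrow> f x" for x
  proof -
    obtain N where N: "norm x \<le> real N" using real_arch_simple by blast
    have "\<forall>\<^sub>F n in sequentially. g n x = f x"
      using eventually_ge_at_top[of N] by eventually_elim (use N in \<open>simp add: g_def\<close>)
    then show ?thesis by (rule tendsto_eventually)
  qed
  have fm': "f \<in> borel_measurable lborel" by simp
  have "cs_approx f"
    by (rule cs_approx_lim[OF assms(1) ga sq_norm_dominated_convergence(2)[OF gm fm' assms(1) AE_I2 AE_I2]])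
      (rule gb glim)+
  then show ?thesis using assms(2) that unfolding cs_approx_def by blast
qed

lemma lborel_integral_shift:
  fixes f :: "'a::euclidean_space \<Rightarrow> 'b::{banach, second_countable_topology}"
  shows "(\<integral>x. f (x + c) \<partial>lborel) = integral\<^sup>L lborel f"
proof (cases "f \<in> borel_measurable borel")
  case True
  have "integral\<^sup>L lborel f = integral\<^sup>L (distr lborel borel ((+) c)) f" by (simp add: lborel_distr_plus)
  also have "\<dots> = (\<integral>x. f (c + x) \<partial>lborel)" by (rule integral_distr) (use True in auto)
  finally show ?thesis by (simp add: add.commute)
next
  case False
  have "(\<lambda>x. f (x + c)) \<notin> borel_measurable borel"
  proof
    assume "(\<lambda>x. f (x + c)) \<in> borel_measurable borel"
    then have "(\<lambda>x. f ((x - c) + c)) \<in> borel_measurable borel"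
      by (rule measurable_compose[rotated]) simp
    with False show False by simp
  qed
  with False have "\<not> integrable lborel f" "\<not> integrable lborel (\<lambda>x. f (x + c))"
    by (auto dest: borel_measurable_integrable)
  then show ?thesis by (simp add: not_integrable_integral_eq)
qed

lemma lborel_integrable_shift:
  fixes f :: "'a::euclidean_space \<Rightarrow> 'b::{banach, second_countable_topology}"
  assumes "integrable lborel f" shows "integrable lborel (\<lambda>x. f (x + c))"
proof -
  have "integrable (distr lborel borel ((+) c)) f" using assms by (simp add: lborel_distr_plus)
  then have "integrable lborel (\<lambda>x. f (c + x))" by (rule integrable_distr[rotated]) simp
  then show ?thesis by (simp add: add.commute)
qed

lemma square_int_shift:
  fixes f :: "'a::euclidean_space \<Rightarrow> 'b::euclidean_space"
  assumes "square_int lborel f"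
  shows "square_int lborel (\<lambda>x. f (x + c))" "sq_norm lborel (\<lambda>x. f (x + c)) = sq_norm lborel f"
proof -
  have [measurable]: "f \<in> borel_measurable borel" using assms by (simp add: square_int_def)
  have "integrable lborel (\<lambda>x. (norm (f (x + c)))\<^sup>2)"
    using lborel_integrable_shift[of "\<lambda>x. (norm (f x))\<^sup>2" c] assms by (simp add: square_int_def)
  moreover have "(\<lambda>x. f (x + c)) \<in> borel_measurable borel"
    by measurable
  ultimately show "square_int lborel (\<lambda>x. f (x + c))" by (simp add: square_int_def)
  show "sq_norm lborel (\<lambda>x. f (x + c)) = sq_norm lborel f"
    unfolding sq_norm_def by (rule lborel_integral_shift)
qed

text \<open>For continuous functions with compact support this is dominated convergence; density extends it to
  \<open>L\<^sup>2\<close>, because translations are isometries.\<close>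

lemma translation_tendsto_real:
  fixes f :: "'a::euclidean_space \<Rightarrow> real"
  assumes f: "square_int lborel f" and c: "c \<longlonglongrightarrow> 0"
  shows "(\<lambda>n. sq_norm lborel (\<lambda>x. f (x + c n) - f x)) \<longlonglongrightarrow> 0"
proof -
  have cc: "(\<lambda>n. sq_norm lborel (\<lambda>x. \<phi> (x + c n) - \<phi> x)) \<longlonglongrightarrow> 0" if p: "cont_cs \<phi>" for \<phi> :: "'a \<Rightarrow> real"
  proof -
    obtain B where B: "\<And>x. \<bar>\<phi> x\<bar> \<le> B" using cont_cs_bounded[OF p] by blast
    obtain R where R: "\<And>x. norm x > R \<Longrightarrow> \<phi> x = 0" using p by (auto simp: cont_cs_def)
    have cont: "continuous_on UNIV \<phi>" using p by (simp add: cont_cs_def)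
    obtain C where C: "\<And>n. norm (c n) \<le> C" using c by (meson Bseq_def convergentI convergent_imp_Bseq)
    have pm: "\<phi> \<in> borel_measurable lborel" using cont by (simp add: borel_measurable_continuous_onI)
    have m: "(\<lambda>x. \<phi> (x + c n)) \<in> borel_measurable lborel" for n
      using square_int_shift(1)[OF cont_cs_square_int[OF p]] by (simp add: square_int_def)
    show ?thesis
    proof (rule sq_norm_dominated_convergence(2)[OF m pm])
      show "square_int lborel (\<lambda>x. B * indicator (cball 0 (R + C)) x :: real)"
        using emeasure_bounded_finite[OF bounded_cball] by (intro square_int_indicator) simp_all
      show "AE x in lborel. norm (\<phi> (x + c n)) \<le> norm (B * indicator (cball 0 (R + C)) x :: real)" for n
      proof (rule AE_I2)
        fix x
        show "norm (\<phi> (x + c n)) \<le> norm (B * indicator (cball 0 (R + C)) x :: real)"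
        proof (cases "norm x > R + C")
          case True
          have "norm x \<le> norm (x + c n) + norm (c n)" using norm_triangle_ineq4[of "x + c n" "c n"] by simp
          then have "norm (x + c n) > R" using True C[of n] by linarith
          then show ?thesis using R by simp
        next
          case False
          then show ?thesis using B[of "x + c n"] by simp
        qed
      qed
      show "AE x in lborel. (\<lambda>n. \<phi> (x + c n)) \<longlonglongrightarrow> \<phi> x"
      proof (rule AE_I2)
        fix x
        have "(\<lambda>n. x + c n) \<longlonglongrightarrow> x + 0" by (intro tendsto_intros c)
        then show "(\<lambda>n. \<phi> (x + c n)) \<longlonglongrightarrow> \<phi> x"
          using continuous_on_tendsto_compose[OF cont] by simp
      qed
    qed
  qed
  show ?thesis
  proof (rule LIMSEQ_I)
    fix e :: real assume e: "e > 0"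
    obtain \<phi> where p: "cont_cs \<phi>" "sq_norm lborel (\<lambda>x. f x - \<phi> x) < e / 12"
      using continuous_dense_in_L2[OF f, of "e/12"] e by auto
    note ps = cont_cs_square_int[OF p(1)]
    obtain N where N: "\<And>n. n \<ge> N \<Longrightarrow> sq_norm lborel (\<lambda>x. \<phi> (x + c n) - \<phi> x) < e / 8"
      using LIMSEQ_D[OF cc[OF p(1)], of "e/8"] e by auto
    have "norm (sq_norm lborel (\<lambda>x. f (x + c n) - f x) - 0) < e" if "n \<ge> N" for n
    proof -
      have "sq_norm lborel (\<lambda>x. f (x + c n) - f x) \<le> 2 * sq_norm lborel (\<lambda>x. f (x + c n) - \<phi> (x + c n)) + 2 * sq_norm lborel (\<lambda>x. \<phi> (x + c n) - f x)"
        by (intro sq_norm_triangle square_int_shift f ps)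
      also have "sq_norm lborel (\<lambda>x. f (x + c n) - \<phi> (x + c n)) = sq_norm lborel (\<lambda>x. f x - \<phi> x)"
        using square_int_shift(2)[OF square_int_diff[OF f ps]] by simp
      also have "sq_norm lborel (\<lambda>x. \<phi> (x + c n) - f x) \<le> 2 * sq_norm lborel (\<lambda>x. \<phi> (x + c n) - \<phi> x) + 2 * sq_norm lborel (\<lambda>x. \<phi> x - f x)"
        by (intro sq_norm_triangle square_int_shift f ps)
      also have "sq_norm lborel (\<lambda>x. \<phi> x - f x) = sq_norm lborel (\<lambda>x. f x - \<phi> x)"
        by (simp add: sq_norm_def power2_commute)
      finally show ?thesis using N[OF that] p(2) sq_norm_nonneg by auto
    qed
    then show "\<exists>N. \<forall>n\<ge>N. norm (sq_norm lborel (\<lambda>x. f (x + c n) - f x) - 0) < e" by blast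
  qed
qed

lemma square_int_inner:
  assumes "square_int M f" shows "square_int M (\<lambda>x. f x \<bullet> b)"
proof (rule square_int_mono(1)[OF square_int_scaleR(1)[OF assms, of "norm b"] _ AE_I2])
  show "(\<lambda>x. f x \<bullet> b) \<in> borel_measurable M" using assms by (auto simp: square_int_def)
  show "norm (f x \<bullet> b) \<le> norm (norm b *\<^sub>R f x)" for x
    using Cauchy_Schwarz_ineq2[of "f x" b] by (simp add: mult.commute)
qed

lemma sq_norm_components:
  assumes "square_int M f"
  shows "sq_norm M f = (\<Sum>b\<in>Basis. sq_norm M (\<lambda>x. f x \<bullet> b))"
proof -
  have "(norm z)\<^sup>2 = (\<Sum>b\<in>Basis. (norm (z \<bullet> b))\<^sup>2)" for z :: 'b
    unfolding power2_norm_eq_inner by (subst euclidean_inner) (simp add: power2_eq_square)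
  then show ?thesis
    unfolding sq_norm_def using square_int_inner[OF assms] by (simp add: square_int_def)
qed

proposition translation_tendsto:
  fixes f :: "'a::euclidean_space \<Rightarrow> 'b::euclidean_space"
  assumes f: "square_int lborel f" and c: "c \<longlonglongrightarrow> 0"
  shows "(\<lambda>n. sq_norm lborel (\<lambda>x. f (x + c n) - f x)) \<longlonglongrightarrow> 0"
proof -
  have "(\<lambda>n. \<Sum>b\<in>Basis. sq_norm lborel (\<lambda>x. f (x + c n) \<bullet> b - f x \<bullet> b)) \<longlonglongrightarrow> (\<Sum>b\<in>(Basis::'b set). 0)"
    by (intro tendsto_sum translation_tendsto_real square_int_inner f c)
  then show ?thesis
    by (subst sq_norm_components) (auto intro!: square_int_diff square_int_shift f simp: inner_diff_left)
qed

corollary translation_uniform: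
  fixes f :: "'a::euclidean_space \<Rightarrow> 'b::euclidean_space"
  assumes f: "square_int lborel f" and e: "e > 0"
  obtains d where "d > 0" "\<And>c. norm c < d \<Longrightarrow> sq_norm lborel (\<lambda>x. f (x + c) - f x) < e"
proof (rule ccontr)
  assume "\<not> thesis"
  then have "\<exists>c. norm c < 1 / real (Suc n) \<and> \<not> sq_norm lborel (\<lambda>x. f (x + c) - f x) < e" for n
    using that by (metis zero_less_divide_1_iff of_nat_0_less_iff zero_less_Suc)
  then obtain c where c: "\<And>n. norm (c n) < 1 / real (Suc n)" "\<And>n. \<not> sq_norm lborel (\<lambda>x. f (x + c n) - f x) < e"
    by metis
  have "c \<longlonglongrightarrow> 0"
    by (rule Lim_null_comparison[OF _ LIMSEQ_Suc[OF lim_1_over_n]]) (use c(1) in \<open>auto intro!: always_eventually less_imp_le\<close>)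
  then have "\<forall>\<^sub>F n in sequentially. sq_norm lborel (\<lambda>x. f (x + c n) - f x) < e"
    using order_tendstoD(2)[OF translation_tendsto[OF f]] e by blast
  then show False using c(2) eventually_happens trivial_limit_sequentially by blast
qed

section \<open>Averages over translations\<close>

text \<open>The convolution of \<open>f\<close> with the reflection of \<open>\<mu>\<close>.\<close>

definition avg :: "'a::euclidean_space measure \<Rightarrow> ('a \<Rightarrow> 'b::euclidean_space) \<Rightarrow> 'a \<Rightarrow> 'b" where
  "avg \<mu> f y = (\<integral>z. f (y + z) \<partial>\<mu>)"

locale averaging = finite_measure \<mu> for \<mu> :: "'a::euclidean_space measure" +
  assumes sets_borel [measurable_cong]: "sets \<mu> = sets borel" and mass_one: "measure \<mu> UNIV = 1"
begin

lemma space_UNIV [simp]: "space \<mu> = UNIV"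
  using sets_eq_imp_space_eq[OF sets_borel] by simp

sublocale pair_sigma_finite \<mu> lborel ..

text \<open>Jensen's inequality for the square, by the Cauchy--Schwarz inequality against the constant one. If
  \<open>|h|\<^sup>2\<close> is not integrable, the right-hand side is infinite.\<close>

lemma norm_integral_sq_le:
  fixes h :: "'a \<Rightarrow> 'b::euclidean_space"
  assumes [measurable]: "h \<in> borel_measurable borel"
  shows "ennreal ((norm (\<integral>z. h z \<partial>\<mu>))\<^sup>2) \<le> (\<integral>\<^sup>+z. ennreal ((norm (h z))\<^sup>2) \<partial>\<mu>)"
proof (cases "integrable \<mu> (\<lambda>z. (norm (h z))\<^sup>2)")
  case True
  then have h: "square_int \<mu> (\<lambda>z. norm (h z))" by (auto simp: square_int_def)
  have one: "square_int \<mu> (\<lambda>z. 1 :: real)" "sq_norm \<mu> (\<lambda>z. 1 :: real) = 1"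
    by (auto simp: square_int_def sq_norm_def mass_one)
  have "(norm (\<integral>z. h z \<partial>\<mu>))\<^sup>2 \<le> (\<integral>z. norm (h z) \<partial>\<mu>)\<^sup>2"
    by (intro power_mono integral_norm_bound) auto
  also have "\<dots> \<le> sq_norm \<mu> (\<lambda>z. norm (h z)) * 1"
    using inner_Cauchy_Schwarz[OF h one(1)] one(2) by simp
  finally have "ennreal ((norm (\<integral>z. h z \<partial>\<mu>))\<^sup>2) \<le> ennreal (\<integral>z. (norm (h z))\<^sup>2 \<partial>\<mu>)"
    by (simp add: sq_norm_def ennreal_leI)
  also have "\<dots> = (\<integral>\<^sup>+z. ennreal ((norm (h z))\<^sup>2) \<partial>\<mu>)"
    using True by (intro nn_integral_eq_integral[symmetric]) auto
  finally show ?thesis .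
next
  case False
  have "(\<integral>\<^sup>+z. ennreal ((norm (h z))\<^sup>2) \<partial>\<mu>) = \<infinity>"
  proof (rule ccontr)
    assume "(\<integral>\<^sup>+z. ennreal ((norm (h z))\<^sup>2) \<partial>\<mu>) \<noteq> \<infinity>"
    then have "integrable \<mu> (\<lambda>z. (norm (h z))\<^sup>2)"
      by (intro integrableI_bounded) (auto simp: less_top)
    with False show False by simp
  qed
  then show ?thesis by simp
qed

lemma avg_measurable [measurable]:
  assumes [measurable]: "f \<in> borel_measurable borel"
  shows "avg \<mu> f \<in> borel_measurable borel"
  unfolding avg_def[abs_def] by measurable

lemma AE_avg_integrable:
  fixes f :: "'a \<Rightarrow> 'b::euclidean_space"
  assumes f: "square_int lborel f"
  shows "AE y in lborel. integrable \<mu> (\<lambda>z. f (y + z))"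
proof -
  have [measurable]: "f \<in> borel_measurable borel" using f by (simp add: square_int_def)
  have "(\<integral>\<^sup>+y. \<integral>\<^sup>+z. ennreal ((norm (f (y + z)))\<^sup>2) \<partial>\<mu> \<partial>lborel) = (\<integral>\<^sup>+z. \<integral>\<^sup>+y. ennreal ((norm (f (y + z)))\<^sup>2) \<partial>lborel \<partial>\<mu>)"
    by (rule Fubini') measurable
  also have "\<dots> = (\<integral>\<^sup>+z. ennreal (sq_norm lborel f) \<partial>\<mu>)"
  proof (rule nn_integral_cong)
    fix z
    have "(\<integral>\<^sup>+y. ennreal ((norm (f (y + z)))\<^sup>2) \<partial>lborel) = ennreal (sq_norm lborel (\<lambda>y. f (y + z)))"
      unfolding sq_norm_def using square_int_shift(1)[OF f, of z]
      by (intro nn_integral_eq_integral) (auto simp: square_int_def)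
    then show "(\<integral>\<^sup>+y. ennreal ((norm (f (y + z)))\<^sup>2) \<partial>lborel) = ennreal (sq_norm lborel f)"
      by (simp add: square_int_shift(2)[OF f])
  qed
  also have "\<dots> \<noteq> \<infinity>"
    by (simp add: ennreal_mult_eq_top_iff emeasure_eq_measure)
  finally have "AE y in lborel. (\<integral>\<^sup>+z. ennreal ((norm (f (y + z)))\<^sup>2) \<partial>\<mu>) \<noteq> \<infinity>"
    by (intro nn_integral_PInf_AE) auto
  then show ?thesis
  proof eventually_elim
    case (elim y)
    have "integrable \<mu> (\<lambda>z. (norm (f (y + z)))\<^sup>2)"
      using elim by (intro integrableI_bounded) (auto simp: less_top)
    then have "integrable \<mu> (\<lambda>z. norm (f (y + z)))"
      by (rule square_integrable_imp_integrable[of "\<lambda>z. norm (f (y + z))", rotated]) measurable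
    moreover have "(\<lambda>z. f (y + z)) \<in> borel_measurable \<mu>" by measurable
    ultimately show ?case using integrable_norm_iff by blast
  qed
qed

text \<open>By Jensen's inequality the distance of \<open>f\<close> from its average is at most the largest distance
  of \<open>f\<close> from the translates that are averaged.\<close>

lemma avg_close:
  fixes f :: "'a \<Rightarrow> 'b::euclidean_space"
  assumes f: "square_int lborel f"
    and e: "AE z in \<mu>. sq_norm lborel (\<lambda>x. f (x + z) - f x) \<le> e"
  shows "square_int lborel (avg \<mu> f)" "sq_norm lborel (\<lambda>x. avg \<mu> f x - f x) \<le> e"
proof -
  have [measurable]: "f \<in> borel_measurable borel" using f by (simp add: square_int_def)
  have e0: "0 \<le> e"
  proof (rule ccontr)
    assume "\<not> 0 \<le> e"
    have "AE z in \<mu>. False"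
      using e
    proof eventually_elim
      case (elim z)
      then show ?case using \<open>\<not> 0 \<le> e\<close> sq_norm_nonneg[of lborel "\<lambda>x. f (x + z) - f x"] by linarith
    qed
    then have "emeasure \<mu> UNIV = 0"
      using AE_iff_null[of \<mu> "\<lambda>_. False"] by (auto simp: null_sets_def)
    then show False using mass_one by (simp add: measure_def)
  qed
  have "(\<integral>\<^sup>+y. ennreal ((norm (avg \<mu> f y - f y))\<^sup>2) \<partial>lborel) \<le> (\<integral>\<^sup>+y. \<integral>\<^sup>+z. ennreal ((norm (f (y + z) - f y))\<^sup>2) \<partial>\<mu> \<partial>lborel)"
  proof (rule nn_integral_mono_AE, use AE_avg_integrable[OF f] in eventually_elim)
    case (elim y)
    then have "avg \<mu> f y - f y = (\<integral>z. f (y + z) - f y \<partial>\<mu>)"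
      by (simp add: avg_def mass_one)
    then show ?case using norm_integral_sq_le[of "\<lambda>z. f (y + z) - f y"] by simp
  qed
  also have "\<dots> = (\<integral>\<^sup>+z. \<integral>\<^sup>+y. ennreal ((norm (f (y + z) - f y))\<^sup>2) \<partial>lborel \<partial>\<mu>)"
    by (rule Fubini') measurable
  also have "\<dots> \<le> (\<integral>\<^sup>+z. ennreal e \<partial>\<mu>)"
  proof (rule nn_integral_mono_AE, use e in eventually_elim)
    case (elim z)
    have "(\<integral>\<^sup>+y. ennreal ((norm (f (y + z) - f y))\<^sup>2) \<partial>lborel) = ennreal (sq_norm lborel (\<lambda>y. f (y + z) - f y))"
      unfolding sq_norm_def using square_int_diff[OF square_int_shift(1)[OF f, of z] f]
      by (intro nn_integral_eq_integral) (auto simp: square_int_def)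
    then show ?case using elim by (simp add: ennreal_leI)
  qed
  also have "\<dots> = ennreal e" using mass_one by (simp add: emeasure_eq_measure)
  finally have le: "(\<integral>\<^sup>+y. ennreal ((norm (avg \<mu> f y - f y))\<^sup>2) \<partial>lborel) \<le> ennreal e" .
  have int: "integrable lborel (\<lambda>x. (norm (avg \<mu> f x - f x))\<^sup>2)"
  proof (rule integrableI_bounded)
    show "(\<integral>\<^sup>+ x. ennreal (norm ((norm (avg \<mu> f x - f x))\<^sup>2)) \<partial>lborel) < \<infinity>"
      using le by (simp add: le_less_trans[OF _ ennreal_less_top])
  qed auto
  then have "square_int lborel (\<lambda>x. avg \<mu> f x - f x)" by (auto simp: square_int_def)
  from square_int_add[OF this f] show "square_int lborel (avg \<mu> f)" by simp
  have "ennreal (sq_norm lborel (\<lambda>x. avg \<mu> f x - f x)) \<le> ennreal e"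
    unfolding sq_norm_def using nn_integral_eq_integral[OF int] le by simp
  then show "sq_norm lborel (\<lambda>x. avg \<mu> f x - f x) \<le> e" using e0 by simp
qed

lemma avg_square_int: "square_int lborel f \<Longrightarrow> square_int lborel (avg \<mu> f)"
  by (rule avg_close(1)[where e="2 * sq_norm lborel f + 2 * sq_norm lborel f"])
    (auto intro!: AE_I2 sq_norm_diff_le[THEN order_trans] square_int_shift(1) simp: square_int_shift(2))

lemma avg_inner:
  fixes f \<psi> :: "'a \<Rightarrow> 'b::euclidean_space"
  assumes f: "square_int lborel f" and \<psi>: "square_int lborel \<psi>"
  shows "(\<integral>y. avg \<mu> f y \<bullet> \<psi> y \<partial>lborel) = (\<integral>z. (\<integral>y. f (y + z) \<bullet> \<psi> y \<partial>lborel) \<partial>\<mu>)"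
proof -
  have [measurable]: "f \<in> borel_measurable borel" "\<psi> \<in> borel_measurable borel" using f \<psi> by (auto simp: square_int_def)
  define C where "C = sqrt (sq_norm lborel f) * sqrt (sq_norm lborel \<psi>)"
  have n: "square_int lborel (\<lambda>y. norm (f (y + z)))" "square_int lborel (\<lambda>y. norm (\<psi> y))" for z
    using square_int_shift(1)[OF f, of z] \<psi> by (auto simp: square_int_def)
  have b: "(\<integral>y. norm (f (y + z) \<bullet> \<psi> y) \<partial>lborel) \<le> C" for z
  proof -
    have "(\<integral>y. norm (f (y + z) \<bullet> \<psi> y) \<partial>lborel) \<le> (\<integral>y. norm (f (y + z)) * norm (\<psi> y) \<partial>lborel)"
      using inner_integrable[OF square_int_shift(1)[OF f, of z] \<psi>] mult_integrable[OF n(1)[of z] n(2)]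
      by (intro integral_mono) (auto intro: Cauchy_Schwarz_ineq2)
    also have "\<dots> \<le> sqrt (sq_norm lborel (\<lambda>y. norm (f (y + z)))) * sqrt (sq_norm lborel (\<lambda>y. norm (\<psi> y)))"
      using abs_inner_le[OF n(1)[of z] n(2)] by simp
    also have "\<dots> = C" using square_int_shift(2)[OF f, of z] by (simp add: C_def sq_norm_def)
    finally show ?thesis .
  qed
  have "integrable (\<mu> \<Otimes>\<^sub>M lborel) (\<lambda>(z, y). f (y + z) \<bullet> \<psi> y)"
  proof (rule Fubini_integrable)
    show "integrable \<mu> (\<lambda>z. LINT y|lborel. norm (case (z, y) of (z, y) \<Rightarrow> f (y + z) \<bullet> \<psi> y))"
      by (rule integrable_const_bound[of _ C]) (use b in \<open>auto intro!: AE_I2\<close>)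
    show "AE z in \<mu>. integrable lborel (\<lambda>y. case (z, y) of (z, y) \<Rightarrow> f (y + z) \<bullet> \<psi> y)"
      by (auto intro!: AE_I2 inner_integrable[OF square_int_shift(1)[OF f] \<psi>])
  qed measurable
  then have "(\<integral>z. (\<integral>y. f (y + z) \<bullet> \<psi> y \<partial>lborel) \<partial>\<mu>) = (\<integral>y. (\<integral>z. f (y + z) \<bullet> \<psi> y \<partial>\<mu>) \<partial>lborel)"
    by (rule Fubini_integral[symmetric])
  also have "\<dots> = (\<integral>y. avg \<mu> f y \<bullet> \<psi> y \<partial>lborel)"
  proof (rule integral_cong_AE)
    show "AE y in lborel. (\<integral>z. f (y + z) \<bullet> \<psi> y \<partial>\<mu>) = avg \<mu> f y \<bullet> \<psi> y"
      using AE_avg_integrable[OF f] by eventually_elim (simp add: avg_def)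
  qed measurable
  finally show ?thesis by simp
qed

end

section \<open>Smooth functions\<close>

abbreviation dd :: "('a::euclidean_space \<Rightarrow> real) \<Rightarrow> 'a \<Rightarrow> 'a \<Rightarrow> real" where
  "dd f v x \<equiv> frechet_derivative f (at x) v"

abbreviation smooth :: "('a::euclidean_space \<Rightarrow> real) \<Rightarrow> bool" where
  "smooth f \<equiv> \<forall>k. Ck k f"

lemma Ck_SucI:
  assumes "\<And>x. (f has_derivative f' x) (at x)" "\<And>v. Ck k (\<lambda>x. f' x v)"
  shows "Ck (Suc k) f"
proof -
  have "f' x = frechet_derivative f (at x)" for x by (rule frechet_derivative_at[OF assms(1)])
  then show ?thesis using assms by (auto simp: differentiable_def)
qed

lemma Ck_Suc_deriv: "Ck (Suc k) f \<Longrightarrow> (f has_derivative (\<lambda>v. dd f v x)) (at x)"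
  by (simp add: frechet_derivative_works[symmetric])

lemma Ck_dd: "Ck (Suc k) f \<Longrightarrow> Ck k (dd f v)"
  by simp

lemma Ck_Suc_D: "Ck (Suc k) f \<Longrightarrow> Ck k f"
proof (induction k arbitrary: f)
  case 0
  then show ?case by (auto intro!: continuous_at_imp_continuous_on differentiable_imp_continuous_within)
next
  case (Suc k)
  then show ?case by (metis Ck.simps(2))
qed

lemma Ck_continuous: "Ck k f \<Longrightarrow> continuous_on UNIV f"
  by (induction k) (use Ck_Suc_D in \<open>auto simp del: Ck.simps(2) simp: Ck.simps(1)\<close>)

lemma dd_eq: "(f has_derivative f') (at x) \<Longrightarrow> dd f v x = f' v"
  by (metis frechet_derivative_at)

lemma Ck_const: "Ck k (\<lambda>x. c)"
proof (induction k arbitrary: c)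
  case (Suc k)
  show ?case by (rule Ck_SucI[OF has_derivative_const]) (rule Suc)
qed simp

lemma Ck_add: "Ck k f \<Longrightarrow> Ck k g \<Longrightarrow> Ck k (\<lambda>x. f x + g x)"
proof (induction k arbitrary: f g)
  case 0 then show ?case by (auto intro: continuous_intros)
next
  case (Suc k)
  show ?case
    by (rule Ck_SucI[OF has_derivative_add[OF Ck_Suc_deriv[OF Suc.prems(1)] Ck_Suc_deriv[OF Suc.prems(2)]]])
      (use Suc in auto)
qed

lemma Ck_mult: "Ck k f \<Longrightarrow> Ck k g \<Longrightarrow> Ck k (\<lambda>x. f x * g x)"
proof (induction k arbitrary: f g)
  case 0 then show ?case by (auto intro: continuous_intros)
next
  case (Suc k)
  show ?case
    by (rule Ck_SucI[OF has_derivative_mult[OF Ck_Suc_deriv[OF Suc.prems(1)] Ck_Suc_deriv[OF Suc.prems(2)]]])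
      (intro Ck_add Suc.IH Ck_dd Suc.prems Ck_Suc_D[OF Suc.prems(1)] Ck_Suc_D[OF Suc.prems(2)])
qed

lemma Ck_cmult: "Ck k f \<Longrightarrow> Ck k (\<lambda>x. c * f x)"
  by (intro Ck_mult Ck_const)

lemma Ck_diff: "Ck k f \<Longrightarrow> Ck k g \<Longrightarrow> Ck k (\<lambda>x. f x - g x)"
  using Ck_add[of k f "\<lambda>x. -1 * g x"] Ck_cmult[of k g "-1"] by simp

lemma Ck_sum: "(\<And>i. i \<in> I \<Longrightarrow> Ck k (f i)) \<Longrightarrow> Ck k (\<lambda>x. \<Sum>i\<in>I. f i x)"
  by (induction I rule: infinite_finite_induct) (auto intro: Ck_add Ck_const)

lemma Ck_inner: "Ck k (\<lambda>x. x \<bullet> b)"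
proof (cases k)
  case (Suc m)
  show ?thesis unfolding Suc
    by (rule Ck_SucI[where f'="\<lambda>x v. v \<bullet> b"]) (auto intro!: derivative_eq_intros Ck_const)
qed (auto intro: continuous_intros)

lemma Ck_affine: "Ck k f \<Longrightarrow> Ck k (\<lambda>x. f (a *\<^sub>R x + c))"
proof (induction k arbitrary: f)
  case 0 then show ?case by (auto intro!: continuous_on_compose2[of UNIV f] continuous_intros)
next
  case (Suc k)
  have "((\<lambda>x. f (a *\<^sub>R x + c)) has_derivative (\<lambda>v. dd f (a *\<^sub>R v) (a *\<^sub>R x + c))) (at x)" for x
    by (rule has_derivative_compose[OF _ Ck_Suc_deriv[OF Suc.prems], of "\<lambda>x. a *\<^sub>R x + c" "\<lambda>v. a *\<^sub>R v"])
      (auto intro!: derivative_eq_intros)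
  then show ?case by (rule Ck_SucI) (intro Suc.IH Ck_dd Suc.prems)
qed

lemma dd_affine:
  assumes "Ck (Suc k) f"
  shows "dd (\<lambda>x. f (a *\<^sub>R x + c)) v x = a * dd f v (a *\<^sub>R x + c)"
proof -
  have "((\<lambda>x. f (a *\<^sub>R x + c)) has_derivative (\<lambda>v. dd f (a *\<^sub>R v) (a *\<^sub>R x + c))) (at x)"
    by (rule has_derivative_compose[OF _ Ck_Suc_deriv[OF assms], of "\<lambda>x. a *\<^sub>R x + c" "\<lambda>v. a *\<^sub>R v"])
      (auto intro!: derivative_eq_intros)
  moreover have "linear (\<lambda>v. dd f v (a *\<^sub>R x + c))"
    using Ck_Suc_deriv[OF assms] has_derivative_linear by blast
  ultimately show ?thesis by (simp add: dd_eq linear_scale)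
qed

text \<open>The derivative of \<open>h \<circ> f\<close> is \<open>(h' \<circ> f) \<cdot> \<partial>\<^sub>v f\<close>, to
  which the induction hypothesis applies with \<open>h'\<close> in place of \<open>h\<close>.\<close>

lemma Ck_compose: "Ck k (h :: real \<Rightarrow> real) \<Longrightarrow> Ck k f \<Longrightarrow> Ck k (\<lambda>x. h (f x))"
proof (induction k arbitrary: f h)
  case 0 then show ?case by (auto intro!: continuous_on_compose2[of UNIV h])
next
  case (Suc k)
  have "((\<lambda>x. h (f x)) has_derivative (\<lambda>v. dd f v x * dd h 1 (f x))) (at x)" for x
  proof -
    have "((\<lambda>x. h (f x)) has_derivative (\<lambda>v. dd h (dd f v x) (f x))) (at x)"
      by (rule has_derivative_compose[OF Ck_Suc_deriv[OF Suc.prems(2)] Ck_Suc_deriv[OF Suc.prems(1)]])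
    moreover have "linear (\<lambda>s. dd h s (f x))"
      using Ck_Suc_deriv[OF Suc.prems(1)] has_derivative_linear by blast
    then have "dd h (dd f v x) (f x) = dd f v x * dd h 1 (f x)" for v
      using linear_scale[of "\<lambda>s. dd h s (f x)" "dd f v x" 1] by simp
    ultimately show ?thesis by simp
  qed
  then show ?case
    by (rule Ck_SucI)
      (rule Ck_mult[OF Ck_dd[OF Suc.prems(2)] Suc.IH[OF Ck_dd[OF Suc.prems(1)] Ck_Suc_D[OF Suc.prems(2)]]])
qed

lemma Ck_inverse: "Ck k f \<Longrightarrow> (\<And>x. f x \<noteq> 0) \<Longrightarrow> Ck k (\<lambda>x. inverse (f x))"
proof (induction k)
  case 0 then show ?case by (auto intro!: continuous_intros)
next
  case (Suc k)
  have "((\<lambda>x. inverse (f x)) has_derivative (\<lambda>v. -1 * (inverse (f x) * dd f v x * inverse (f x)))) (at x)" for x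
    using Deriv.has_derivative_inverse[OF Suc.prems(2) Ck_Suc_deriv[OF Suc.prems(1)]] by simp
  then show ?case
    by (rule Ck_SucI)
      (rule Ck_cmult[OF Ck_mult[OF Ck_mult[OF Suc.IH[OF Ck_Suc_D[OF Suc.prems(1)] Suc.prems(2)] Ck_dd[OF Suc.prems(1)]]
        Suc.IH[OF Ck_Suc_D[OF Suc.prems(1)] Suc.prems(2)]]])
qed

lemma Ck_norm_sq: "Ck k (\<lambda>x. (norm (x - c))\<^sup>2)"
proof -
  have "(\<lambda>x. (norm (x - c))\<^sup>2) = (\<lambda>x. \<Sum>b\<in>Basis. (x \<bullet> b - c \<bullet> b) * (x \<bullet> b - c \<bullet> b))"
  proof
    fix x
    show "(norm (x - c))\<^sup>2 = (\<Sum>b\<in>Basis. (x \<bullet> b - c \<bullet> b) * (x \<bullet> b - c \<bullet> b))"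
      unfolding power2_norm_eq_inner by (subst euclidean_inner) (simp add: inner_diff_left)
  qed
  then show ?thesis by (simp add: Ck_sum Ck_mult Ck_diff Ck_inner Ck_const)
qed

text \<open>The functions \<open>t\<^sup>-\<^sup>n exp (-1/t)\<close>, extended by zero to \<open>t \<le> 0\<close>: their derivatives are
  combinations of functions of the same family.\<close>

definition flat :: "nat \<Rightarrow> real \<Rightarrow> real" where
  "flat n t = (if t \<le> 0 then 0 else (1 / t) ^ n * exp (- (1 / t)))"

text \<open>With \<open>u = 1/t\<close> and \<open>N = n + 2\<close>, the inequality \<open>exp u \<ge>
  (u/N)\<^sup>N\<close> shows that \<open>flat n\<close> vanishes to second order at the origin. Hence it is
  differentiable there.\<close>

lemma flat_bound: "\<bar>flat n t\<bar> \<le> real (n + 2) ^ (n + 2) * t\<^sup>2"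
proof (cases "t \<le> 0")
  case False
  define u where "u = 1 / t"
  have u: "u > 0" "t = 1 / u" using False by (auto simp: u_def)
  let ?N = "n + 2"
  define P where "P = real ?N ^ ?N"
  have P: "P > 0" unfolding P_def by (intro zero_less_power) auto
  have "u ^ ?N / P = (u / real ?N) ^ ?N" unfolding P_def by (rule power_divide[symmetric])
  also have "\<dots> \<le> (1 + u / real ?N) ^ ?N" using u by (intro power_mono) auto
  also have "\<dots> \<le> exp u" using u by (intro exp_ge_one_plus_x_over_n_power_n) auto
  finally have "u ^ ?N \<le> P * exp u" using P by (simp add: pos_divide_le_eq mult.commute)
  then have "u ^ ?N * exp (- u) \<le> P" by (simp add: exp_minus inverse_eq_divide pos_divide_le_eq)
  then have "u ^ n * exp (- u) * u\<^sup>2 \<le> P" by (simp add: power_add mult_ac power2_eq_square)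
  then have "u ^ n * exp (- u) \<le> P * t\<^sup>2" using u by (simp add: power_divide pos_le_divide_eq)
  then show ?thesis using False by (simp add: flat_def u_def P_def)
qed (simp add: flat_def)

lemma flat_deriv: "(flat n has_real_derivative (flat (n + 2) t - real n * flat (n + 1) t)) (at t)"
proof -
  consider "t < 0" | "t = 0" | "t > 0" by linarith
  then show ?thesis
  proof cases
    case 1
    have "((\<lambda>t. 0) has_real_derivative 0) (at t)" by simp
    then have "(flat n has_real_derivative 0) (at t)"
      by (rule has_field_derivative_transform_within_open[where S="{..<0}"]) (use 1 in \<open>auto simp: flat_def\<close>)
    then show ?thesis using 1 by (simp add: flat_def)
  next
    case 2
    have "((\<lambda>h. (flat n (0 + h) - flat n 0) / h) \<longlongrightarrow> 0) (at 0)"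
    proof (rule Lim_null_comparison)
      show "\<forall>\<^sub>F h in at 0. norm ((flat n (0 + h) - flat n 0) / h) \<le> real (n + 2) ^ (n + 2) * \<bar>h\<bar>"
      proof (rule always_eventually, rule allI)
        fix h :: real
        show "norm ((flat n (0 + h) - flat n 0) / h) \<le> real (n + 2) ^ (n + 2) * \<bar>h\<bar>"
        proof (cases "h = 0")
          case False
          have "\<bar>flat n h\<bar> \<le> (real (n + 2) ^ (n + 2) * \<bar>h\<bar>) * \<bar>h\<bar>"
            using flat_bound[of n h] by (simp add: power2_eq_square mult_ac)
          then have "\<bar>flat n h\<bar> / \<bar>h\<bar> \<le> real (n + 2) ^ (n + 2) * \<bar>h\<bar>"
            using False by (subst pos_divide_le_eq) auto
          then show ?thesis by (simp add: flat_def[of n 0] abs_divide)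
        qed simp
      qed
      show "((\<lambda>h. real (n + 2) ^ (n + 2) * \<bar>h\<bar>) \<longlongrightarrow> 0) (at 0)"
        by (rule tendsto_eq_intros refl | simp)+
    qed
    then show ?thesis using 2 by (simp add: flat_def DERIV_def)
  next
    case 3
    have "((\<lambda>t. (1 / t) ^ n * exp (- (1 / t))) has_real_derivative
        (flat (n + 2) t - real n * flat (n + 1) t)) (at t)"
    proof -
      define u where "u = 1 / t"
      have d: "((\<lambda>t. 1 / t) has_real_derivative - (u * u)) (at t)"
        using 3 by (auto intro!: derivative_eq_intros simp: u_def)
      have "((\<lambda>t. (1 / t) ^ n * exp (- (1 / t))) has_real_derivative
          real n * (- (u * u) * u ^ (n - Suc 0)) * exp (- u) + exp (- u) * - (- (u * u)) * u ^ n) (at t)"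
        using DERIV_mult[OF DERIV_power[OF d, of n] DERIV_fun_exp[OF DERIV_minus[OF d]]] by (simp add: u_def)
      moreover have "real n * (- (u * u) * u ^ (n - Suc 0)) * exp (- u) + exp (- u) * - (- (u * u)) * u ^ n
          = flat (n + 2) t - real n * flat (n + 1) t"
        using 3 by (cases n) (simp_all add: flat_def u_def[symmetric] algebra_simps)
      ultimately show ?thesis by simp
    qed
    then show ?thesis
      by (rule has_field_derivative_transform_within_open[where S="{0<..}"]) (use 3 in \<open>auto simp: flat_def\<close>)
  qed
qed

lemma Ck_flat: "Ck k (flat n)"
proof (induction k arbitrary: n)
  case 0
  show ?case using flat_deriv[of n] by (auto intro!: continuous_at_imp_continuous_on DERIV_isCont)
next
  case (Suc k)
  have "(flat n has_derivative (\<lambda>v. (flat (n + 2) t - real n * flat (n + 1) t) * v)) (at t)" for t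
    using flat_deriv[of n t] by (simp add: has_field_derivative_def)
  then show ?case by (rule Ck_SucI) (intro Ck_mult Ck_diff Ck_const Suc.IH)
qed

text \<open>A smooth step from 0 on \<open>t \<le> 0\<close> to 1 on \<open>t \<ge> 1\<close>.\<close>

definition step_fun :: "real \<Rightarrow> real" where
  "step_fun t = flat 0 t * inverse (flat 0 t + flat 0 (1 - t))"

lemma flat0_nonneg: "flat 0 t \<ge> 0" and flat0_pos: "t > 0 \<Longrightarrow> flat 0 t > 0" and flat0_zero: "t \<le> 0 \<Longrightarrow> flat 0 t = 0"
  by (auto simp: flat_def)

lemma step_denom: "flat 0 t + flat 0 (1 - t) > 0"
  using flat0_nonneg[of t] flat0_nonneg[of "1 - t"] flat0_pos[of t] flat0_pos[of "1 - t"]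
  by (cases "t > 0") (auto intro: add_pos_nonneg add_nonneg_pos)

lemma step_fun_props:
  "Ck k step_fun" "t \<le> 0 \<Longrightarrow> step_fun t = 0" "1 \<le> t \<Longrightarrow> step_fun t = 1" "0 \<le> step_fun t" "step_fun t \<le> 1"
proof -
  have "Ck k (\<lambda>t. flat 0 ((-1) *\<^sub>R t + 1))" by (rule Ck_affine[OF Ck_flat])
  then have "Ck k (\<lambda>t. flat 0 (1 - t))" by simp
  then show "Ck k step_fun"
    unfolding step_fun_def[abs_def]
    by (intro Ck_mult Ck_inverse Ck_add Ck_flat) (use step_denom in \<open>auto simp: less_imp_neq[symmetric]\<close>)
  show "t \<le> 0 \<Longrightarrow> step_fun t = 0" by (simp add: step_fun_def flat0_zero)
  show "1 \<le> t \<Longrightarrow> step_fun t = 1" using flat0_pos[of t] by (simp add: step_fun_def flat0_zero)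
  show "0 \<le> step_fun t" by (simp add: step_fun_def flat0_nonneg)
  show "step_fun t \<le> 1"
    using step_denom[of t] flat0_nonneg[of "1 - t"] by (simp add: step_fun_def field_simps)
qed

text \<open>The value is 1 within distance \<open>a\<close> of \<open>c\<close> and 0 beyond distance \<open>b\<close>.
  The squared norm makes the function smooth at the centre as well.\<close>

definition cutoff :: "'a::euclidean_space \<Rightarrow> real \<Rightarrow> real \<Rightarrow> 'a \<Rightarrow> real" where
  "cutoff c a b x = step_fun ((b\<^sup>2 - (norm (x - c))\<^sup>2) / (b\<^sup>2 - a\<^sup>2))"

lemma cutoff_props:
  assumes "0 \<le> a" "a < b"
  shows "smooth (cutoff c a b)" "norm (x - c) \<le> a \<Longrightarrow> cutoff c a b x = 1"
    "b \<le> norm (x - c) \<Longrightarrow> cutoff c a b x = 0" "0 \<le> cutoff c a b x" "cutoff c a b x \<le> 1"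
proof -
  have d: "b\<^sup>2 - a\<^sup>2 > 0" using assms by (simp add: power_strict_mono)
  have "Ck k (\<lambda>x. step_fun ((1 / (b\<^sup>2 - a\<^sup>2)) * (b\<^sup>2 - (norm (x - c))\<^sup>2)))" for k
    by (intro Ck_compose[OF step_fun_props(1)] Ck_cmult Ck_diff Ck_const Ck_norm_sq)
  then show "smooth (cutoff c a b)" by (simp add: cutoff_def[abs_def])
  show "cutoff c a b x = 1" if "norm (x - c) \<le> a"
  proof -
    have "(norm (x - c))\<^sup>2 \<le> a\<^sup>2" using that by (intro power_mono) auto
    then show ?thesis using d by (auto simp: cutoff_def intro!: step_fun_props(3))
  qed
  show "cutoff c a b x = 0" if "b \<le> norm (x - c)"
  proof -
    have "b\<^sup>2 \<le> (norm (x - c))\<^sup>2" using that assms by (intro power_mono) auto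
    then show ?thesis using d by (auto simp: cutoff_def intro!: step_fun_props(2) divide_nonpos_pos)
  qed
qed (auto simp: cutoff_def step_fun_props)

section \<open>Classical gradients and test functions\<close>

definition grad :: "('a::euclidean_space \<Rightarrow> real) \<Rightarrow> 'a \<Rightarrow> 'a" where
  "grad f x = (\<Sum>b\<in>Basis. dd f b x *\<^sub>R b)"

lemma grad_inner_Basis: "b \<in> Basis \<Longrightarrow> grad f x \<bullet> b = dd f b x"
  by (simp add: grad_def inner_sum_left inner_Basis if_distrib cong: if_cong)

lemma grad_inner:
  assumes "Ck (Suc k) f" shows "grad f x \<bullet> v = dd f v x"
proof -
  have lin: "linear (\<lambda>v. dd f v x)" using Ck_Suc_deriv[OF assms] has_derivative_linear by blast
  have "dd f v x = dd f (\<Sum>b\<in>Basis. (v \<bullet> b) *\<^sub>R b) x" by (simp only: euclidean_representation)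
  also have "\<dots> = (\<Sum>b\<in>Basis. (v \<bullet> b) * dd f b x)"
    by (simp only: linear_sum[OF lin] linear_scale[OF lin] real_scaleR_def)
  also have "\<dots> = grad f x \<bullet> v"
    unfolding grad_def inner_sum_left by (simp add: inner_commute mult.commute)
  finally show ?thesis by simp
qed

lemma continuous_grad: "Ck (Suc k) f \<Longrightarrow> continuous_on UNIV (grad f)"
  unfolding grad_def[abs_def] by (intro continuous_intros Ck_continuous[OF Ck_dd])

lemma grad_affine:
  assumes "Ck (Suc k) f"
  shows "grad (\<lambda>x. f (a *\<^sub>R x + c)) x = a *\<^sub>R grad f (a *\<^sub>R x + c)"
  by (simp add: grad_def dd_affine[OF assms] scaleR_sum_right)

lemma grad_cong_open:
  assumes "Ck (Suc k) f" "open S" "x \<in> S" "\<And>y. y \<in> S \<Longrightarrow> f y = g y"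
  shows "grad f x = grad g x"
  using frechet_derivative_transform_within_open[of f x S g] Ck_Suc_deriv[OF assms(1), of x] assms
  by (simp add: grad_def differentiable_def)

lemma grad_const: "grad (\<lambda>x. c) x = 0"
  by (simp add: grad_def)

lemma grad_zero_outside:
  assumes "Ck (Suc k) f" "closed K" "\<And>x. x \<notin> K \<Longrightarrow> f x = 0" "x \<notin> K"
  shows "grad f x = 0"
proof -
  have "grad f x = grad (\<lambda>x. 0) x"
    by (rule grad_cong_open[OF assms(1), of "- K"]) (use assms in auto)
  then show ?thesis by (simp add: grad_const)
qed

lemma grad_bounded:
  assumes "Ck (Suc k) f" "\<And>x. norm x > R \<Longrightarrow> f x = 0"
  obtains B where "\<And>x. norm (grad f x) \<le> B" "\<And>x. \<bar>f x\<bar> \<le> B"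
proof -
  have g0: "grad f x = 0" if "norm x > R" for x
    by (rule grad_zero_outside[OF assms(1), of "cball 0 R"]) (use assms(2) that in auto)
  have "compact (grad f ` cball 0 R)" "compact (f ` cball 0 R)"
    by (intro compact_continuous_image continuous_on_subset[OF continuous_grad[OF assms(1)]]
        continuous_on_subset[OF Ck_continuous[OF assms(1)]]; simp)+
  then obtain B B' where "\<forall>y\<in>grad f ` cball 0 R. norm y \<le> B" "\<forall>y\<in>f ` cball 0 R. norm y \<le> B'"
    by (meson compact_imp_bounded bounded_iff)
  then have "norm (grad f x) \<le> max 0 (max B B')" "\<bar>f x\<bar> \<le> max 0 (max B B')" for x
    using g0[of x] assms(2)[of x] by (cases "norm x > R"; auto simp: le_max_iff_disj)+
  then show ?thesis using that by blast
qed

lemma C1_square_int: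
  assumes "Ck (Suc k) f" "\<And>x. norm x > R \<Longrightarrow> f x = 0"
  shows "square_int lborel f" "square_int lborel (grad f)"
proof -
  obtain B where B: "\<And>x. norm (grad f x) \<le> B" "\<And>x. \<bar>f x\<bar> \<le> B" using grad_bounded[OF assms] by blast
  have g0: "grad f x = 0" if "norm x > R" for x
    by (rule grad_zero_outside[OF assms(1), of "cball 0 R"]) (use assms(2) that in auto)
  show "square_int lborel f"
    by (rule bounded_support_square_int[OF borel_measurable_continuous_onI[OF Ck_continuous[OF assms(1)]]])
      (use B assms(2) in auto)
  show "square_int lborel (grad f)"
    by (rule bounded_support_square_int[OF borel_measurable_continuous_onI[OF continuous_grad[OF assms(1)]]])
      (use B g0 in auto)
qed

lemma test_smooth: "\<phi> \<in> test_functions S \<Longrightarrow> Ck k \<phi>"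
  by (simp add: test_functions_def)

lemma test_support:
  assumes "\<phi> \<in> test_functions S"
  obtains K R where "compact K" "K \<subseteq> S" "\<And>x. x \<notin> K \<Longrightarrow> \<phi> x = 0" "\<And>x. x \<notin> K \<Longrightarrow> grad \<phi> x = 0"
    "\<And>x. norm x > R \<Longrightarrow> \<phi> x = 0"
proof -
  obtain K where K: "compact K" "K \<subseteq> S" "\<And>x. x \<notin> K \<Longrightarrow> \<phi> x = 0" using assms by (auto simp: test_functions_def)
  obtain R where "\<And>x. x \<in> K \<Longrightarrow> norm x \<le> R" using compact_imp_bounded[OF K(1)] bounded_iff by metis
  then have "\<And>x. norm x > R \<Longrightarrow> \<phi> x = 0" using K(3) by (meson not_less)
  moreover have "grad \<phi> x = 0" if "x \<notin> K" for x
    by (rule grad_zero_outside[OF test_smooth[OF assms, of "Suc 0"] compact_imp_closed[OF K(1)]]) (use K(3) that in auto)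
  ultimately show ?thesis using K that by blast
qed

lemma test_square_int:
  assumes "\<phi> \<in> test_functions S"
  shows "square_int lborel \<phi>" "square_int lborel (grad \<phi>)" "square_int lborel (\<lambda>x. dd \<phi> b x)"
proof -
  obtain R where R: "\<And>x. norm x > R \<Longrightarrow> \<phi> x = 0" using test_support[OF assms] by metis
  show "square_int lborel \<phi>" by (rule C1_square_int(1)[OF test_smooth[OF assms, of "Suc 0"]]) (rule R)
  show g: "square_int lborel (grad \<phi>)" by (rule C1_square_int(2)[OF test_smooth[OF assms, of "Suc 0"]]) (rule R)
  from square_int_inner[OF g, of b] show "square_int lborel (\<lambda>x. dd \<phi> b x)"
    using grad_inner[OF test_smooth[OF assms, of "Suc 0"]] by simp
qed

lemma test_shift:
  assumes "\<phi> \<in> test_functions S" "\<And>x. x \<in> S \<Longrightarrow> x + c \<in> S'"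
  shows "(\<lambda>x. \<phi> (x - c)) \<in> test_functions S'" "dd (\<lambda>x. \<phi> (x - c)) b x = dd \<phi> b (x - c)"
proof -
  obtain K where K: "compact K" "K \<subseteq> S" "\<And>x. x \<notin> K \<Longrightarrow> \<phi> x = 0" using assms by (auto simp: test_functions_def)
  have "compact ((\<lambda>x. c + x) ` K)" by (intro compact_continuous_image continuous_intros K)
  moreover have "(\<lambda>x. c + x) ` K \<subseteq> S'" using K(2) assms(2) by (auto simp: add.commute)
  moreover have "\<phi> (x - c) = 0" if "x \<notin> (\<lambda>x. c + x) ` K" for x
  proof (rule K(3))
    show "x - c \<notin> K" using that by (metis add_diff_cancel_left' diff_add_cancel image_eqI add.commute)
  qed
  moreover have "Ck k (\<lambda>x. \<phi> (x - c))" for k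
    using Ck_affine[OF test_smooth[OF assms(1)], of k 1 "- c"] by simp
  ultimately show "(\<lambda>x. \<phi> (x - c)) \<in> test_functions S'" unfolding test_functions_def by blast
  show "dd (\<lambda>x. \<phi> (x - c)) b x = dd \<phi> b (x - c)"
    using dd_affine[OF test_smooth[OF assms(1), of "Suc 0"], where a=1 and c="- c" and v=b and x=x] by simp
qed

lemma test_mult:
  assumes "\<phi> \<in> test_functions S" "smooth \<eta>"
  shows "(\<lambda>x. \<eta> x * \<phi> x) \<in> test_functions S"
proof -
  obtain K where K: "compact K" "K \<subseteq> S" "\<And>x. x \<notin> K \<Longrightarrow> \<phi> x = 0" using assms by (auto simp: test_functions_def)
  have "Ck k (\<lambda>x. \<eta> x * \<phi> x)" for k using assms by (intro Ck_mult test_smooth[OF assms(1)]) auto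
  moreover have "\<eta> x * \<phi> x = 0" if "x \<notin> K" for x using K(3)[OF that] by simp
  ultimately show ?thesis using K(1,2) unfolding test_functions_def by blast
qed

lemma dd_mult:
  assumes "Ck (Suc k) f" "Ck (Suc k) g"
  shows "dd (\<lambda>x. f x * g x) v x = f x * dd g v x + dd f v x * g x"
  by (rule dd_eq[OF has_derivative_mult[OF Ck_Suc_deriv[OF assms(1)] Ck_Suc_deriv[OF assms(2)]]])

section \<open>Averages over segments and against bumps\<close>

text \<open>The uniform distribution on the segment from 0 to \<open>c\<close>.\<close>

definition seg :: "'a::euclidean_space \<Rightarrow> 'a measure" where
  "seg c = distr (uniform_measure lborel {0..1}) borel (\<lambda>s::real. s *\<^sub>R c)"

lemma averaging_seg: "averaging (seg c)"
proof -
  have e: "emeasure (seg c) UNIV = 1"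
    unfolding seg_def by (subst emeasure_distr) auto
  show ?thesis
  proof (intro averaging.intro averaging_axioms.intro finite_measureI)
    show "emeasure (seg c) (space (seg c)) \<noteq> \<infinity>" using e by (simp add: seg_def)
    show "sets (seg c) = sets borel" by (simp add: seg_def)
    show "measure (seg c) UNIV = 1" using e by (simp add: measure_def)
  qed
qed

lemma integral_seg:
  fixes f :: "'a::euclidean_space \<Rightarrow> 'b::euclidean_space"
  assumes [measurable]: "f \<in> borel_measurable borel"
  shows "(\<integral>z. f z \<partial>seg c) = (\<integral>s. indicator {0..1} s *\<^sub>R f (s *\<^sub>R c) \<partial>lborel)"
proof -
  have u: "uniform_measure lborel {0..1::real} = density lborel (\<lambda>s. ennreal (indicator {0..1} s))"
    unfolding uniform_measure_def by (auto intro!: density_cong simp: indicator_def)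
  show ?thesis
    unfolding seg_def u by (subst integral_distr) (auto intro!: integral_density)
qed

lemma AE_seg: "AE z in seg c. norm z \<le> norm c"
  unfolding seg_def
proof (subst AE_distr_iff)
  have "AE s in uniform_measure lborel {0..1::real}. norm (s *\<^sub>R c) \<le> norm c"
  proof (rule AE_uniform_measureI)
    show "AE s in lborel. s \<in> {0..1::real} \<longrightarrow> norm (s *\<^sub>R c) \<le> norm c"
      by (auto intro!: AE_I2 mult_left_le_one_le)
  qed simp
  then show "AE s in uniform_measure lborel {0..1::real}. norm (s *\<^sub>R c) \<le> norm c" .
qed auto

text \<open>The fundamental theorem of calculus on the segment from \<open>x\<close> to \<open>x + c\<close>.\<close>

lemma increment_avg_seg:
  assumes "Ck (Suc k) f"
  shows "f (x + c) - f x = avg (seg c) (dd f c) x"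
proof -
  have cont: "continuous_on UNIV (dd f c)" by (rule Ck_continuous[OF Ck_dd[OF assms]])
  then have m: "(\<lambda>z. dd f c (x + z)) \<in> borel_measurable borel"
    by (intro borel_measurable_continuous_onI continuous_on_compose2[OF cont] continuous_intros) auto
  have "avg (seg c) (dd f c) x = (\<integral>s. indicator {0..1} s *\<^sub>R dd f c (x + s *\<^sub>R c) \<partial>lborel)"
    unfolding avg_def by (rule integral_seg[OF m])
  also have "\<dots> = f (x + 1 *\<^sub>R c) - f (x + 0 *\<^sub>R c)"
  proof (rule integral_FTC_Icc)
    show "((\<lambda>s. f (x + s *\<^sub>R c)) has_vector_derivative dd f c (x + s *\<^sub>R c)) (at s within {0..1})" for s
    proof -
      have "((\<lambda>s. f (x + s *\<^sub>R c)) has_derivative (\<lambda>t. dd f (t *\<^sub>R c) (x + s *\<^sub>R c))) (at s within {0..1})"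
        by (rule has_derivative_compose[OF _ Ck_Suc_deriv[OF assms], of "\<lambda>s. x + s *\<^sub>R c" "\<lambda>t. t *\<^sub>R c"])
          (auto intro!: derivative_eq_intros)
      moreover have "linear (\<lambda>v. dd f v (x + s *\<^sub>R c))"
        using Ck_Suc_deriv[OF assms] has_derivative_linear by blast
      ultimately show ?thesis by (simp add: has_vector_derivative_def linear_scale)
    qed
    show "continuous_on {0..1} (\<lambda>s. dd f c (x + s *\<^sub>R c))"
      by (intro continuous_on_compose2[OF cont] continuous_intros) auto
  qed simp
  finally show ?thesis by simp
qed

text \<open>The type argument fixes the space over which the mass is taken.\<close>

definition bump_mass :: "real \<Rightarrow> 'a::euclidean_space itself \<Rightarrow> real" where
  "bump_mass d _ = (\<integral>z. flat 0 (d\<^sup>2 - (norm (z::'a))\<^sup>2) \<partial>lborel)"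

definition bump :: "real \<Rightarrow> 'a::euclidean_space \<Rightarrow> real" where
  "bump d z = flat 0 (d\<^sup>2 - (norm z)\<^sup>2) / bump_mass d TYPE('a)"

definition bump_measure :: "'a::euclidean_space \<Rightarrow> real \<Rightarrow> 'a measure" where
  "bump_measure c d = density lborel (\<lambda>z. ennreal (bump d (z - c)))"

lemma flat_ball_smooth: "Ck k (\<lambda>z::'a::euclidean_space. flat 0 (d\<^sup>2 - (norm z)\<^sup>2))"
  using Ck_compose[OF Ck_flat Ck_diff[OF Ck_const Ck_norm_sq[of k 0]], of 0 "d\<^sup>2"] by simp

lemma flat_ball_integrable: "integrable lborel (\<lambda>z::'a::euclidean_space. flat 0 (d\<^sup>2 - (norm z)\<^sup>2))"
proof -
  let ?f = "\<lambda>z::'a. flat 0 (d\<^sup>2 - (norm z)\<^sup>2)"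
  have "integrable lborel (\<lambda>z. indicator (cball 0 \<bar>d\<bar>) z *\<^sub>R ?f z)"
    by (rule borel_integrable_compact) (auto intro: continuous_on_subset[OF Ck_continuous[OF flat_ball_smooth]])
  moreover have "(\<lambda>z. indicator (cball 0 \<bar>d\<bar>) z *\<^sub>R ?f z) = ?f"
  proof
    fix z :: 'a
    show "indicator (cball 0 \<bar>d\<bar>) z *\<^sub>R ?f z = ?f z"
    proof (cases "norm z \<le> \<bar>d\<bar>")
      case False
      then have "\<bar>d\<bar>\<^sup>2 \<le> (norm z)\<^sup>2" by (intro power_mono) auto
      then show ?thesis by (simp add: flat0_zero)
    qed simp
  qed
  ultimately show ?thesis by simp
qed

lemma bump_mass_pos:
  assumes "d > 0" shows "bump_mass d TYPE('a::euclidean_space) > 0"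
proof -
  let ?f = "\<lambda>z::'a. flat 0 (d\<^sup>2 - (norm z)\<^sup>2)"
  have "bump_mass d TYPE('a) \<ge> 0" unfolding bump_mass_def by (simp add: flat0_nonneg)
  moreover have "bump_mass d TYPE('a) \<noteq> 0"
  proof
    assume "bump_mass d TYPE('a) = 0"
    then have "AE z in lborel. ?f z = 0"
      unfolding bump_mass_def using integral_nonneg_eq_0_iff_AE[OF flat_ball_integrable[where 'a='a and d=d]]
      by (simp add: flat0_nonneg)
    then have "AE z in lborel. (z::'a) \<notin> ball 0 d"
    proof eventually_elim
      case (elim z)
      show ?case
      proof
        assume "(z::'a) \<in> ball 0 d"
        then have "(norm z)\<^sup>2 < d\<^sup>2" by (intro power_strict_mono) auto
        then show False using elim flat0_pos[of "d\<^sup>2 - (norm z)\<^sup>2"] by simp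
      qed
    qed
    then have "ball (0::'a) d \<in> null_sets lborel" by (subst AE_iff_null_sets) auto
    then have "ball (0::'a) d \<in> null_sets lebesgue" by (simp add: null_sets_completionI)
    then show False using assms open_not_negligible[of "ball (0::'a) d"]
      by (simp add: negligible_iff_null_sets)
  qed
  ultimately show ?thesis by simp
qed

lemma bump_props:
  fixes z :: "'a::euclidean_space"
  assumes "d > 0"
  shows "smooth (bump d :: 'a \<Rightarrow> real)" "0 \<le> bump d z" "d \<le> norm z \<Longrightarrow> bump d z = 0"
    "(\<integral>z. bump d (z::'a) \<partial>lborel) = 1" "integrable lborel (bump d :: 'a \<Rightarrow> real)"
    "bump d (- z) = bump d z"
proof -
  have m: "bump_mass d TYPE('a) > 0" by (rule bump_mass_pos[OF assms])
  have eq: "bump d = (\<lambda>z::'a. (1 / bump_mass d TYPE('a)) * flat 0 (d\<^sup>2 - (norm z)\<^sup>2))"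
    by (simp add: bump_def fun_eq_iff)
  show "smooth (bump d :: 'a \<Rightarrow> real)" unfolding eq by (intro allI Ck_cmult flat_ball_smooth)
  show "0 \<le> bump d z" using m by (simp add: bump_def flat0_nonneg)
  show "bump d z = 0" if "d \<le> norm z"
  proof -
    have "d\<^sup>2 \<le> (norm z)\<^sup>2" using that assms by (intro power_mono) auto
    then show ?thesis by (simp add: bump_def flat0_zero)
  qed
  show "integrable lborel (bump d :: 'a \<Rightarrow> real)" unfolding eq by (intro integrable_mult_right flat_ball_integrable)
  show "(\<integral>z. bump d (z::'a) \<partial>lborel) = 1"
    using m unfolding eq by (simp add: bump_mass_def)
  show "bump d (- z) = bump d z" by (simp add: bump_def)
qed

lemma bump_shift_measurable: "(\<lambda>z. bump d (z - c)) \<in> borel_measurable borel"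
proof -
  have "continuous_on UNIV (\<lambda>z. flat 0 (d\<^sup>2 - (norm (z - c))\<^sup>2))"
    using Ck_continuous[OF Ck_affine[OF flat_ball_smooth[of 0 d], of 1 "- c"]] by simp
  then show ?thesis
    unfolding bump_def by (intro borel_measurable_divide borel_measurable_continuous_onI) auto
qed

lemma averaging_bump:
  assumes "d > 0" shows "averaging (bump_measure c d)"
proof -
  have [measurable]: "(\<lambda>z. bump d (z - c)) \<in> borel_measurable borel" by (rule bump_shift_measurable)
  have "emeasure (bump_measure c d) UNIV = (\<integral>\<^sup>+z. ennreal (bump d (z - c)) \<partial>lborel)"
    unfolding bump_measure_def by (subst emeasure_density) auto
  also have "\<dots> = ennreal (\<integral>z. bump d (z - c) \<partial>lborel)"
    using bump_props[OF assms] lborel_integrable_shift[of "bump d" "- c"] by (intro nn_integral_eq_integral) auto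
  also have "(\<integral>z. bump d (z - c) \<partial>lborel) = 1"
    using lborel_integral_shift[of "bump d" "- c"] bump_props(4)[OF assms] by simp
  finally have e: "emeasure (bump_measure c d) UNIV = 1" by simp
  show ?thesis
  proof (intro averaging.intro averaging_axioms.intro finite_measureI)
    show "emeasure (bump_measure c d) (space (bump_measure c d)) \<noteq> \<infinity>" using e by (simp add: bump_measure_def)
    show "sets (bump_measure c d) = sets borel" by (simp add: bump_measure_def)
    show "measure (bump_measure c d) UNIV = 1" using e by (simp add: measure_def)
  qed
qed

lemma AE_bump:
  fixes c :: "'a::euclidean_space"
  assumes "d > 0" shows "AE z in bump_measure c d. norm (z - c) < d"
  unfolding bump_measure_def using bump_shift_measurable[of d c]
proof (subst AE_density)
  have "0 < ennreal (bump d (z - c)) \<Longrightarrow> norm (z - c) < d" for z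
    using bump_props(3)[OF assms, of "z - c"] by (cases "norm (z - c) < d") auto
  then show "AE z in lborel. 0 < ennreal (bump d (z - c)) \<longrightarrow> norm (z - c) < d" by auto
qed auto

lemma avg_bump:
  fixes f :: "'a::euclidean_space \<Rightarrow> 'b::euclidean_space"
  assumes d: "d > 0" and [measurable]: "f \<in> borel_measurable borel"
  shows "avg (bump_measure c d) f y = (\<integral>z. bump d (z - (y + c)) *\<^sub>R f z \<partial>lborel)"
proof -
  have [measurable]: "(\<lambda>z. bump d (z - c)) \<in> borel_measurable borel" by (rule bump_shift_measurable)
  have "avg (bump_measure c d) f y = (\<integral>z. bump d (z - c) *\<^sub>R f (y + z) \<partial>lborel)"
    unfolding avg_def bump_measure_def using bump_props(2)[OF d] by (intro integral_density) auto
  also have "\<dots> = (\<integral>z. bump d ((z + y) - (y + c)) *\<^sub>R f (z + y) \<partial>lborel)"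
    by (simp add: algebra_simps)
  also have "\<dots> = (\<integral>z. bump d (z - (y + c)) *\<^sub>R f z \<partial>lborel)"
    by (rule lborel_integral_shift[of "\<lambda>z. bump d (z - (y + c)) *\<^sub>R f z"])
  finally show ?thesis .
qed

section \<open>Weak gradients\<close>

text \<open>A function on \<open>S\<close> and its weak gradient, both extended by zero to the whole space, so that
  translations and averages need no bookkeeping of domains.\<close>

definition sobolev :: "'a::euclidean_space set \<Rightarrow> ('a \<Rightarrow> real) \<Rightarrow> ('a \<Rightarrow> 'a) \<Rightarrow> bool" where
  "sobolev S u g \<longleftrightarrow> square_int lborel u \<and> square_int lborel g \<and> (\<forall>x. x \<notin> S \<longrightarrow> u x = 0 \<and> g x = 0) \<and>
     (\<forall>\<phi>\<in>test_functions S. \<forall>b\<in>Basis.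
        (\<integral>x. u x * dd \<phi> b x \<partial>lborel) = - (\<integral>x. (g x \<bullet> b) * \<phi> x \<partial>lborel))"

lemma sobolevD:
  assumes "sobolev S u g"
  shows "square_int lborel u" "square_int lborel g" "x \<notin> S \<Longrightarrow> u x = 0" "x \<notin> S \<Longrightarrow> g x = 0"
    "\<phi> \<in> test_functions S \<Longrightarrow> b \<in> Basis \<Longrightarrow>
      (\<integral>x. u x * dd \<phi> b x \<partial>lborel) = - (\<integral>x. (g x \<bullet> b) * \<phi> x \<partial>lborel)"
  using assms by (auto simp: sobolev_def)

lemma AE_lborel_compact_exhaustion:
  fixes S :: "'a::euclidean_space set"
  assumes "open S" "\<And>K. compact K \<Longrightarrow> K \<subseteq> S \<Longrightarrow> AE x in lborel. x \<in> K \<longrightarrow> P x"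
  shows "AE x in lborel. x \<in> S \<longrightarrow> P x"
proof -
  obtain C :: "nat \<Rightarrow> 'a set" where C: "\<And>n. compact (C n)" "\<And>n. C n \<subseteq> S" "(\<Union>n. C n) = S"
    using open_Union_compact_subsets[OF assms(1)] by metis
  have "AE x in lborel. \<forall>n. x \<in> C n \<longrightarrow> P x"
    using assms(2)[OF C(1,2)] unfolding AE_all_countable by blast
  then show ?thesis by eventually_elim (use C(3) in blast)
qed

lemma avg_bump_tendsto:
  fixes f :: "'a::euclidean_space \<Rightarrow> 'b::euclidean_space"
  assumes f: "square_int lborel f" and d: "\<And>n. d n > 0" "d \<longlonglongrightarrow> 0"
  shows "(\<lambda>n. sq_norm lborel (\<lambda>x. avg (bump_measure 0 (d n)) f x - f x)) \<longlonglongrightarrow> 0"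
proof (rule LIMSEQ_I)
  fix e :: real assume e: "e > 0"
  obtain \<delta> where \<delta>: "\<delta> > 0" "\<And>c. norm c < \<delta> \<Longrightarrow> sq_norm lborel (\<lambda>x. f (x + c) - f x) < e / 2"
    using translation_uniform[OF f, of "e/2"] e by auto
  obtain N where N: "\<And>n. n \<ge> N \<Longrightarrow> \<bar>d n\<bar> < \<delta>" using LIMSEQ_D[OF d(2) \<delta>(1)] by auto
  have "norm (sq_norm lborel (\<lambda>x. avg (bump_measure 0 (d n)) f x - f x) - 0) < e" if "n \<ge> N" for n
  proof -
    interpret averaging "bump_measure (0::'a) (d n)" by (rule averaging_bump[OF d(1)])
    have ae: "AE z in bump_measure 0 (d n). sq_norm lborel (\<lambda>x. f (x + z) - f x) \<le> e / 2"
      using AE_bump[OF d(1)[of n], of 0]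
    proof eventually_elim
      case (elim z)
      then have "norm z < \<delta>" using N[OF that] d(1)[of n] by simp
      then show ?case using \<delta>(2)[of z] by linarith
    qed
    show ?thesis using avg_close(2)[OF f ae] e by simp
  qed
  then show "\<exists>N. \<forall>n\<ge>N. norm (sq_norm lborel (\<lambda>x. avg (bump_measure 0 (d n)) f x - f x) - 0) < e" by blast
qed

lemma bump_test_function:
  assumes "d > 0" "cball x d \<subseteq> S"
  shows "(\<lambda>z. bump d (z - x)) \<in> test_functions S"
  unfolding test_functions_def mem_Collect_eq
proof (intro conjI allI exI[of _ "cball x d"])
  show "Ck k (\<lambda>z. bump d (z - x))" for k
    using Ck_affine[OF bump_props(1)[OF assms(1), rule_format], of k 1 "- x"] by simp
  show "z \<notin> cball x d \<longrightarrow> bump d (z - x) = 0" for z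
    using bump_props(3)[OF assms(1), of "z - x"] by (auto simp: dist_norm norm_minus_commute)
qed (use assms in auto)

text \<open>Averages of the bounded function \<open>\<psi> = 1\<^sub>K sgn D\<close> against bumps are orthogonal to \<open>D\<close>, since
  by Fubini they are superpositions of test functions; they converge to \<open>\<psi>\<close>, and \<open>D \<psi> = |D|\<close> on
  \<open>K\<close>.\<close>

lemma du_Bois_Reymond:
  fixes D :: "'a::euclidean_space \<Rightarrow> real"
  assumes Dm[measurable]: "D \<in> borel_measurable borel" and S: "open S"
    and loc: "\<And>K. compact K \<Longrightarrow> K \<subseteq> S \<Longrightarrow> integrable lborel (\<lambda>x. indicator K x * D x)"
    and test: "\<And>\<phi>. \<phi> \<in> test_functions S \<Longrightarrow> (\<integral>x. D x * \<phi> x \<partial>lborel) = 0"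
  shows "AE x in lborel. x \<in> S \<longrightarrow> D x = 0"
proof (rule AE_lborel_compact_exhaustion[OF S])
  fix K assume K: "compact K" "K \<subseteq> S"
  obtain r where r: "r > 0" "(\<Union>x\<in>K. cball x r) \<subseteq> S"
    using compact_subset_open_imp_cball_epsilon_subset[OF K(1) S K(2)] by metis
  define K' where "K' = (\<Union>x\<in>K. \<Union>y\<in>cball 0 r. {x + y})"
  have K'c: "compact K'" unfolding K'_def by (rule compact_sums'[OF K(1) compact_cball])
  have K'mem: "x + y \<in> K'" if "x \<in> K" "norm y \<le> r" for x y
    unfolding K'_def by (rule UN_I[OF that(1)], rule UN_I[of y]) (use that in auto)
  have K'S: "K' \<subseteq> S"
  proof
    fix z assume "z \<in> K'"
    then obtain x y where "x \<in> K" "norm y \<le> r" "z = x + y" by (auto simp: K'_def)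
    then have "z \<in> (\<Union>x\<in>K. cball x r)" by (intro UN_I[of x]) (auto simp: dist_norm)
    then show "z \<in> S" using r(2) by blast
  qed
  have K'm[measurable]: "K' \<in> sets borel" using K'c by (simp add: borel_compact)
  define D1 where "D1 x = indicator K' x * D x" for x
  have D1: "integrable lborel D1" unfolding D1_def using loc[OF K'c K'S] .
  have D1m[measurable]: "D1 \<in> borel_measurable borel" unfolding D1_def by measurable
  have Km[measurable]: "K \<in> sets borel" using K by (simp add: borel_compact)
  define \<psi> where "\<psi> x = indicator K x * sgn (D x)" for x
  have \<psi>m[measurable]: "\<psi> \<in> borel_measurable borel" unfolding \<psi>_def by measurable
  have \<psi>1: "norm (\<psi> x) \<le> 1" for x by (auto simp: \<psi>_def sgn_if split: split_indicator)
  obtain R where R: "\<And>x. x \<in> K \<Longrightarrow> norm x \<le> R" using compact_imp_bounded[OF K(1)] bounded_iff by metis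
  have \<psi>s: "square_int lborel \<psi>"
    by (rule bounded_support_square_int[OF \<psi>m \<psi>1, of R]) (use R in \<open>force simp: \<psi>_def split: split_indicator\<close>)
  have \<psi>i: "integrable lborel \<psi>"
  proof -
    have "integrable lborel (\<lambda>x. indicator K x * \<psi> x)"
      using square_int_indicator[of K lborel 1] emeasure_compact_finite[OF K(1)] \<psi>s by (intro mult_integrable) auto
    moreover have "(\<lambda>x. indicator K x * \<psi> x) = \<psi>" by (auto simp: \<psi>_def fun_eq_iff split: split_indicator)
    ultimately show ?thesis by simp
  qed
  define d where "d n = r * (1 / real (Suc n))" for n
  have d: "d n > 0" "d n \<le> r" for n using r(1) by (auto simp: d_def field_simps)
  have d0: "d \<longlonglongrightarrow> 0" unfolding d_def using tendsto_mult[OF tendsto_const LIMSEQ_Suc[OF lim_1_over_n], of r] by simp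
  let ?\<psi> = "\<lambda>n. avg (bump_measure 0 (d n)) \<psi>"
  have av: "averaging (bump_measure (0::'a) (d n))" for n by (rule averaging_bump[OF d(1)])
  obtain q where q: "strict_mono q" "AE x in lborel. (\<lambda>n. ?\<psi> (q n) x) \<longlonglongrightarrow> \<psi> x"
    by (rule sq_norm_AE_subseq[OF averaging.avg_square_int[OF av \<psi>s] \<psi>s avg_bump_tendsto[OF \<psi>s d(1) d0]])
  have \<psi>n1: "norm (?\<psi> n x) \<le> 1" for n x
  proof -
    interpret averaging "bump_measure (0::'a) (d n)" by (rule av)
    have "norm (?\<psi> n x) \<le> (\<integral>z. norm (\<psi> (x + z)) \<partial>bump_measure 0 (d n))" unfolding avg_def by (rule integral_norm_bound)
    also have "\<dots> \<le> (\<integral>z. 1 \<partial>bump_measure (0::'a) (d n))"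
      by (rule integral_mono) (use \<psi>1 in \<open>auto intro!: integrable_const_bound[of _ 1]\<close>)
    finally show ?thesis by (simp add: mass_one)
  qed
  have \<psi>nm[measurable]: "?\<psi> n \<in> borel_measurable borel" for n by (rule averaging.avg_measurable[OF av \<psi>m])
  have orth: "(\<integral>x. D1 x * ?\<psi> n x \<partial>lborel) = 0" for n
  proof -
    have bc: "continuous_on UNIV (bump (d n) :: 'a \<Rightarrow> real)"
      by (rule Ck_continuous[OF spec[OF bump_props(1)[OF d(1)], of 0]])
    have [measurable]: "(bump (d n) :: 'a \<Rightarrow> real) \<in> borel_measurable borel"
      by (rule borel_measurable_continuous_onI[OF bc])
    have b1: "Ck (Suc 0) (bump (d n) :: 'a \<Rightarrow> real)" using bump_props(1)[OF d(1)] by blast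
    have "bump (d n) z = 0" if "norm z > d n" for z :: 'a by (rule bump_props(3)[OF d(1)]) (use that in simp)
    then obtain B where B: "\<And>z::'a. \<bar>bump (d n) z\<bar> \<le> B" using grad_bounded[OF b1, of "d n"] by metis
    have P: "pair_sigma_finite (lborel :: 'a measure) (lborel :: 'a measure)" ..
    have int: "integrable (lborel \<Otimes>\<^sub>M lborel) (\<lambda>(x, y). D1 x * (bump (d n) (y - x) * \<psi> y))"
    proof (rule pair_sigma_finite.Fubini_integrable[OF P])
      show "(\<lambda>(x, y). D1 x * (bump (d n) (y - x) * \<psi> y)) \<in> borel_measurable (lborel \<Otimes>\<^sub>M lborel)" by measurable
      have i2: "integrable lborel (\<lambda>y. D1 x * (bump (d n) (y - x) * \<psi> y))" for x
      proof (rule Bochner_Integration.integrable_bound[OF integrable_mult_right[OF integrable_norm[OF \<psi>i], of "\<bar>D1 x\<bar> * B"]])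
        show "AE y in lborel. norm (D1 x * (bump (d n) (y - x) * \<psi> y)) \<le> norm (\<bar>D1 x\<bar> * B * norm (\<psi> y))"
        proof (rule AE_I2)
          fix y
          have "\<bar>D1 x\<bar> * \<bar>bump (d n) (y - x)\<bar> * \<bar>\<psi> y\<bar> \<le> \<bar>D1 x\<bar> * B * \<bar>\<psi> y\<bar>"
            using B[of "y - x"] by (intro mult_right_mono mult_left_mono) auto
          moreover have "0 \<le> B" using B[of 0] by linarith
          ultimately show "norm (D1 x * (bump (d n) (y - x) * \<psi> y)) \<le> norm (\<bar>D1 x\<bar> * B * norm (\<psi> y))"
            by (simp add: abs_mult mult.assoc)
        qed
      qed measurable
      then show "AE x in lborel. integrable lborel (\<lambda>y. case (x, y) of (x, y) \<Rightarrow> D1 x * (bump (d n) (y - x) * \<psi> y))" by simp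
      show "integrable lborel (\<lambda>x. LINT y|lborel. norm (case (x, y) of (x, y) \<Rightarrow> D1 x * (bump (d n) (y - x) * \<psi> y)))"
      proof (rule Bochner_Integration.integrable_bound[OF integrable_mult_left[OF integrable_norm[OF D1], of "LINT y|lborel. B * norm (\<psi> y)"]])
        show "AE x in lborel. norm (LINT y|lborel. norm (case (x, y) of (x, y) \<Rightarrow> D1 x * (bump (d n) (y - x) * \<psi> y)))
            \<le> norm (norm (D1 x) * (LINT y|lborel. B * norm (\<psi> y)))"
        proof (rule AE_I2)
          fix x
          have "(LINT y|lborel. norm (D1 x * (bump (d n) (y - x) * \<psi> y))) \<le> (LINT y|lborel. norm (D1 x) * (B * norm (\<psi> y)))"
          proof (rule integral_mono[OF integrable_norm[OF i2]])
            show "integrable lborel (\<lambda>y. norm (D1 x) * (B * norm (\<psi> y)))"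
              by (intro integrable_mult_right integrable_norm \<psi>i)
            show "norm (D1 x * (bump (d n) (y - x) * \<psi> y)) \<le> norm (D1 x) * (B * norm (\<psi> y))" for y
              unfolding real_norm_def abs_mult using B[of "y - x"] by (intro mult_left_mono mult_right_mono) auto
          qed
          moreover have "0 \<le> (LINT y|lborel. norm (D1 x * (bump (d n) (y - x) * \<psi> y)))"
            by (rule Bochner_Integration.integral_nonneg) simp
          moreover have "(LINT y|lborel. norm (D1 x) * (B * norm (\<psi> y))) = norm (D1 x) * (LINT y|lborel. B * norm (\<psi> y))"
            by (rule integral_mult_right_zero)
          ultimately show "norm (LINT y|lborel. norm (case (x, y) of (x, y) \<Rightarrow> D1 x * (bump (d n) (y - x) * \<psi> y)))
            \<le> norm (norm (D1 x) * (LINT y|lborel. B * norm (\<psi> y)))"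
            unfolding prod.case real_norm_def by linarith
        qed
      qed measurable
    qed
    have "(\<integral>x. D1 x * ?\<psi> n x \<partial>lborel) = (\<integral>x. (\<integral>y. D1 x * (bump (d n) (y - x) * \<psi> y) \<partial>lborel) \<partial>lborel)"
      by (simp add: avg_bump[OF d(1)[of n] \<psi>m])
    also have "\<dots> = (\<integral>y. (\<integral>x. D1 x * (bump (d n) (y - x) * \<psi> y) \<partial>lborel) \<partial>lborel)"
      by (rule pair_sigma_finite.Fubini_integral[OF P int, symmetric])
    also have "\<dots> = (\<integral>y. 0 \<partial>(lborel :: 'a measure))"
    proof (rule Bochner_Integration.integral_cong[OF refl])
      fix y
      show "(\<integral>x. D1 x * (bump (d n) (y - x) * \<psi> y) \<partial>lborel) = 0"
      proof (cases "y \<in> K")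
        case True
        have sub: "cball y (d n) \<subseteq> S" 
          using r(2) True subset_cball[OF d(2)[of n], of y] by blast
        have eq: "D1 x * (bump (d n) (y - x) * \<psi> y) = \<psi> y * (D x * bump (d n) (x - y))" for x
        proof (cases "norm (x - y) < d n")
          case t: True
          then have "x \<in> K'" using K'mem[OF True, of "x - y"] d(2)[of n] by simp
          then show ?thesis using bump_props(6)[OF d(1)[of n], of "x - y"] by (simp add: D1_def)
        next
          case False
          then show ?thesis using bump_props(6)[OF d(1)[of n], of "x - y"] bump_props(3)[OF d(1)[of n], of "x - y"] by simp
        qed
        show ?thesis unfolding eq using test[OF bump_test_function[OF d(1) sub]] by simp
      qed (simp add: \<psi>_def)
    qed
    finally show ?thesis by simp
  qed
  have "(\<lambda>n. \<integral>x. D1 x * ?\<psi> (q n) x \<partial>lborel) \<longlonglongrightarrow> (\<integral>x. D1 x * \<psi> x \<partial>lborel)"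
  proof (rule integral_dominated_convergence[where w="\<lambda>x. norm (D1 x)"])
    show "AE x in lborel. (\<lambda>n. D1 x * ?\<psi> (q n) x) \<longlonglongrightarrow> D1 x * \<psi> x"
      using q(2) by eventually_elim (intro tendsto_intros)
    show "AE x in lborel. norm (D1 x * ?\<psi> (q n) x) \<le> norm (D1 x)" for n
    proof (rule AE_I2)
      fix x show "norm (D1 x * ?\<psi> (q n) x) \<le> norm (D1 x)"
        unfolding norm_mult using mult_left_mono[OF \<psi>n1[of "q n" x], of "norm (D1 x)"] by simp
    qed
  qed (use D1 in auto)
  then have z: "(\<integral>x. D1 x * \<psi> x \<partial>lborel) = 0" unfolding orth by (simp add: LIMSEQ_const_iff)
  have KK': "x \<in> K'" if "x \<in> K" for x using K'mem[OF that, of 0] r(1) by simp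
  have e: "(\<lambda>x. D1 x * \<psi> x) = (\<lambda>x. indicator K x * \<bar>D x\<bar>)"
  proof
    fix x show "D1 x * \<psi> x = indicator K x * \<bar>D x\<bar>"
      using KK'[of x] by (cases "x \<in> K") (auto simp: D1_def \<psi>_def sgn_if)
  qed
  have "integrable lborel (\<lambda>x. indicator K x * \<bar>D x\<bar>)"
    using integrable_norm[OF loc[OF K]] by (simp add: abs_mult)
  then have "AE x in lborel. indicator K x * \<bar>D x\<bar> = 0"
    using z unfolding e by (subst (asm) integral_nonneg_eq_0_iff_AE) auto
  then show "AE x in lborel. x \<in> K \<longrightarrow> D x = 0" by eventually_elim auto
qed

lemma du_Bois_Reymond_L2:
  fixes D :: "'a::euclidean_space \<Rightarrow> real"
  assumes D: "square_int lborel D" and S: "open S"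
    and test: "\<And>\<phi>. \<phi> \<in> test_functions S \<Longrightarrow> (\<integral>x. D x * \<phi> x \<partial>lborel) = 0"
  shows "AE x in lborel. x \<in> S \<longrightarrow> D x = 0"
proof (rule du_Bois_Reymond[OF _ S])
  show "D \<in> borel_measurable borel" using D by (simp add: square_int_def)
  show "integrable lborel (\<lambda>x. indicator K x * D x)" if "compact K" for K
    using square_int_indicator[of K lborel 1] emeasure_compact_finite[OF that] that D
    by (intro mult_integrable) (auto simp: borel_compact)
qed (rule test)

lemma AE_Basis_eq:
  assumes "\<And>b. b \<in> Basis \<Longrightarrow> AE x in M. P x \<longrightarrow> f x \<bullet> b = g x \<bullet> (b::'b::euclidean_space)"
  shows "AE x in M. P x \<longrightarrow> f x = g x"
proof -
  have "AE x in M. \<forall>b\<in>Basis. P x \<longrightarrow> f x \<bullet> b = g x \<bullet> b"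
    using assms by (intro AE_ball_countable[THEN iffD2] ballI countable_finite) auto
  then show ?thesis by eventually_elim (auto intro: euclidean_eqI)
qed

lemma sobolev_unique:
  assumes S: "open S" and u: "sobolev S u g" "sobolev S v h" and eq: "AE x in lborel. u x = v x"
  shows "AE x in lborel. g x = h x"
proof -
  note u1 = sobolevD[OF u(1)] and u2 = sobolevD[OF u(2)]
  have "AE x in lborel. x \<in> S \<longrightarrow> g x \<bullet> b = h x \<bullet> b" if b: "b \<in> Basis" for b
  proof -
    have sq: "square_int lborel (\<lambda>x. g x \<bullet> b)" "square_int lborel (\<lambda>x. h x \<bullet> b)"
      using u1(2) u2(2) by (auto intro: square_int_inner)
    have "AE x in lborel. x \<in> S \<longrightarrow> g x \<bullet> b - h x \<bullet> b = 0"
    proof (rule du_Bois_Reymond_L2[OF square_int_diff[OF sq] S])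
      fix \<phi> assume p: "\<phi> \<in> test_functions S"
      have "(\<integral>x. u x * dd \<phi> b x \<partial>lborel) = (\<integral>x. v x * dd \<phi> b x \<partial>lborel)"
        using eq u1(1) u2(1) test_square_int(3)[OF p, of b]
        by (intro integral_cong_AE) (auto simp: square_int_def)
      then have "(\<integral>x. (g x \<bullet> b) * \<phi> x \<partial>lborel) = (\<integral>x. (h x \<bullet> b) * \<phi> x \<partial>lborel)"
        using u1(5)[OF p b] u2(5)[OF p b] by simp
      then show "(\<integral>x. (g x \<bullet> b - h x \<bullet> b) * \<phi> x \<partial>lborel) = 0"
        using mult_integrable[OF sq(1) test_square_int(1)[OF p]] mult_integrable[OF sq(2) test_square_int(1)[OF p]]
        by (simp add: left_diff_distrib)
    qed
    then show ?thesis by simp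
  qed
  then have "AE x in lborel. x \<in> S \<longrightarrow> g x = h x" by (rule AE_Basis_eq)
  then show ?thesis by eventually_elim (use u1(4) u2(4) in metis)
qed

lemma sobolev_zero: "sobolev S (\<lambda>x. 0) (\<lambda>x. 0)"
  by (simp add: sobolev_def)

lemma sobolev_add:
  assumes "sobolev S u g" "sobolev S v h"
  shows "sobolev S (\<lambda>x. u x + v x) (\<lambda>x. g x + h x)"
  unfolding sobolev_def
proof (intro conjI allI impI ballI)
  note u = sobolevD[OF assms(1)] and v = sobolevD[OF assms(2)]
  show "square_int lborel (\<lambda>x. u x + v x)" "square_int lborel (\<lambda>x. g x + h x)"
    using u v by (auto intro: square_int_add)
  fix \<phi> and b :: 'a assume p: "\<phi> \<in> test_functions S" "b \<in> Basis"
  note t = test_square_int[OF p(1)]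
  show "(\<integral>x. (u x + v x) * dd \<phi> b x \<partial>lborel) = - (\<integral>x. ((g x + h x) \<bullet> b) * \<phi> x \<partial>lborel)"
    using u(5)[OF p] v(5)[OF p] mult_integrable[OF u(1) t(3)] mult_integrable[OF v(1) t(3)]
      mult_integrable[OF square_int_inner[OF u(2)] t(1)] mult_integrable[OF square_int_inner[OF v(2)] t(1)]
    by (simp add: distrib_right inner_add_left)
qed (use assms in \<open>auto simp: sobolev_def\<close>)

lemma sobolev_cmult:
  assumes "sobolev S u g"
  shows "sobolev S (\<lambda>x. c * u x) (\<lambda>x. c *\<^sub>R g x)"
  unfolding sobolev_def
proof (intro conjI allI impI ballI)
  note u = sobolevD[OF assms(1)]
  show "square_int lborel (\<lambda>x. c * u x)" "square_int lborel (\<lambda>x. c *\<^sub>R g x)"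
    using square_int_cmult(1)[OF u(1)] square_int_scaleR(1)[OF u(2)] by auto
  fix \<phi> and b :: 'a assume p: "\<phi> \<in> test_functions S" "b \<in> Basis"
  show "(\<integral>x. (c * u x) * dd \<phi> b x \<partial>lborel) = - (\<integral>x. ((c *\<^sub>R g x) \<bullet> b) * \<phi> x \<partial>lborel)"
    using u(5)[OF p] by (simp add: mult.assoc)
qed (use assms in \<open>auto simp: sobolev_def\<close>)

lemma sobolev_diff:
  assumes "sobolev S u g" "sobolev S v h"
  shows "sobolev S (\<lambda>x. u x - v x) (\<lambda>x. g x - h x)"
  using sobolev_add[OF assms(1) sobolev_cmult[OF assms(2), of "-1"]] by simp

lemma square_int_bounded_mult:
  fixes \<eta> :: "'a \<Rightarrow> real"
  assumes "square_int M f" "\<eta> \<in> borel_measurable M" "\<And>x. \<bar>\<eta> x\<bar> \<le> B"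
  shows "square_int M (\<lambda>x. \<eta> x *\<^sub>R f x)"
proof (rule square_int_mono(1)[OF square_int_scaleR(1)[OF assms(1), of B] _ AE_I2])
  show "(\<lambda>x. \<eta> x *\<^sub>R f x) \<in> borel_measurable M" using assms by (auto simp: square_int_def)
  show "norm (\<eta> x *\<^sub>R f x) \<le> norm (B *\<^sub>R f x)" for x
    using assms(3)[of x] by (simp add: mult_right_mono)
qed

text \<open>If \<open>\<phi>\<close> is a test function, so is \<open>\<eta> \<phi>\<close>; the product rule for the
  latter is the assertion.\<close>

lemma sobolev_mult_smooth:
  assumes u: "sobolev S u g" and \<eta>: "smooth \<eta>" "\<And>x. \<bar>\<eta> x\<bar> \<le> B" "\<And>x. norm (grad \<eta> x) \<le> B"
  shows "sobolev S (\<lambda>x. \<eta> x * u x) (\<lambda>x. \<eta> x *\<^sub>R g x + u x *\<^sub>R grad \<eta> x)"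
  unfolding sobolev_def
proof (intro conjI allI impI ballI)
  note u' = sobolevD[OF u]
  have \<eta>1: "Ck k \<eta>" for k using \<eta>(1) by simp
  have \<eta>m: "\<eta> \<in> borel_measurable lborel" using Ck_continuous[OF \<eta>1[of 0]] by (simp add: borel_measurable_continuous_onI)
  have gm: "grad \<eta> \<in> borel_measurable lborel"
    using continuous_grad[OF \<eta>1[of "Suc 0"]] by (simp add: borel_measurable_continuous_onI)
  show 1: "square_int lborel (\<lambda>x. \<eta> x * u x)"
    using square_int_bounded_mult[OF u'(1) \<eta>m \<eta>(2)] by simp
  have 2: "square_int lborel (\<lambda>x. u x *\<^sub>R grad \<eta> x)"
  proof (rule square_int_mono(1)[OF square_int_scaleR(1)[OF u'(1), of B] _ AE_I2])
    show "(\<lambda>x. u x *\<^sub>R grad \<eta> x) \<in> borel_measurable lborel"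
      using u'(1) gm by (auto simp: square_int_def)
    show "norm (u x *\<^sub>R grad \<eta> x) \<le> norm (B *\<^sub>R u x)" for x
      using \<eta>(3)[of x] mult_right_mono[of "norm (grad \<eta> x)" "\<bar>B\<bar>" "\<bar>u x\<bar>"] by (simp add: abs_mult mult.commute)
  qed
  have 3: "square_int lborel (\<lambda>x. \<eta> x *\<^sub>R g x)" by (rule square_int_bounded_mult[OF u'(2) \<eta>m \<eta>(2)])
  show "square_int lborel (\<lambda>x. \<eta> x *\<^sub>R g x + u x *\<^sub>R grad \<eta> x)" by (rule square_int_add[OF 3 2])
  fix \<phi> and b :: 'a assume p: "\<phi> \<in> test_functions S" "b \<in> Basis"
  note t = test_square_int[OF p(1)]
  note ip = mult_integrable[OF 1 t(3), of b] mult_integrable[OF square_int_inner[OF 3, of b] t(1)]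
    mult_integrable[OF square_int_inner[OF 2, of b] t(1)]
  have dm: "dd (\<lambda>x. \<eta> x * \<phi> x) b x = \<eta> x * dd \<phi> b x + (grad \<eta> x \<bullet> b) * \<phi> x" for x
    using dd_mult[OF \<eta>1[of "Suc 0"] test_smooth[OF p(1)], where v=b and x=x] grad_inner[OF \<eta>1[of "Suc 0"], of x b] by simp
  have "(\<integral>x. u x * (\<eta> x * dd \<phi> b x + (grad \<eta> x \<bullet> b) * \<phi> x) \<partial>lborel) = - (\<integral>x. (g x \<bullet> b) * (\<eta> x * \<phi> x) \<partial>lborel)"
    using u'(5)[OF test_mult[OF p(1) \<eta>(1)] p(2)] by (simp add: dm)
  moreover have "(\<integral>x. u x * (\<eta> x * dd \<phi> b x + (grad \<eta> x \<bullet> b) * \<phi> x) \<partial>lborel)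
      = (\<integral>x. (\<eta> x * u x) * dd \<phi> b x + ((u x *\<^sub>R grad \<eta> x) \<bullet> b) * \<phi> x \<partial>lborel)"
    by (simp add: algebra_simps)
  moreover have "\<dots> = (\<integral>x. (\<eta> x * u x) * dd \<phi> b x \<partial>lborel) + (\<integral>x. ((u x *\<^sub>R grad \<eta> x) \<bullet> b) * \<phi> x \<partial>lborel)"
    by (rule Bochner_Integration.integral_add[OF ip(1,3)])
  moreover have "(\<integral>x. ((\<eta> x *\<^sub>R g x + u x *\<^sub>R grad \<eta> x) \<bullet> b) * \<phi> x \<partial>lborel)
      = (\<integral>x. ((\<eta> x *\<^sub>R g x) \<bullet> b) * \<phi> x + ((u x *\<^sub>R grad \<eta> x) \<bullet> b) * \<phi> x \<partial>lborel)"
    by (simp add: inner_add_left distrib_right)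
  moreover have "\<dots> = (\<integral>x. ((\<eta> x *\<^sub>R g x) \<bullet> b) * \<phi> x \<partial>lborel) + (\<integral>x. ((u x *\<^sub>R grad \<eta> x) \<bullet> b) * \<phi> x \<partial>lborel)"
    by (rule Bochner_Integration.integral_add[OF ip(2,3)])
  moreover have "(\<integral>x. ((\<eta> x *\<^sub>R g x) \<bullet> b) * \<phi> x \<partial>lborel) = (\<integral>x. (g x \<bullet> b) * (\<eta> x * \<phi> x) \<partial>lborel)"
    by (simp add: mult_ac)
  ultimately show "(\<integral>x. (\<eta> x * u x) * dd \<phi> b x \<partial>lborel) = - (\<integral>x. ((\<eta> x *\<^sub>R g x + u x *\<^sub>R grad \<eta> x) \<bullet> b) * \<phi> x \<partial>lborel)"
    by linarith
qed (use u in \<open>auto simp: sobolev_def\<close>)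

text \<open>The increment \<open>F (x + c) - F x\<close> has integral zero by translation invariance, and it is the
  average of the derivative along the segment from \<open>x\<close> to \<open>x + c\<close>. The indicator of
  a large ball makes the constant function one square integrable.\<close>

lemma integral_dd_zero:
  assumes F: "Ck (Suc k) F" "\<And>x. norm x > R \<Longrightarrow> F x = 0"
  shows "(\<integral>x. dd F c x \<partial>lborel) = 0"
proof -
  interpret averaging "seg c" by (rule averaging_seg)
  let ?R = "R + norm c"
  let ?I = "\<lambda>x. indicator (cball 0 ?R) x :: real"
  have g0: "grad F x = 0" if "norm x > R" for x
    by (rule grad_zero_outside[OF F(1), of "cball 0 R"]) (use F(2) that in auto)
  have sq: "square_int lborel F" "square_int lborel (dd F c)"
  proof -
    show "square_int lborel F" by (rule C1_square_int(1)[OF F(1)]) (rule F(2))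
    have "square_int lborel (grad F)" by (rule C1_square_int(2)[OF F(1)]) (rule F(2))
    from square_int_inner[OF this, of c] show "square_int lborel (dd F c)" by (simp add: grad_inner[OF F(1)])
  qed
  have one: "square_int lborel ?I"
    using emeasure_bounded_finite[OF bounded_cball, of 0 ?R] square_int_indicator[of "cball 0 ?R" lborel 1] by simp
  have out: "norm y > R" if "norm z \<le> norm c" "norm (y - z) > ?R" for y z :: 'a
    using norm_triangle_ineq4[of y z] that by linarith
  have supp: "dd F c y * ?I (y - z) = dd F c y" if "norm z \<le> norm c" for y z
    using out[OF that, of y] g0[of y] grad_inner[OF F(1), of y c] by (auto split: split_indicator)
  have "(\<integral>x. avg (seg c) (dd F c) x * ?I x \<partial>lborel) = (\<integral>z. (\<integral>y. dd F c (y + z) * ?I y \<partial>lborel) \<partial>seg c)"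
    using avg_inner[OF sq(2) one] by simp
  also have "\<dots> = (\<integral>z. (\<integral>y. dd F c y \<partial>lborel) \<partial>seg c)"
  proof (rule integral_cong_AE)
    have [measurable]: "dd F c \<in> borel_measurable borel" using sq by (simp add: square_int_def)
    have [measurable]: "?I \<in> borel_measurable borel" by (intro borel_measurable_indicator) auto
    show "(\<lambda>z. \<integral>y. dd F c (y + z) * ?I y \<partial>lborel) \<in> borel_measurable (seg c)" by measurable
    show "AE z in seg c. (\<integral>y. dd F c (y + z) * ?I y \<partial>lborel) = (\<integral>y. dd F c y \<partial>lborel)"
      using AE_seg
    proof eventually_elim
      case (elim z)
      show ?case using lborel_integral_shift[of "\<lambda>y. dd F c y * ?I (y - z)" z] by (simp add: supp[OF elim])
    qed
  qed simp
  also have "\<dots> = (\<integral>y. dd F c y \<partial>lborel)" by (simp add: mass_one)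
  finally have "(\<integral>y. dd F c y \<partial>lborel) = (\<integral>x. (F (x + c) - F x) * ?I x \<partial>lborel)"
    by (simp add: increment_avg_seg[OF F(1)])
  also have "\<dots> = (\<integral>x. F (x + c) * ?I x - F x * ?I x \<partial>lborel)" by (simp add: left_diff_distrib)
  also have "\<dots> = (\<integral>x. F (x + c) * ?I x \<partial>lborel) - (\<integral>x. F x * ?I x \<partial>lborel)"
    by (rule Bochner_Integration.integral_diff[OF mult_integrable[OF square_int_shift(1)[OF sq(1)] one] mult_integrable[OF sq(1) one]])
  also have "(\<integral>x. F (x + c) * ?I x \<partial>lborel) = (\<integral>x. F x \<partial>lborel)"
  proof -
    have e: "(\<lambda>x. F x * ?I (x - c)) = F"
      by (rule ext) (use out[of c] F(2) in \<open>auto split: split_indicator\<close>)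
    show ?thesis using lborel_integral_shift[of "\<lambda>y. F y * ?I (y - c)" c] by (simp only: add_diff_cancel_right' e)
  qed
  also have "(\<integral>x. F x * ?I x \<partial>lborel) = (\<integral>x. F x \<partial>lborel)"
  proof -
    have e: "(\<lambda>x. F x * ?I x) = F"
      by (rule ext) (use out[of 0] F(2) in \<open>auto split: split_indicator\<close>)
    show ?thesis by (simp only: e)
  qed
  finally show ?thesis by simp
qed

text \<open>The product of \<open>f\<close> with a test function is \<open>C\<^sup>1\<close> with compact support, so its
  derivative integrates to zero.\<close>

lemma sobolev_C1:
  assumes S: "S \<in> sets borel" and f: "Ck (Suc k) f" "\<And>x. norm x > R \<Longrightarrow> f x = 0"
  shows "sobolev S (\<lambda>x. indicator S x * f x) (\<lambda>x. indicator S x *\<^sub>R grad f x)"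
  unfolding sobolev_def
proof (intro conjI allI impI ballI)
  have sq: "square_int lborel f" "square_int lborel (grad f)"
    by (rule C1_square_int[OF f(1)]; use f(2) in blast)+
  have ind: "(indicator S :: _ \<Rightarrow> real) \<in> borel_measurable lborel" using S by simp
  show "square_int lborel (\<lambda>x. indicator S x * f x)"
    using square_int_bounded_mult[OF sq(1) ind, of 1] by simp
  show "square_int lborel (\<lambda>x. indicator S x *\<^sub>R grad f x)"
    by (rule square_int_bounded_mult[OF sq(2) ind, of 1]) simp
  fix \<phi> and b :: 'a assume p: "\<phi> \<in> test_functions S" "b \<in> Basis"
  obtain K where K: "K \<subseteq> S" "\<And>x. x \<notin> K \<Longrightarrow> \<phi> x = 0" "\<And>x. x \<notin> K \<Longrightarrow> grad \<phi> x = 0"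
    using test_support[OF p(1)] by metis
  note t = test_square_int[OF p(1)] and tk = test_smooth[OF p(1), of "Suc k"]
  have out: "\<phi> x = 0" "dd \<phi> b x = 0" if "x \<notin> S" for x
  proof -
    have "x \<notin> K" using K(1) that by blast
    then show "\<phi> x = 0" "dd \<phi> b x = 0" using K(2,3) grad_inner[OF tk, of x b] by auto
  qed
  have e: "indicator S x * f x * dd \<phi> b x = f x * dd \<phi> b x"
    "(indicator S x *\<^sub>R grad f x \<bullet> b) * \<phi> x = dd f b x * \<phi> x" for x
    using out[of x] grad_inner[OF f(1), of x b] by (auto split: split_indicator)
  have fb: "square_int lborel (dd f b)" using square_int_inner[OF sq(2), of b] by (simp add: grad_inner[OF f(1)])
  have "0 = (\<integral>x. dd (\<lambda>x. f x * \<phi> x) b x \<partial>lborel)"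
    by (rule integral_dd_zero[OF Ck_mult[OF f(1) tk], symmetric, of R]) (use f(2) in auto)
  also have "\<dots> = (\<integral>x. f x * dd \<phi> b x + dd f b x * \<phi> x \<partial>lborel)"
    by (simp add: dd_mult[OF f(1) tk])
  also have "\<dots> = (\<integral>x. f x * dd \<phi> b x \<partial>lborel) + (\<integral>x. dd f b x * \<phi> x \<partial>lborel)"
    by (rule Bochner_Integration.integral_add[OF mult_integrable[OF sq(1) t(3)] mult_integrable[OF fb t(1)]])
  finally show "(\<integral>x. indicator S x * f x * dd \<phi> b x \<partial>lborel) = - (\<integral>x. (indicator S x *\<^sub>R grad f x \<bullet> b) * \<phi> x \<partial>lborel)"
    unfolding e by linarith
qed auto

lemma sobolev_limit:
  assumes s: "\<And>n. sobolev S (u n) (g n)" and sq: "square_int lborel v" "square_int lborel h"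
    and out: "\<And>x. x \<notin> S \<Longrightarrow> v x = 0 \<and> h x = 0"
    and lim: "(\<lambda>n. sq_norm lborel (\<lambda>x. u n x - v x)) \<longlonglongrightarrow> 0" "(\<lambda>n. sq_norm lborel (\<lambda>x. g n x - h x)) \<longlonglongrightarrow> 0"
  shows "sobolev S v h"
  unfolding sobolev_def
proof (intro conjI allI impI ballI sq)
  fix \<phi> and b :: 'a assume p: "\<phi> \<in> test_functions S" "b \<in> Basis"
  note t = test_square_int[OF p(1)]
  have p': "square_int lborel (\<lambda>x. \<phi> x *\<^sub>R b)"
  proof (rule square_int_mono(1)[OF t(1) _ AE_I2])
    show "(\<lambda>x. \<phi> x *\<^sub>R b) \<in> borel_measurable lborel" using t(1) by (auto simp: square_int_def)
  qed (use p in simp)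
  have c: "(\<integral>x. f x \<bullet> (\<phi> x *\<^sub>R b) \<partial>lborel) = (\<integral>x. (f x \<bullet> b) * \<phi> x \<partial>lborel)" for f
    by (simp add: mult.commute)
  have "(\<lambda>n. \<integral>x. u n x * dd \<phi> b x \<partial>lborel) \<longlonglongrightarrow> (\<integral>x. v x * dd \<phi> b x \<partial>lborel)"
    by (rule mult_tendsto[OF sobolevD(1)[OF s] sq(1) t(3) lim(1)])
  moreover have "(\<lambda>n. \<integral>x. g n x \<bullet> (\<phi> x *\<^sub>R b) \<partial>lborel) \<longlonglongrightarrow> (\<integral>x. h x \<bullet> (\<phi> x *\<^sub>R b) \<partial>lborel)"
    by (rule inner_tendsto[OF sobolevD(2)[OF s] sq(2) p' lim(2)])
  then have "(\<lambda>n. - (\<integral>x. (g n x \<bullet> b) * \<phi> x \<partial>lborel)) \<longlonglongrightarrow> - (\<integral>x. (h x \<bullet> b) * \<phi> x \<partial>lborel)"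
    unfolding c by (rule tendsto_minus)
  ultimately show "(\<integral>x. v x * dd \<phi> b x \<partial>lborel) = - (\<integral>x. (h x \<bullet> b) * \<phi> x \<partial>lborel)"
    using sobolevD(5)[OF s p] LIMSEQ_unique by simp
qed (use out in auto)

section \<open>Difference quotients and the unit contraction\<close>

lemma avg_seg_tendsto:
  fixes f :: "'a::euclidean_space \<Rightarrow> 'b::euclidean_space"
  assumes f: "square_int lborel f" and c: "c \<longlonglongrightarrow> 0"
  shows "(\<lambda>n. sq_norm lborel (\<lambda>x. avg (seg (c n)) f x - f x)) \<longlonglongrightarrow> 0"
proof (rule LIMSEQ_I)
  fix e :: real assume e: "e > 0"
  obtain d where d: "d > 0" "\<And>c. norm c < d \<Longrightarrow> sq_norm lborel (\<lambda>x. f (x + c) - f x) < e / 2"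
    using translation_uniform[OF f, of "e/2"] e by auto
  obtain N where N: "\<And>n. n \<ge> N \<Longrightarrow> norm (c n) < d" using LIMSEQ_D[OF c d(1)] by auto
  have "norm (sq_norm lborel (\<lambda>x. avg (seg (c n)) f x - f x) - 0) < e" if "n \<ge> N" for n
  proof -
    interpret averaging "seg (c n)" by (rule averaging_seg)
    have ae: "AE z in seg (c n). sq_norm lborel (\<lambda>x. f (x + z) - f x) \<le> e / 2"
      using AE_seg
    proof eventually_elim
      case (elim z)
      then show ?case using d(2)[of z] N[OF that] by linarith
    qed
    show ?thesis using avg_close(2)[OF f ae] e by simp
  qed
  then show "\<exists>N. \<forall>n\<ge>N. norm (sq_norm lborel (\<lambda>x. avg (seg (c n)) f x - f x) - 0) < e" by blast
qed

text \<open>Tested against \<open>\<phi>\<close>, both sides are averages over \<open>s \<in> [0, 1]\<close> of the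
  pairing of \<open>\<partial>\<^sub>b u\<close> with the translate of \<open>\<phi>\<close> by \<open>s h
  b\<close>. The condition on \<open>V\<close> makes these translates test functions on \<open>S\<close>.\<close>

lemma sobolev_increment:
  assumes u: "sobolev S u g" and b: "b \<in> Basis" and V: "open V" "\<And>x s. x \<in> V \<Longrightarrow> 0 \<le> s \<Longrightarrow> s \<le> 1 \<Longrightarrow> x + (s * h) *\<^sub>R b \<in> S"
  shows "AE x in lborel. x \<in> V \<longrightarrow> u (x + h *\<^sub>R b) - u x = h * avg (seg (h *\<^sub>R b)) (\<lambda>x. g x \<bullet> b) x"
proof -
  interpret P: averaging "seg (h *\<^sub>R b)" by (rule averaging_seg)
  interpret N: averaging "seg (- (h *\<^sub>R b))" by (rule averaging_seg)
  note u' = sobolevD[OF u]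
  have gb: "square_int lborel (\<lambda>x. g x \<bullet> b)" by (rule square_int_inner[OF u'(2)])
  note ga = P.avg_square_int[OF gb]
  have um[measurable]: "u \<in> borel_measurable borel" "(\<lambda>x. g x \<bullet> b) \<in> borel_measurable borel"
    using u' gb by (auto simp: square_int_def)
  let ?A = "avg (seg (h *\<^sub>R b)) (\<lambda>x. g x \<bullet> b)"
  let ?D = "\<lambda>x. u (x + h *\<^sub>R b) - u x - h * ?A x"
  have s1: "square_int lborel (\<lambda>x. u (x + h *\<^sub>R b) - u x)"
    by (intro square_int_diff square_int_shift(1) u'(1))
  have "AE x in lborel. x \<in> V \<longrightarrow> ?D x = 0"
  proof (rule du_Bois_Reymond_L2[OF square_int_diff[OF s1 square_int_cmult(1)[OF ga]] V(1)])
    fix \<phi> assume p: "\<phi> \<in> test_functions V"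
    note t = test_square_int[OF p] and tk = test_smooth[OF p, of "Suc 0"]
    have tm[measurable]: "\<phi> \<in> borel_measurable borel" "dd \<phi> b \<in> borel_measurable borel" for b
      using test_square_int[OF p] by (auto simp: square_int_def)
    have lin: "dd \<phi> (- (h *\<^sub>R b)) x = - h * dd \<phi> b x" for x
      using grad_inner[OF tk, of x] by (simp flip: grad_inner[OF tk])
    have key: "(\<integral>y. dd \<phi> (- (h *\<^sub>R b)) (y - (s * h) *\<^sub>R b) * u y \<partial>lborel) = h * (\<integral>y. (g (y + (s * h) *\<^sub>R b) \<bullet> b) * \<phi> y \<partial>lborel)"
      if s: "0 \<le> s" "s \<le> 1" for s
    proof -
      have ts: "(\<lambda>x. \<phi> (x - (s * h) *\<^sub>R b)) \<in> test_functions S"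
        by (rule test_shift(1)[OF p V(2)[OF _ s]])
      have ts2: "dd (\<lambda>x. \<phi> (x - (s * h) *\<^sub>R b)) b y = dd \<phi> b (y - (s * h) *\<^sub>R b)" for y
        using dd_affine[OF tk, where a=1 and c="- ((s * h) *\<^sub>R b)" and v=b and x=y] by simp
      have "(\<integral>y. dd \<phi> (- (h *\<^sub>R b)) (y - (s * h) *\<^sub>R b) * u y \<partial>lborel)
          = (\<integral>y. - h * (u y * dd (\<lambda>x. \<phi> (x - (s * h) *\<^sub>R b)) b y) \<partial>lborel)"
        unfolding lin ts2 by (simp add: mult.commute mult.left_commute)
      also have "\<dots> = - h * (\<integral>y. u y * dd (\<lambda>x. \<phi> (x - (s * h) *\<^sub>R b)) b y \<partial>lborel)"
        by (rule integral_mult_right_zero)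
      also have "\<dots> = h * (\<integral>y. (g y \<bullet> b) * \<phi> (y - (s * h) *\<^sub>R b) \<partial>lborel)"
        using u'(5)[OF ts b] by simp
      also have "(\<integral>y. (g y \<bullet> b) * \<phi> (y - (s * h) *\<^sub>R b) \<partial>lborel) = (\<integral>y. (g (y + (s * h) *\<^sub>R b) \<bullet> b) * \<phi> y \<partial>lborel)"
        using lborel_integral_shift[of "\<lambda>y. (g y \<bullet> b) * \<phi> (y - (s * h) *\<^sub>R b)" "(s * h) *\<^sub>R b"] by simp
      finally show ?thesis .
    qed
    have "(\<integral>x. (u (x + h *\<^sub>R b) - u x) * \<phi> x \<partial>lborel) = (\<integral>x. u (x + h *\<^sub>R b) * \<phi> x \<partial>lborel) - (\<integral>x. u x * \<phi> x \<partial>lborel)"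
      using mult_integrable[OF square_int_shift(1)[OF u'(1)] t(1)] mult_integrable[OF u'(1) t(1)]
      by (simp add: left_diff_distrib)
    also have "(\<integral>x. u (x + h *\<^sub>R b) * \<phi> x \<partial>lborel) = (\<integral>x. u x * \<phi> (x + - (h *\<^sub>R b)) \<partial>lborel)"
      using lborel_integral_shift[of "\<lambda>x. u x * \<phi> (x - h *\<^sub>R b)" "h *\<^sub>R b"] by simp
    also have "\<dots> - (\<integral>x. u x * \<phi> x \<partial>lborel) = (\<integral>x. u x * \<phi> (x + - (h *\<^sub>R b)) - u x * \<phi> x \<partial>lborel)"
      by (rule Bochner_Integration.integral_diff[symmetric, OF mult_integrable[OF u'(1) square_int_shift(1)[OF t(1)]] mult_integrable[OF u'(1) t(1)]])
    also have "\<dots> = (\<integral>x. avg (seg (- (h *\<^sub>R b))) (dd \<phi> (- (h *\<^sub>R b))) x \<bullet> u x \<partial>lborel)"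
      by (simp flip: increment_avg_seg[OF tk] add: algebra_simps)
    also have "\<dots> = (\<integral>z. (\<integral>y. dd \<phi> (- (h *\<^sub>R b)) (y + z) \<bullet> u y \<partial>lborel) \<partial>seg (- (h *\<^sub>R b)))"
      by (rule N.avg_inner[OF t(3) u'(1)])
    also have "\<dots> = (\<integral>s. indicator {0..1} s *\<^sub>R (\<integral>y. dd \<phi> (- (h *\<^sub>R b)) (y + s *\<^sub>R - (h *\<^sub>R b)) \<bullet> u y \<partial>lborel) \<partial>lborel)"
      by (rule integral_seg) measurable
    also have "\<dots> = (\<integral>s. h * (indicator {0..1} s *\<^sub>R (\<integral>y. (g (y + s *\<^sub>R (h *\<^sub>R b)) \<bullet> b) \<bullet> \<phi> y \<partial>lborel)) \<partial>lborel)"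
      by (rule Bochner_Integration.integral_cong[OF refl]) (auto simp: key split: split_indicator)
    also have "\<dots> = h * (\<integral>s. indicator {0..1} s *\<^sub>R (\<integral>y. (g (y + s *\<^sub>R (h *\<^sub>R b)) \<bullet> b) \<bullet> \<phi> y \<partial>lborel) \<partial>lborel)"
      by (rule integral_mult_right_zero)
    also have "(\<integral>s. indicator {0..1} s *\<^sub>R (\<integral>y. (g (y + s *\<^sub>R (h *\<^sub>R b)) \<bullet> b) \<bullet> \<phi> y \<partial>lborel) \<partial>lborel)
        = (\<integral>z. (\<integral>y. (g (y + z) \<bullet> b) \<bullet> \<phi> y \<partial>lborel) \<partial>seg (h *\<^sub>R b))"
      by (rule integral_seg[symmetric]) measurable
    also have "\<dots> = (\<integral>x. ?A x \<bullet> \<phi> x \<partial>lborel)"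
      by (rule P.avg_inner[OF gb t(1), symmetric])
    finally have "(\<integral>x. (u (x + h *\<^sub>R b) - u x) * \<phi> x \<partial>lborel) = (\<integral>x. (h * ?A x) * \<phi> x \<partial>lborel)"
      by (simp add: mult.assoc)
    then show "(\<integral>x. ?D x * \<phi> x \<partial>lborel) = 0"
      using mult_integrable[OF s1 t(1)] mult_integrable[OF square_int_cmult(1)[OF ga, of h] t(1)]
      by (simp add: left_diff_distrib)
  qed
  then show ?thesis by simp
qed

text \<open>Each of the three limits holds in \<open>L\<^sup>2\<close>, hence almost everywhere along a subsequence. The
  additional function \<open>f\<close> will be the indicator of a level set.\<close>

lemma difference_quotients:
  assumes S: "open S" and u: "sobolev S u g" and b: "b \<in> Basis" and K: "compact K" "K \<subseteq> S"
    and f: "square_int lborel (f :: 'a::euclidean_space \<Rightarrow> real)"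
  obtains h :: "nat \<Rightarrow> real" where "\<forall>n. h n > 0" "h \<longlonglongrightarrow> 0"
    "AE x in lborel. (\<lambda>n. u (x + h n *\<^sub>R b)) \<longlonglongrightarrow> u x"
    "AE x in lborel. (\<lambda>n. f (x + h n *\<^sub>R b)) \<longlonglongrightarrow> f x"
    "AE x in lborel. (\<lambda>n. avg (seg (h n *\<^sub>R b)) (\<lambda>x. g x \<bullet> b) x) \<longlonglongrightarrow> g x \<bullet> b"
    "\<forall>n. AE x in lborel. x \<in> K \<longrightarrow> u (x + h n *\<^sub>R b) - u x = h n * avg (seg (h n *\<^sub>R b)) (\<lambda>x. g x \<bullet> b) x"
proof -
  note u' = sobolevD[OF u]
  have gb: "square_int lborel (\<lambda>x. g x \<bullet> b)" by (rule square_int_inner[OF u'(2)])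
  obtain r where r: "r > 0" "(\<Union>x\<in>K. cball x r) \<subseteq> S"
    using compact_subset_open_imp_cball_epsilon_subset[OF K(1) S K(2)] by metis
  \<comment> \<open>Steps below \<open>r / 2\<close> keep the segments that start within \<open>r
    / 2\<close> of \<open>K\<close> inside \<open>S\<close>.\<close>
  define k where "k n = (r / 2) * (1 / real (Suc n))" for n
  have k: "k n > 0" "k n \<le> r / 2" for n using r(1) by (auto simp: k_def field_simps)
  have k0: "k \<longlonglongrightarrow> 0"
    unfolding k_def using tendsto_mult[OF tendsto_const LIMSEQ_Suc[OF lim_1_over_n], of "r/2"] by simp
  have kb: "(\<lambda>n. k (r n) *\<^sub>R b) \<longlonglongrightarrow> 0" if "strict_mono r" for r :: "nat \<Rightarrow> nat"
    using tendsto_scaleR[OF LIMSEQ_subseq_LIMSEQ[OF k0 that] tendsto_const, of b] by (simp add: comp_def)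
  have kb0: "(\<lambda>n. k n *\<^sub>R b) \<longlonglongrightarrow> 0" using kb[OF strict_mono_id] by simp
  obtain r1 where r1: "strict_mono r1" "AE x in lborel. (\<lambda>n. u (x + k (r1 n) *\<^sub>R b)) \<longlonglongrightarrow> u x"
    by (rule sq_norm_AE_subseq[OF square_int_shift(1)[OF u'(1)] u'(1) translation_tendsto[OF u'(1) kb0]])
  obtain r2 where r2: "strict_mono r2" "AE x in lborel. (\<lambda>n. f (x + k (r1 (r2 n)) *\<^sub>R b)) \<longlonglongrightarrow> f x"
    by (rule sq_norm_AE_subseq[OF square_int_shift(1)[OF f] f translation_tendsto[OF f kb[OF r1(1)]]])
  have m12: "strict_mono (\<lambda>n. r1 (r2 n))" using strict_mono_compose[OF r1(1) r2(1)] by (simp add: comp_def)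
  obtain r3 where r3: "strict_mono r3"
    "AE x in lborel. (\<lambda>n. avg (seg (k (r1 (r2 (r3 n))) *\<^sub>R b)) (\<lambda>x. g x \<bullet> b) x) \<longlonglongrightarrow> g x \<bullet> b"
    by (rule sq_norm_AE_subseq[OF averaging.avg_square_int[OF averaging_seg gb] gb avg_seg_tendsto[OF gb kb[OF m12]]])
  define h where "h n = k (r1 (r2 (r3 n)))" for n
  have m23: "strict_mono (\<lambda>n. r2 (r3 n))" using strict_mono_compose[OF r2(1) r3(1)] by (simp add: comp_def)
  have m: "strict_mono (\<lambda>n. r1 (r2 (r3 n)))" using strict_mono_compose[OF m12 r3(1)] by (simp add: comp_def)
  show ?thesis
  proof (rule that)
    show "\<forall>n. h n > 0" using k by (simp add: h_def)
    show "h \<longlonglongrightarrow> 0" unfolding h_def using LIMSEQ_subseq_LIMSEQ[OF k0 m] by (simp add: comp_def)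
    show "AE x in lborel. (\<lambda>n. u (x + h n *\<^sub>R b)) \<longlonglongrightarrow> u x"
      using r1(2)
    proof eventually_elim
      case (elim x)
      from LIMSEQ_subseq_LIMSEQ[OF elim m23] show ?case by (simp add: comp_def h_def)
    qed
    show "AE x in lborel. (\<lambda>n. f (x + h n *\<^sub>R b)) \<longlonglongrightarrow> f x"
      using r2(2)
    proof eventually_elim
      case (elim x)
      from LIMSEQ_subseq_LIMSEQ[OF elim r3(1)] show ?case by (simp add: comp_def h_def)
    qed
    show "AE x in lborel. (\<lambda>n. avg (seg (h n *\<^sub>R b)) (\<lambda>x. g x \<bullet> b) x) \<longlonglongrightarrow> g x \<bullet> b"
      using r3(2) by (simp add: h_def)
    show "\<forall>n. AE x in lborel. x \<in> K \<longrightarrow> u (x + h n *\<^sub>R b) - u x = h n * avg (seg (h n *\<^sub>R b)) (\<lambda>x. g x \<bullet> b) x"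
    proof (rule allI)
      fix n
      have "AE x in lborel. x \<in> (\<Union>x\<in>K. ball x (r / 2)) \<longrightarrow>
          u (x + h n *\<^sub>R b) - u x = h n * avg (seg (h n *\<^sub>R b)) (\<lambda>x. g x \<bullet> b) x"
      proof (rule sobolev_increment[OF u b])
        fix x and s :: real assume x: "x \<in> (\<Union>x\<in>K. ball x (r / 2))" and s: "0 \<le> s" "s \<le> 1"
        then obtain y where y: "y \<in> K" "dist y x < r / 2" by auto
        have "s * h n \<le> 1 * (r / 2)"
          unfolding h_def using s k[of "r1 (r2 (r3 n))"] r(1) by (intro mult_mono) auto
        then have "norm ((s * h n) *\<^sub>R b) \<le> r / 2"
          using s k(1)[of "r1 (r2 (r3 n))"] b by (simp add: abs_mult h_def)
        then have "dist y (x + (s * h n) *\<^sub>R b) \<le> r"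
          using y(2) dist_triangle[of y "x + (s * h n) *\<^sub>R b" x] by (simp add: dist_norm)
        then show "x + (s * h n) *\<^sub>R b \<in> S" using r(2) y(1) by fastforce
      qed (intro open_UN ballI open_ball)
      then show "AE x in lborel. x \<in> K \<longrightarrow> u (x + h n *\<^sub>R b) - u x = h n * avg (seg (h n *\<^sub>R b)) (\<lambda>x. g x \<bullet> b) x"
      proof eventually_elim
        case (elim x)
        then show ?case using r(1) by (meson UN_I centre_in_ball half_gt_zero)
      qed
    qed
  qed
qed

text \<open>At almost every point \<open>x\<close> of the level set \<open>{u = c}\<close> there are \<open>h\<^sub>n \<rightarrow> 0\<close> such that
  \<open>x + h\<^sub>n b\<close> also lies in the level set; the difference quotients along these vanish.\<close>

lemma gradient_zero_on_level_set:
  assumes S: "open S" and u: "sobolev S u g"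
  shows "AE x in lborel. u x = c \<longrightarrow> g x = 0"
proof -
  have um[measurable]: "u \<in> borel_measurable borel" using sobolevD(1)[OF u] by (simp add: square_int_def)
  have "AE x in lborel. x \<in> S \<longrightarrow> (u x = c \<longrightarrow> g x = 0)"
  proof (rule AE_lborel_compact_exhaustion[OF S])
    fix K assume K: "compact K" "K \<subseteq> S"
    have Km[measurable]: "K \<in> sets borel" using K by (simp add: borel_compact)
    let ?Z = "{x\<in>K. u x = c}"
    let ?f = "indicator ?Z :: 'a \<Rightarrow> real"
    have "?Z \<in> sets borel" by measurable
    moreover have "emeasure lborel ?Z < \<infinity>"
      using emeasure_bounded_finite[of ?Z] bounded_subset[OF compact_imp_bounded[OF K(1)], of ?Z] by auto
    ultimately have f: "square_int lborel ?f" using square_int_indicator[of ?Z lborel 1] by simp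
    have "AE x in lborel. (x \<in> K \<and> u x = c) \<longrightarrow> g x = 0"
    proof (rule AE_Basis_eq)
      fix b :: 'a assume b: "b \<in> Basis"
      obtain h :: "nat \<Rightarrow> real" where h: "\<forall>n. h n > 0" "h \<longlonglongrightarrow> 0"
        "AE x in lborel. (\<lambda>n. u (x + h n *\<^sub>R b)) \<longlonglongrightarrow> u x"
        "AE x in lborel. (\<lambda>n. ?f (x + h n *\<^sub>R b)) \<longlonglongrightarrow> ?f x"
        "AE x in lborel. (\<lambda>n. avg (seg (h n *\<^sub>R b)) (\<lambda>x. g x \<bullet> b) x) \<longlonglongrightarrow> g x \<bullet> b"
        "\<forall>n. AE x in lborel. x \<in> K \<longrightarrow> u (x + h n *\<^sub>R b) - u x = h n * avg (seg (h n *\<^sub>R b)) (\<lambda>x. g x \<bullet> b) x"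
        by (rule difference_quotients[OF S u b K f])
      have h4: "AE x in lborel. \<forall>n. x \<in> K \<longrightarrow> u (x + h n *\<^sub>R b) - u x = h n * avg (seg (h n *\<^sub>R b)) (\<lambda>x. g x \<bullet> b) x"
        using h(6) unfolding AE_all_countable by blast
      show "AE x in lborel. (x \<in> K \<and> u x = c) \<longrightarrow> g x \<bullet> b = 0 \<bullet> b"
        using h(4,5) h4
      proof eventually_elim
        case (elim x)
        show ?case
        proof
          assume x: "x \<in> K \<and> u x = c"
          then have "(\<lambda>n. ?f (x + h n *\<^sub>R b)) \<longlonglongrightarrow> 1" using elim(1) by simp
          then have "\<forall>\<^sub>F n in sequentially. ?f (x + h n *\<^sub>R b) > 1 / 2" by (rule order_tendstoD(1)) simp
          then have "\<forall>\<^sub>F n in sequentially. avg (seg (h n *\<^sub>R b)) (\<lambda>x. g x \<bullet> b) x = 0"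
          proof eventually_elim
            case e: (elim n)
            then have "u (x + h n *\<^sub>R b) = c" by (auto split: split_indicator_asm)
            then have "h n * avg (seg (h n *\<^sub>R b)) (\<lambda>x. g x \<bullet> b) x = 0" using x elim(3)[rule_format, of n] by simp
            then show ?case using h(1)[rule_format, of n] by simp
          qed
          then have "(\<lambda>n. avg (seg (h n *\<^sub>R b)) (\<lambda>x. g x \<bullet> b) x) \<longlonglongrightarrow> 0" by (rule tendsto_eventually)
          then show "g x \<bullet> b = 0 \<bullet> b" using LIMSEQ_unique[OF elim(2)] by simp
        qed
      qed
    qed
    then show "AE x in lborel. x \<in> K \<longrightarrow> (u x = c \<longrightarrow> g x = 0)" by eventually_elim auto
  qed
  then show ?thesis by eventually_elim (use sobolevD(4)[OF u] in blast)
qed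

abbreviation unit_clip :: "real \<Rightarrow> real" where
  "unit_clip t \<equiv> min (max t 0) 1"

definition clip_gradient :: "('a \<Rightarrow> real) \<Rightarrow> ('a \<Rightarrow> 'b::real_vector) \<Rightarrow> 'a \<Rightarrow> 'b" where
  "clip_gradient u g x = (if 0 < u x \<and> u x < 1 then g x else 0)"

lemma unit_clip_lipschitz: "\<bar>unit_clip s - unit_clip t\<bar> \<le> \<bar>s - t\<bar>"
  by (auto simp: min_def max_def)

lemma unit_clip_abs_le: "\<bar>unit_clip t\<bar> \<le> \<bar>t\<bar>"
  by (auto simp: min_def max_def)

text \<open>The difference quotients of \<open>unit_clip \<circ> u\<close> are dominated by those of \<open>u\<close>, which converge in
  \<open>L\<^sup>2\<close>. Their pointwise limit is clear where \<open>u\<close> avoids the corners \<open>0\<close> and \<open>1\<close>, and on the two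
  exceptional level sets the limit is zero because \<open>g\<close> vanishes there.\<close>

lemma sobolev_unit_clip:
  assumes S: "open S" and u: "sobolev S u g"
  shows "sobolev S (\<lambda>x. unit_clip (u x)) (clip_gradient u g)"
proof -
  note u' = sobolevD[OF u]
  have um[measurable]: "u \<in> borel_measurable borel" "g \<in> borel_measurable borel" using u' by (auto simp: square_int_def)
  have cm[measurable]: "clip_gradient u g \<in> borel_measurable borel" unfolding clip_gradient_def[abs_def] by measurable
  have s1: "square_int lborel (\<lambda>x. unit_clip (u x))"
    by (rule square_int_mono(1)[OF u'(1)]) (use unit_clip_abs_le in \<open>auto intro!: AE_I2\<close>)
  have s2: "square_int lborel (clip_gradient u g)"
    by (rule square_int_mono(1)[OF u'(2)]) (auto intro!: AE_I2 simp: clip_gradient_def)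
  have "(\<integral>x. unit_clip (u x) * dd \<phi> b x \<partial>lborel) = - (\<integral>x. (clip_gradient u g x \<bullet> b) * \<phi> x \<partial>lborel)"
    if p: "\<phi> \<in> test_functions S" and b: "b \<in> Basis" for \<phi> b
  proof -
    obtain K where K: "compact K" "K \<subseteq> S" "\<And>x. x \<notin> K \<Longrightarrow> \<phi> x = 0" using test_support[OF p] by metis
    note t = test_square_int[OF p] and tk = test_smooth[OF p, of "Suc 0"]
    have gb: "square_int lborel (\<lambda>x. g x \<bullet> b)" by (rule square_int_inner[OF u'(2)])
    have Km[measurable]: "K \<in> sets borel" using K by (simp add: borel_compact)
    obtain h :: "nat \<Rightarrow> real" where h: "\<forall>n. h n > 0" "h \<longlonglongrightarrow> 0"
      "AE x in lborel. (\<lambda>n. u (x + h n *\<^sub>R b)) \<longlonglongrightarrow> u x"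
      "AE x in lborel. (\<lambda>n. u (x + h n *\<^sub>R b)) \<longlonglongrightarrow> u x"
      "AE x in lborel. (\<lambda>n. avg (seg (h n *\<^sub>R b)) (\<lambda>x. g x \<bullet> b) x) \<longlonglongrightarrow> g x \<bullet> b"
      "\<forall>n. AE x in lborel. x \<in> K \<longrightarrow> u (x + h n *\<^sub>R b) - u x = h n * avg (seg (h n *\<^sub>R b)) (\<lambda>x. g x \<bullet> b) x"
      by (rule difference_quotients[OF S u b K(1,2) u'(1)])
    define Q where "Q n = avg (seg (h n *\<^sub>R b)) (\<lambda>x. g x \<bullet> b)" for n
    define R where "R n x = indicator K x * ((unit_clip (u (x + h n *\<^sub>R b)) - unit_clip (u x)) / h n)" for n x
    define R' where "R' x = indicator K x * (clip_gradient u g x \<bullet> b)" for x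
    have Qs: "square_int lborel (Q n)" for n unfolding Q_def by (rule averaging.avg_square_int[OF averaging_seg gb])
    have hb: "(\<lambda>n. h n *\<^sub>R b) \<longlonglongrightarrow> 0" "(\<lambda>n. - (h n *\<^sub>R b)) \<longlonglongrightarrow> 0"
      using tendsto_scaleR[OF h(2) tendsto_const, of b] tendsto_minus[OF tendsto_scaleR[OF h(2) tendsto_const, of b]] by auto
    have Ql: "(\<lambda>n. sq_norm lborel (\<lambda>x. Q n x - g x \<bullet> b)) \<longlonglongrightarrow> 0"
      unfolding Q_def by (rule avg_seg_tendsto[OF gb hb(1)])
    have Rm: "R n \<in> borel_measurable lborel" for n unfolding R_def by measurable
    have R'm: "R' \<in> borel_measurable lborel" unfolding R'_def by measurable
    have h5: "AE x in lborel. \<forall>n. x \<in> K \<longrightarrow> u (x + h n *\<^sub>R b) - u x = h n * Q n x"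
      using h(6) unfolding AE_all_countable Q_def by blast
    have Rle: "\<bar>(unit_clip (u (x + h n *\<^sub>R b)) - unit_clip (u x)) / h n\<bar> \<le> \<bar>Q n x\<bar>"
      if "u (x + h n *\<^sub>R b) - u x = h n * Q n x" for x n
      using unit_clip_lipschitz[of "u (x + h n *\<^sub>R b)" "u x"] h(1)[rule_format, of n] that
      by (simp add: abs_divide abs_mult field_simps)
    have Rbd: "AE x in lborel. norm (R n x) \<le> norm (Q n x)" for n
      using h5
    proof eventually_elim
      case (elim x)
      then show ?case using Rle[of x n] by (auto simp: R_def split: split_indicator)
    qed
    have R'bd: "AE x in lborel. norm (R' x) \<le> norm (g x \<bullet> b)"
      by (auto intro!: AE_I2 simp: R'_def clip_gradient_def split: split_indicator)
    have Rlim: "AE x in lborel. (\<lambda>n. R n x) \<longlonglongrightarrow> R' x"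
      using h(3,5) h5 gradient_zero_on_level_set[OF S u, of 0] gradient_zero_on_level_set[OF S u, of 1]
    proof eventually_elim
      case (elim x)
      note ql = elim(2)[folded Q_def]
      show ?case
      proof (cases "x \<in> K")
        case False
        then show ?thesis by (simp add: R_def R'_def)
      next
        case True
        then have inc: "u (x + h n *\<^sub>R b) - u x = h n * Q n x" for n using elim(3) by blast
        consider "u x < 0" | "u x > 1" | "0 < u x" "u x < 1" | "u x = 0 \<or> u x = 1" by linarith
        then show ?thesis
        proof cases
          case 1
          have "\<forall>\<^sub>F n in sequentially. u (x + h n *\<^sub>R b) < 0" by (rule order_tendstoD(2)[OF elim(1) 1])
          then have "\<forall>\<^sub>F n in sequentially. R n x = R' x"
            by eventually_elim (use 1 in \<open>simp add: R_def R'_def clip_gradient_def\<close>)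
          then show ?thesis by (rule tendsto_eventually)
        next
          case 2
          have "\<forall>\<^sub>F n in sequentially. u (x + h n *\<^sub>R b) > 1" by (rule order_tendstoD(1)[OF elim(1) 2])
          then have "\<forall>\<^sub>F n in sequentially. R n x = R' x"
            by eventually_elim (use 2 in \<open>simp add: R_def R'_def clip_gradient_def\<close>)
          then show ?thesis by (rule tendsto_eventually)
        next
          case 3
          have "\<forall>\<^sub>F n in sequentially. R n x = Q n x"
            using order_tendstoD(1)[OF elim(1) 3(1)] order_tendstoD(2)[OF elim(1) 3(2)]
          proof eventually_elim
            case e: (elim n)
            then have "R n x = (u (x + h n *\<^sub>R b) - u x) / h n" using 3 True by (simp add: R_def)
            then show ?case using inc[of n] h(1)[rule_format, of n] by simp
          qed
          moreover have "R' x = g x \<bullet> b" using 3 True by (simp add: R'_def clip_gradient_def)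
          ultimately show ?thesis
            using ql tendsto_cong[of "\<lambda>n. R n x" "\<lambda>n. Q n x" sequentially "g x \<bullet> b"] by simp
        next
          case 4
          then have "g x = 0" using elim(4,5) by blast
          then have q0: "(\<lambda>n. Q n x) \<longlonglongrightarrow> 0" using ql by simp
          have "(\<lambda>n. R n x) \<longlonglongrightarrow> 0"
          proof (rule Lim_null_comparison[OF always_eventually tendsto_rabs_zero[OF q0]], rule allI)
            show "norm (R n x) \<le> \<bar>Q n x\<bar>" for n using Rle[OF inc[of n]] True by (simp add: R_def)
          qed
          moreover have "R' x = 0" using \<open>g x = 0\<close> by (simp add: R'_def clip_gradient_def)
          ultimately show ?thesis by simp
        qed
      qed
    qed
    note Rconv = sq_norm_moving_dominated_convergence[OF Rm R'm Qs gb Ql Rbd R'bd Rlim]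
    have Rs: "square_int lborel (R n)" for n by (rule square_int_mono(1)[OF Qs Rm Rbd])
    have R's: "square_int lborel R'" by (rule square_int_mono(1)[OF gb R'm R'bd])
    have l1: "(\<lambda>n. \<integral>x. R n x * \<phi> x \<partial>lborel) \<longlonglongrightarrow> (\<integral>x. R' x * \<phi> x \<partial>lborel)"
      by (rule mult_tendsto[OF Rs R's t(1) Rconv])
    have l2: "(\<lambda>n. \<integral>x. avg (seg (- (h n *\<^sub>R b))) (dd \<phi> b) x * unit_clip (u x) \<partial>lborel) \<longlonglongrightarrow> (\<integral>x. dd \<phi> b x * unit_clip (u x) \<partial>lborel)"
      by (rule mult_tendsto[OF averaging.avg_square_int[OF averaging_seg t(3)] t(3) s1 avg_seg_tendsto[OF t(3) hb(2)]])
    have eq: "(\<integral>x. R n x * \<phi> x \<partial>lborel) = - (\<integral>x. avg (seg (- (h n *\<^sub>R b))) (dd \<phi> b) x * unit_clip (u x) \<partial>lborel)" for n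
    proof -
      let ?c = "h n *\<^sub>R b"
      let ?T = "\<lambda>x. unit_clip (u x)"
      have inc: "\<phi> (x + - ?c) - \<phi> x = - h n * avg (seg (- ?c)) (dd \<phi> b) x" for x
      proof -
        have "dd \<phi> (- ?c) = (\<lambda>x. - h n * dd \<phi> b x)"
          by (rule ext) (simp flip: grad_inner[OF tk])
        then show ?thesis using increment_avg_seg[OF tk, of x "- ?c"] by (simp add: avg_def)
      qed
      have "(\<integral>x. R n x * \<phi> x \<partial>lborel) = (\<integral>x. (1 / h n) * (?T (x + ?c) * \<phi> x - ?T x * \<phi> x) \<partial>lborel)"
      proof (rule Bochner_Integration.integral_cong[OF refl])
        fix x show "R n x * \<phi> x = (1 / h n) * (?T (x + ?c) * \<phi> x - ?T x * \<phi> x)"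
          using K(3)[of x] by (cases "x \<in> K") (simp_all add: R_def algebra_simps diff_divide_distrib)
      qed
      also have "\<dots> = (1 / h n) * (\<integral>x. ?T (x + ?c) * \<phi> x - ?T x * \<phi> x \<partial>lborel)" by (rule integral_mult_right_zero)
      also have "(\<integral>x. ?T (x + ?c) * \<phi> x - ?T x * \<phi> x \<partial>lborel) = (\<integral>x. ?T (x + ?c) * \<phi> x \<partial>lborel) - (\<integral>x. ?T x * \<phi> x \<partial>lborel)"
        by (rule Bochner_Integration.integral_diff[OF mult_integrable[OF square_int_shift(1)[OF s1] t(1)] mult_integrable[OF s1 t(1)]])
      also have "(\<integral>x. ?T (x + ?c) * \<phi> x \<partial>lborel) = (\<integral>x. ?T x * \<phi> (x + - ?c) \<partial>lborel)"
        using lborel_integral_shift[of "\<lambda>x. ?T x * \<phi> (x - ?c)" ?c] by simp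
      also have "\<dots> - (\<integral>x. ?T x * \<phi> x \<partial>lborel) = (\<integral>x. ?T x * \<phi> (x + - ?c) - ?T x * \<phi> x \<partial>lborel)"
        by (rule Bochner_Integration.integral_diff[symmetric, OF mult_integrable[OF s1 square_int_shift(1)[OF t(1)]] mult_integrable[OF s1 t(1)]])
      also have "\<dots> = (\<integral>x. - h n * (avg (seg (- ?c)) (dd \<phi> b) x * ?T x) \<partial>lborel)"
      proof (rule Bochner_Integration.integral_cong[OF refl])
        fix x
        have "?T x * \<phi> (x + - ?c) - ?T x * \<phi> x = ?T x * (\<phi> (x + - ?c) - \<phi> x)" by (simp only: right_diff_distrib)
        then show "?T x * \<phi> (x + - ?c) - ?T x * \<phi> x = - h n * (avg (seg (- ?c)) (dd \<phi> b) x * ?T x)"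
          unfolding inc by simp
      qed
      also have "\<dots> = - h n * (\<integral>x. avg (seg (- ?c)) (dd \<phi> b) x * ?T x \<partial>lborel)" by (rule integral_mult_right_zero)
      finally show ?thesis using h(1)[rule_format, of n] by simp
    qed
    have "(\<lambda>n. \<integral>x. R n x * \<phi> x \<partial>lborel) \<longlonglongrightarrow> - (\<integral>x. dd \<phi> b x * unit_clip (u x) \<partial>lborel)"
      unfolding eq by (rule tendsto_minus[OF l2])
    then have "(\<integral>x. R' x * \<phi> x \<partial>lborel) = - (\<integral>x. dd \<phi> b x * unit_clip (u x) \<partial>lborel)"
      using LIMSEQ_unique[OF l1] by simp
    moreover have "R' x * \<phi> x = (clip_gradient u g x \<bullet> b) * \<phi> x" for x
      using K(3)[of x] by (auto simp: R'_def split: split_indicator)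
    ultimately show ?thesis by (simp add: mult.commute)
  qed
  then show ?thesis
    unfolding sobolev_def using s1 s2 u'(3,4) by (auto simp: clip_gradient_def)
qed

section \<open>The segment property\<close>

text \<open>A weak form of boundary regularity. Points of the open set itself satisfy it with \<open>e = 0\<close>.\<close>

definition segment_property :: "'a::euclidean_space set \<Rightarrow> bool" where
  "segment_property S \<longleftrightarrow> (\<forall>x\<in>closure S. \<exists>r>0. \<exists>e. \<forall>y\<in>closure S \<inter> ball x r. \<forall>t. 0 < t \<and> t < 1 \<longrightarrow> y + t *\<^sub>R e \<in> S)"

text \<open>In a boundary chart the set is \<open>G > 0\<close> for the continuous function \<open>G y = y\<^sub>d -
  F(y\<^sub>1, \<dots>, y\<^sub>d\<^sub>-\<^sub>1)\<close>, so \<open>G \<ge> 0\<close> on its closure. A step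
  of length \<open>t\<close> along the last coordinate axis \<open>e0\<close> raises \<open>G\<close> by
  \<open>t\<close>.\<close>

lemma continuous_boundary_segment_property:
  fixes S :: "'a::euclidean_space set"
  assumes "open S" "continuous_boundary S"
  shows "segment_property S"
  unfolding segment_property_def
proof
  fix x assume x: "x \<in> closure S"
  show "\<exists>r>0. \<exists>e. \<forall>y\<in>closure S \<inter> ball x r. \<forall>t. 0 < t \<and> t < 1 \<longrightarrow> y + t *\<^sub>R e \<in> S"
  proof (cases "x \<in> S")
    case True
    then obtain r where "r > 0" "ball x r \<subseteq> S" using assms(1) open_contains_ball by metis
    then show ?thesis by (intro exI[of _ r] conjI exI[of _ 0]) auto
  next
    case False
    then have "x \<in> frontier S" using x assms(1) by (simp add: frontier_def interior_open)
    then obtain W p T b F where W: "open W" "x \<in> W" and T: "orthogonal_transformation (T :: 'a \<Rightarrow> 'a)" and b: "b \<in> Basis"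
      and F: "continuous_on {z. z \<bullet> b = 0} (F :: 'a \<Rightarrow> real)"
      and eq: "S \<inter> W = {y. let z = T (y - p) in z \<bullet> b > F (z - (z \<bullet> b) *\<^sub>R b)} \<inter> W"
      using assms(2) unfolding continuous_boundary_def by meson
    have lin: "linear T" using T by (simp add: orthogonal_transformation_def)
    obtain e0 where e0: "T e0 = b" using orthogonal_transformation_surj[OF T] by (metis surjD)
    have ne: "norm e0 = 1" using orthogonal_transformation_norm[OF T, of e0] e0 b by simp
    have bb: "b \<bullet> b = 1" using b by simp
    define G where "G y = T (y - p) \<bullet> b - F (T (y - p) - (T (y - p) \<bullet> b) *\<^sub>R b)" for y
    have Tc: "continuous_on UNIV (\<lambda>y. T (y - p))"
      by (intro continuous_on_compose2[OF linear_continuous_on[OF lin[unfolded linear_conv_bounded_linear], of UNIV]] continuous_intros) auto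
    have Gc: "continuous_on UNIV G"
      unfolding G_def
      by (intro continuous_intros Tc continuous_on_compose2[OF F]) (auto simp: inner_diff_left bb)
    have mem: "y \<in> S \<longleftrightarrow> G y > 0" if "y \<in> W" for y
      using eq that by (auto simp: Let_def G_def set_eq_iff)
    have Gn: "G y \<ge> 0" if y: "y \<in> closure S" "y \<in> W" for y
    proof (rule ccontr)
      assume "\<not> G y \<ge> 0"
      then have "y \<in> W \<inter> {y. G y < 0}" using y by simp
      moreover have "open (W \<inter> {y. G y < 0})"
        using W(1) Gc by (intro open_Int open_Collect_less continuous_intros) auto
      ultimately have "S \<inter> (W \<inter> {y. G y < 0}) \<noteq> {}"
        using y(1) by (metis closure_iff_nhds_not_empty disjoint_iff order_refl)
      then show False using mem by fastforce
    qed
    obtain r where r: "r > 0" "ball x r \<subseteq> W" using W open_contains_ball by metis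
    show ?thesis
    proof (intro exI[of _ "r / 2"] conjI exI[of _ "(r / 2) *\<^sub>R e0"] ballI allI impI)
      fix y t assume y: "y \<in> closure S \<inter> ball x (r / 2)" and t: "0 < t \<and> (t::real) < 1"
      let ?y = "y + t *\<^sub>R (r / 2) *\<^sub>R e0"
      have yW: "y \<in> W" using y r by (auto simp: subset_iff)
      have "norm (t *\<^sub>R (r / 2) *\<^sub>R e0) \<le> r / 2" using t r ne by (simp add: abs_mult)
      then have "dist x ?y < r"
        using y dist_triangle[of x ?y y] by (simp add: dist_norm)
      then have W': "?y \<in> W" using r(2) by auto
      have "?y - p = (y - p) + (t * (r / 2)) *\<^sub>R e0" by (simp add: algebra_simps)
      then have Ty: "T (?y - p) = T (y - p) + (t * (r / 2)) *\<^sub>R b"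
        by (simp only: linear_add[OF lin] linear_scale[OF lin] e0)
      have "G ?y = G y + t * (r / 2)"
        unfolding G_def Ty by (simp add: inner_add_left bb scaleR_add_left)
      then have "G ?y > 0" using Gn[OF _ yW] y t r by (simp add: add_nonneg_pos)
      then show "?y \<in> S" using mem[OF W'] by simp
    qed (use r in auto)
  qed
qed

text \<open>Near a boundary point the translates of the boundary along the segment direction are disjoint
  from the boundary. By continuity of translations in \<open>L\<^sup>2\<close>, a set of positive measure cannot be
  disjoint from arbitrarily small translates of itself.\<close>

lemma frontier_null:
  fixes S :: "'a::euclidean_space set"
  assumes S: "open S" "segment_property S"
  shows "AE x in lborel. x \<notin> frontier S"
proof -
  have "\<exists>r>0. AE y in lborel. y \<in> ball x r \<longrightarrow> y \<notin> frontier S" if x: "x \<in> frontier S" for x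
  proof -
    have "x \<in> closure S" using x by (simp add: frontier_def)
    then obtain r e where r: "r > 0" and e: "\<And>y t. y \<in> closure S \<inter> ball x r \<Longrightarrow> 0 < t \<and> t < 1 \<Longrightarrow> y + t *\<^sub>R e \<in> S"
      using S(2) unfolding segment_property_def by metis
    define N where "N = frontier S \<inter> ball x r"
    have Nb: "N \<in> sets borel" unfolding N_def by (intro sets.Int borel_closed borel_open) auto
    have "bounded N" unfolding N_def using bounded_ball bounded_subset by blast
    then have sq: "square_int lborel (indicator N :: 'a \<Rightarrow> real)"
      using square_int_indicator[of N lborel 1] Nb emeasure_bounded_finite[of N] by simp
    have disj: "indicator N (y + t *\<^sub>R e) * indicator N y = (0::real)" if "0 < t" "t < 1" for y t
    proof -
      have "y + t *\<^sub>R e \<notin> N" if y: "y \<in> N"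
      proof -
        have "y + t *\<^sub>R e \<in> S" using e[of y t] y \<open>0 < t\<close> \<open>t < 1\<close> by (simp add: N_def frontier_def)
        then show ?thesis using S(1) by (simp add: N_def frontier_def interior_open)
      qed
      then show ?thesis by (auto split: split_indicator)
    qed
    have c: "(\<lambda>n. (1 / real (Suc (Suc n))) *\<^sub>R e) \<longlonglongrightarrow> 0"
      using tendsto_scaleR[OF LIMSEQ_Suc[OF LIMSEQ_Suc[OF lim_1_over_n]] tendsto_const, of e] by simp
    have "sq_norm lborel (\<lambda>y. indicator N (y + (1 / real (Suc (Suc n))) *\<^sub>R e) - indicator N y :: real) = 2 * sq_norm lborel (indicator N :: 'a \<Rightarrow> real)" for n
    proof -
      have "0 < 1 / real (Suc (Suc n))" "1 / real (Suc (Suc n)) < 1" by simp_all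
      then show ?thesis
        by (subst sq_norm_diff_expand[OF square_int_shift(1)[OF sq] sq]) (simp add: disj square_int_shift(2)[OF sq])
    qed
    then have "2 * sq_norm lborel (indicator N :: 'a \<Rightarrow> real) = 0"
      using translation_tendsto[OF sq c] LIMSEQ_unique tendsto_const by fastforce
    then have "AE y in lborel. (indicator N y :: real) = 0" using sq_norm_eq_0_iff[OF sq] by simp
    then have "AE y in lborel. y \<in> ball x r \<longrightarrow> y \<notin> frontier S"
      by eventually_elim (auto simp: N_def split: split_indicator_asm)
    then show ?thesis using r by blast
  qed
  then obtain r where r: "\<And>x. x \<in> frontier S \<Longrightarrow> r x > 0"
    "\<And>x. x \<in> frontier S \<Longrightarrow> AE y in lborel. y \<in> ball x (r x) \<longrightarrow> y \<notin> frontier S" by metis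
  obtain D where D: "D \<subseteq> (\<lambda>x. ball x (r x)) ` frontier S" "countable D" "\<Union>D = (\<Union>x\<in>frontier S. ball x (r x))"
    using Lindelof[of "(\<lambda>x. ball x (r x)) ` frontier S"] by auto
  have "AE y in lborel. \<forall>B\<in>D. y \<in> B \<longrightarrow> y \<notin> frontier S"
    by (rule AE_ball_countable[THEN iffD2, OF D(2)]) (use D(1) r(2) in blast)
  then show ?thesis
  proof eventually_elim
    case (elim y)
    show ?case
    proof
      assume y: "y \<in> frontier S"
      then have "y \<in> \<Union>D" unfolding D(3) using r(1) by force
      then show False using elim y by blast
    qed
  qed
qed

section \<open>Approximation by continuous functions with compact support\<close>

definition H1_approx :: "'a::euclidean_space set \<Rightarrow> ('a \<Rightarrow> real) \<Rightarrow> ('a \<Rightarrow> 'a) \<Rightarrow> bool" where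
  "H1_approx S u g \<longleftrightarrow> sobolev S u g \<and> (\<forall>e>0. \<exists>w k. cont_cs w \<and> sobolev S (\<lambda>x. indicator S x * w x) k \<and>
      sq_norm lborel (\<lambda>x. u x - indicator S x * w x) < e \<and> sq_norm lborel (\<lambda>x. g x - k x) < e)"

lemma H1_approx_zero: "H1_approx S (\<lambda>x. 0) (\<lambda>x. 0)"
  unfolding H1_approx_def
proof (intro conjI allI impI sobolev_zero exI)
  show "cont_cs (\<lambda>x. 0)" by (rule cont_cs_zero)
  show "sobolev S (\<lambda>x. indicator S x * (0::real)) (\<lambda>x. 0)" by (simp add: sobolev_zero)
qed auto

lemma H1_approx_closed:
  assumes s: "sobolev S u g"
    and a: "\<And>e. e > 0 \<Longrightarrow> \<exists>v h. H1_approx S v h \<and> sq_norm lborel (\<lambda>x. u x - v x) < e \<and> sq_norm lborel (\<lambda>x. g x - h x) < e"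
  shows "H1_approx S u g"
  unfolding H1_approx_def
proof (intro conjI allI impI s)
  fix e :: real assume "e > 0"
  then have e: "e / 4 > 0" by simp
  obtain v h where v: "H1_approx S v h" "sq_norm lborel (\<lambda>x. u x - v x) < e / 4" "sq_norm lborel (\<lambda>x. g x - h x) < e / 4"
    using a[OF e] by blast
  then have vs: "sobolev S v h" by (simp add: H1_approx_def)
  obtain w k where w: "cont_cs w" "sobolev S (\<lambda>x. indicator S x * w x) k"
    "sq_norm lborel (\<lambda>x. v x - indicator S x * w x) < e / 4" "sq_norm lborel (\<lambda>x. h x - k x) < e / 4"
    using v(1) e unfolding H1_approx_def by blast
  have "sq_norm lborel (\<lambda>x. u x - indicator S x * w x) < e"
    using sq_norm_triangle[OF sobolevD(1)[OF s] sobolevD(1)[OF vs] sobolevD(1)[OF w(2)]] v(2) w(3) by linarith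
  moreover have "sq_norm lborel (\<lambda>x. g x - k x) < e"
    using sq_norm_triangle[OF sobolevD(2)[OF s] sobolevD(2)[OF vs] sobolevD(2)[OF w(2)]] v(3) w(4) by linarith
  ultimately show "\<exists>w k. cont_cs w \<and> sobolev S (\<lambda>x. indicator S x * w x) k \<and>
      sq_norm lborel (\<lambda>x. u x - indicator S x * w x) < e \<and> sq_norm lborel (\<lambda>x. g x - k x) < e"
    using w by blast
qed

lemma H1_approx_add:
  assumes "H1_approx S u g" "H1_approx S v h"
  shows "H1_approx S (\<lambda>x. u x + v x) (\<lambda>x. g x + h x)"
  unfolding H1_approx_def
proof (intro conjI allI impI)
  have us: "sobolev S u g" and vs: "sobolev S v h" using assms by (auto simp: H1_approx_def)
  show "sobolev S (\<lambda>x. u x + v x) (\<lambda>x. g x + h x)" by (rule sobolev_add[OF us vs])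
  fix e :: real assume "e > 0"
  then have e: "e / 4 > 0" by simp
  obtain w k where w: "cont_cs w" "sobolev S (\<lambda>x. indicator S x * w x) k"
    "sq_norm lborel (\<lambda>x. u x - indicator S x * w x) < e / 4" "sq_norm lborel (\<lambda>x. g x - k x) < e / 4"
    using assms(1) e unfolding H1_approx_def by blast
  obtain w' k' where w': "cont_cs w'" "sobolev S (\<lambda>x. indicator S x * w' x) k'"
    "sq_norm lborel (\<lambda>x. v x - indicator S x * w' x) < e / 4" "sq_norm lborel (\<lambda>x. h x - k' x) < e / 4"
    using assms(2) e unfolding H1_approx_def by blast
  note d = sobolev_diff[OF us w(2)] and d' = sobolev_diff[OF vs w'(2)]
  have eq1: "(u x - indicator S x * w x) + (v x - indicator S x * w' x) = u x + v x - indicator S x * (w x + w' x)"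
    and eq2: "(g x - k x) + (h x - k' x) = g x + h x - (k x + k' x)" for x
    by (simp_all add: algebra_simps)
  have "sq_norm lborel (\<lambda>x. u x + v x - indicator S x * (w x + w' x)) < e"
    using sq_norm_add_le[OF sobolevD(1)[OF d] sobolevD(1)[OF d']] w(3) w'(3) unfolding eq1 by linarith
  moreover have "sq_norm lborel (\<lambda>x. g x + h x - (k x + k' x)) < e"
    using sq_norm_add_le[OF sobolevD(2)[OF d] sobolevD(2)[OF d']] w(4) w'(4) unfolding eq2 by linarith
  moreover have "sobolev S (\<lambda>x. indicator S x * (w x + w' x)) (\<lambda>x. k x + k' x)"
    using sobolev_add[OF w(2) w'(2)] by (simp add: distrib_left)
  ultimately show "\<exists>w k. cont_cs w \<and> sobolev S (\<lambda>x. indicator S x * w x) k \<and>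
      sq_norm lborel (\<lambda>x. u x + v x - indicator S x * w x) < e \<and> sq_norm lborel (\<lambda>x. g x + h x - k x) < e"
    using cont_cs_add[OF w(1) w'(1)] by blast
qed

lemma avg_bump_cont_cs:
  fixes u :: "'a::euclidean_space \<Rightarrow> real"
  assumes d: "d > 0" and u: "square_int lborel u" "\<And>x. norm x > R \<Longrightarrow> u x = 0"
  shows "cont_cs (avg (bump_measure c d) u)"
  unfolding cont_cs_def
proof
  have um: "u \<in> borel_measurable borel" using u by (simp add: square_int_def)
  have b1: "Ck (Suc 0) (bump d :: 'a \<Rightarrow> real)" using bump_props(1)[OF d] by blast
  have bs: "square_int lborel (bump d :: 'a \<Rightarrow> real)"
    by (rule C1_square_int(1)[OF b1, of d]) (rule bump_props(3)[OF d], rule less_imp_le)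
  show "continuous_on UNIV (avg (bump_measure c d) u)"
    unfolding continuous_on_sequentially
  proof (intro ballI allI impI, elim conjE)
    fix y and ys :: "nat \<Rightarrow> 'a" assume ys: "ys \<longlonglongrightarrow> y"
    let ?f = "\<lambda>z. bump d (z - (y + c))"
    have f: "square_int lborel ?f" using square_int_shift(1)[OF bs, of "- (y + c)"] by (simp only: diff_conv_add_uminus)
    have "(\<lambda>n. y - ys n) \<longlonglongrightarrow> y - y" by (intro tendsto_intros ys)
    then have l: "(\<lambda>n. sq_norm lborel (\<lambda>z. ?f (z + (y - ys n)) - ?f z)) \<longlonglongrightarrow> 0"
      by (intro translation_tendsto[OF f]) simp
    have "(\<lambda>n. \<integral>z. ?f (z + (y - ys n)) * u z \<partial>lborel) \<longlonglongrightarrow> (\<integral>z. ?f z * u z \<partial>lborel)"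
      by (rule mult_tendsto[OF square_int_shift(1)[OF f] f u(1) l])
    moreover have "?f (z + (y - ys n)) = bump d (z - (ys n + c))" for z n by (simp add: algebra_simps)
    ultimately show "(avg (bump_measure c d) u \<circ> ys) \<longlonglongrightarrow> avg (bump_measure c d) u y"
      by (simp add: comp_def avg_bump[OF d um])
  qed
  show "\<exists>R. \<forall>x. norm x > R \<longrightarrow> avg (bump_measure c d) u x = 0"
  proof (intro exI allI impI)
    fix x :: 'a assume x: "norm x > R + norm c + d"
    have "bump d (z - (x + c)) *\<^sub>R u z = 0" for z
    proof (cases "norm z > R")
      case False
      have "norm x \<le> norm (z - (x + c)) + norm z + norm c"
        using norm_triangle_ineq4[of "z - c" "z - (x + c)"] norm_triangle_ineq4[of z c] by simp
      then have "norm (z - (x + c)) \<ge> d" using x False by linarith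
      then show ?thesis using bump_props(3)[OF d, of "z - (x + c)"] by simp
    qed (use u in simp)
    then show "avg (bump_measure c d) u x = 0"
      unfolding avg_bump[OF d um] by (simp only: integral_zero)
  qed
qed

text \<open>A function supported near a boundary point is first translated into the domain along the
  segment direction and then mollified at a scale so small that only values inside the domain enter.\<close>

lemma H1_approx_local:
  fixes S :: "'a::euclidean_space set"
  assumes S: "open S" and s: "sobolev S u g"
    and \<rho>: "0 < \<rho>" "\<rho> < r" and out: "\<And>x. x \<notin> cball x0 \<rho> \<Longrightarrow> u x = 0 \<and> g x = 0"
    and seg: "\<And>y t. y \<in> closure S \<inter> ball x0 r \<Longrightarrow> 0 < t \<Longrightarrow> t < 1 \<Longrightarrow> y + t *\<^sub>R e \<in> S"
  shows "H1_approx S u g"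
  unfolding H1_approx_def
proof (intro conjI s allI impI)
  fix \<epsilon> :: real assume \<epsilon>: "\<epsilon> > 0"
  note s' = sobolevD[OF s]
  obtain d1 where d1: "d1 > 0" "\<And>c. norm c < d1 \<Longrightarrow> sq_norm lborel (\<lambda>x. u (x + c) - u x) < \<epsilon> / 2"
    using translation_uniform[OF s'(1), of "\<epsilon> / 2"] \<epsilon> by auto
  obtain d2 where d2: "d2 > 0" "\<And>c. norm c < d2 \<Longrightarrow> sq_norm lborel (\<lambda>x. g (x + c) - g x) < \<epsilon> / 2"
    using translation_uniform[OF s'(2), of "\<epsilon> / 2"] \<epsilon> by auto
  define \<rho>1 where "\<rho>1 = \<rho> + (r - \<rho>) / 4"
  define \<rho>2 where "\<rho>2 = \<rho> + (r - \<rho>) / 2"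
  define r' where "r' = \<rho> + 3 * (r - \<rho>) / 4"
  have rr: "\<rho> < \<rho>1" "\<rho>1 < \<rho>2" "\<rho>2 < r'" "r' < r" "0 < \<rho>1" using \<rho> by (auto simp: \<rho>1_def \<rho>2_def r'_def field_simps)
  \<comment> \<open>All displacements will be shorter than \<open>m\<close>: this makes the
    averages \<open>L\<^sup>2\<close>-close to \<open>u\<close> and \<open>g\<close>, and keeps
    displaced points of the ball of radius \<open>\<rho>2\<close> in that of radius
    \<open>r'\<close>.\<close>
  define m where "m = min (min d1 d2) (r' - \<rho>2)"
  have m: "m > 0" "m \<le> d1" "m \<le> d2" "m \<le> r' - \<rho>2" using d1 d2 rr by (auto simp: m_def)
  define t where "t = min (1 / 2) (m / 2 / (norm e + 1))"
  have t: "0 < t" "t < 1" using m by (auto simp: t_def intro!: divide_pos_pos add_nonneg_pos)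
  have te: "norm (t *\<^sub>R e) \<le> m / 2"
  proof -
    have "t * norm e \<le> m / 2 / (norm e + 1) * (norm e + 1)"
      using m t by (intro mult_mono) (auto simp: t_def)
    also have "\<dots> = m / 2"
    proof -
      have "a / q * q = a" if "q \<noteq> 0" for a q :: real using that by simp
      moreover have "norm e + 1 \<noteq> 0" using norm_ge_zero[of e] by linarith
      ultimately show ?thesis by blast
    qed
    finally show ?thesis using t by simp
  qed
  define Y where "Y = closure S \<inter> cball x0 r'"
  have "compact Y" unfolding Y_def by (simp add: closed_Int_compact)
  then have Yc: "compact ((\<lambda>y. y + t *\<^sub>R e) ` Y)" by (intro compact_continuous_image continuous_intros)
  have YS: "(\<lambda>y. y + t *\<^sub>R e) ` Y \<subseteq> S" using seg t rr by (auto simp: Y_def)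
  obtain \<delta>0 where \<delta>0: "\<delta>0 > 0" "(\<Union>x\<in>(\<lambda>y. y + t *\<^sub>R e) ` Y. cball x \<delta>0) \<subseteq> S"
    using compact_subset_open_imp_cball_epsilon_subset[OF Yc S YS] by metis
  \<comment> \<open>The translated piece of the closure is a compact subset of \<open>S\<close>,
    which leaves room \<open>\<delta>0\<close> for mollification.\<close>
  define \<delta> where "\<delta> = min \<delta>0 (m / 2)"
  have \<delta>: "\<delta> > 0" "\<delta> \<le> \<delta>0" "\<delta> \<le> m / 2" using \<delta>0 m by (auto simp: \<delta>_def)
  define \<mu> where "\<mu> = bump_measure (t *\<^sub>R e) \<delta>"
  interpret averaging \<mu> unfolding \<mu>_def by (rule averaging_bump[OF \<delta>(1)])
  have near: "AE z in \<mu>. norm (z - t *\<^sub>R e) < \<delta>" unfolding \<mu>_def by (rule AE_bump[OF \<delta>(1)])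
  have small: "norm z < m" if "norm (z - t *\<^sub>R e) < \<delta>" for z
    using norm_triangle_ineq[of "z - t *\<^sub>R e" "t *\<^sub>R e"] that te \<delta>(3) by simp
  have au: "AE z in \<mu>. sq_norm lborel (\<lambda>x. u (x + z) - u x) \<le> \<epsilon> / 2"
    using near by eventually_elim (use d1(2) small m(2) in \<open>meson less_imp_le order_less_le_trans\<close>)
  have ag: "AE z in \<mu>. sq_norm lborel (\<lambda>x. g (x + z) - g x) \<le> \<epsilon> / 2"
    using near by eventually_elim (use d2(2) small m(3) in \<open>meson less_imp_le order_less_le_trans\<close>)
  note cu = avg_close[OF s'(1) au] and cg = avg_close[OF s'(2) ag]
  let ?w = "avg \<mu> u"
  let ?k = "\<lambda>x. indicator S x *\<^sub>R avg \<mu> g x"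
  have Sm[measurable]: "S \<in> sets borel" using S by simp
  have indm: "(indicator S :: 'a \<Rightarrow> real) \<in> borel_measurable lborel" by simp
  have ws: "square_int lborel (\<lambda>x. indicator S x * ?w x)"
    using square_int_bounded_mult[OF cu(1) indm, of 1] by simp
  have ks: "square_int lborel ?k"
    by (rule square_int_bounded_mult[OF cg(1) indm, of 1]) simp
  have "cont_cs ?w"
    unfolding \<mu>_def
  proof (rule avg_bump_cont_cs[OF \<delta>(1) s'(1), of "norm x0 + \<rho>"])
    fix x :: 'a assume x: "norm x > norm x0 + \<rho>"
    have "norm x \<le> norm x0 + dist x0 x" by (metis dist_commute dist_norm norm_triangle_sub)
    then have "x \<notin> cball x0 \<rho>" using x by simp
    then show "u x = 0" using out by blast
  qed
  moreover have "sq_norm lborel (\<lambda>x. u x - indicator S x * ?w x) < \<epsilon>"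
  proof -
    have "sq_norm lborel (\<lambda>x. u x - indicator S x * ?w x) \<le> sq_norm lborel (\<lambda>x. ?w x - u x)"
      by (rule square_int_mono(2)[OF square_int_diff[OF cu(1) s'(1)] square_int_meas[OF square_int_diff[OF s'(1) ws]] AE_I2])
        (use s'(3) in \<open>auto split: split_indicator\<close>)
    then show ?thesis using cu(2) \<epsilon> by linarith
  qed
  moreover have "sq_norm lborel (\<lambda>x. g x - ?k x) < \<epsilon>"
  proof -
    have "sq_norm lborel (\<lambda>x. g x - ?k x) \<le> sq_norm lborel (\<lambda>x. avg \<mu> g x - g x)"
      by (rule square_int_mono(2)[OF square_int_diff[OF cg(1) s'(2)] square_int_meas[OF square_int_diff[OF s'(2) ks]] AE_I2])
        (use s'(4) in \<open>auto simp: norm_minus_commute split: split_indicator\<close>)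
    then show ?thesis using cg(2) \<epsilon> by linarith
  qed
  moreover have "sobolev S (\<lambda>x. indicator S x * ?w x) ?k"
    unfolding sobolev_def
  proof (intro conjI ws ks allI impI ballI)
    fix \<phi> and b :: 'a assume p: "\<phi> \<in> test_functions S" and b: "b \<in> Basis"
    obtain L where L: "compact L" "L \<subseteq> S" "\<And>x. x \<notin> L \<Longrightarrow> \<phi> x = 0" "\<And>x. x \<notin> L \<Longrightarrow> grad \<phi> x = 0"
      using test_support[OF p] by metis
    note tq = test_square_int[OF p] and tk = test_smooth[OF p]
    let ?\<eta> = "cutoff x0 \<rho>1 \<rho>2"
    have c: "0 \<le> \<rho>1" "\<rho>1 < \<rho>2" using rr by auto
    \<comment> \<open>The shifted test function is cut off near \<open>x0\<close>, where
      \<open>u\<close> lives; the cut-off equals one near the support of \<open>u\<close>.\<close>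
    have shifted: "(\<integral>y. u (y + z) * dd \<phi> b y \<partial>lborel) = - (\<integral>y. (g (y + z) \<bullet> b) * \<phi> y \<partial>lborel)"
      if z: "norm (z - t *\<^sub>R e) < \<delta>" for z
    proof -
      let ?\<phi> = "\<lambda>y. \<phi> (y - z)"
      have pk: "Ck k ?\<phi>" for k using Ck_affine[OF tk, of k 1 "- z"] by simp
      have pd: "dd ?\<phi> b y = dd \<phi> b (y - z)" for y
        using dd_affine[OF tk[of "Suc 0"], where a=1 and c="- z" and v=b and x=y] by simp
      have "(\<lambda>y. ?\<eta> y * ?\<phi> y) \<in> test_functions S"
        unfolding test_functions_def mem_Collect_eq
      proof (intro conjI allI exI[of _ "(\<lambda>y. y + z) ` L \<inter> cball x0 \<rho>2"] impI)
        show "Ck k (\<lambda>y. ?\<eta> y * ?\<phi> y)" for k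
          by (intro Ck_mult pk) (use cutoff_props(1)[OF c] in blast)
        show "compact ((\<lambda>y. y + z) ` L \<inter> cball x0 \<rho>2)"
          by (intro compact_Int_closed compact_continuous_image continuous_intros L) auto
        show "(\<lambda>y. y + z) ` L \<inter> cball x0 \<rho>2 \<subseteq> S"
        proof
          fix y assume y: "y \<in> (\<lambda>y. y + z) ` L \<inter> cball x0 \<rho>2"
          then obtain l where l: "l \<in> L" "y = l + z" by blast
          have "dist x0 l \<le> dist x0 y + norm z" using dist_triangle[of x0 l y] l(2) by (simp add: dist_norm)
          then have "l \<in> cball x0 r'" using y small[OF z] m(4) by auto
          then have "l \<in> Y" using l(1) L(2) closure_subset by (auto simp: Y_def)
          moreover have "dist (l + t *\<^sub>R e) y \<le> \<delta>0"
            using z \<delta>(2) l(2) by (simp add: dist_norm norm_minus_commute)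
          ultimately show "y \<in> S" using \<delta>0(2) by fastforce
        qed
        fix y assume y: "y \<notin> (\<lambda>y. y + z) ` L \<inter> cball x0 \<rho>2"
        show "?\<eta> y * ?\<phi> y = 0"
        proof (cases "y \<in> cball x0 \<rho>2")
          case True
          then have "y - z \<notin> L" using y by (metis IntI diff_add_cancel image_eqI)
          then show ?thesis using L(3) by simp
        next
          case False
          then have "?\<eta> y = 0" by (intro cutoff_props(3)[OF c]) (simp add: dist_norm norm_minus_commute)
          then show ?thesis by simp
        qed
      qed
      from s'(5)[OF this b]
      have main: "(\<integral>y. u y * dd (\<lambda>y. ?\<eta> y * ?\<phi> y) b y \<partial>lborel) = - (\<integral>y. (g y \<bullet> b) * (?\<eta> y * ?\<phi> y) \<partial>lborel)" .
      have e1: "u y * dd (\<lambda>y. ?\<eta> y * ?\<phi> y) b y = u y * dd \<phi> b (y - z)" for y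
      proof (cases "y \<in> cball x0 \<rho>")
        case True
        have "grad ?\<phi> y = grad (\<lambda>y. ?\<eta> y * ?\<phi> y) y"
        proof (rule grad_cong_open[OF pk[of "Suc 0"], of "ball x0 \<rho>1"])
          show "y \<in> ball x0 \<rho>1" using True rr(1) by auto
          show "?\<phi> y = ?\<eta> y * ?\<phi> y" if "y \<in> ball x0 \<rho>1" for y
          proof -
            have "?\<eta> y = 1" using that by (intro cutoff_props(2)[OF c]) (simp add: dist_norm norm_minus_commute)
            then show ?thesis by simp
          qed
        qed simp
        then show ?thesis using grad_inner_Basis[OF b, of ?\<phi> y] grad_inner_Basis[OF b, of "\<lambda>y. ?\<eta> y * ?\<phi> y" y] by (simp add: pd)
      qed (use out in simp)
      have e2: "(g y \<bullet> b) * (?\<eta> y * ?\<phi> y) = (g y \<bullet> b) * \<phi> (y - z)" for y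
      proof (cases "y \<in> cball x0 \<rho>")
        case True
        have "?\<eta> y = 1" using True rr(1) by (intro cutoff_props(2)[OF c]) (simp add: dist_norm norm_minus_commute)
        then show ?thesis by simp
      qed (use out in simp)
      show ?thesis
        using main lborel_integral_shift[of "\<lambda>y. u y * dd \<phi> b (y - z)" z] lborel_integral_shift[of "\<lambda>y. (g y \<bullet> b) * \<phi> (y - z)" z]
        unfolding e1 e2 by simp
    qed
    have outS: "\<phi> x = 0" "dd \<phi> b x = 0" if "x \<notin> S" for x
    proof -
      have "x \<notin> L" using L(2) that by blast
      then show "\<phi> x = 0" "dd \<phi> b x = 0" using L(3,4) grad_inner_Basis[OF b, of \<phi> x] by auto
    qed
    have pb: "square_int lborel (\<lambda>x. \<phi> x *\<^sub>R b)"
    proof (rule square_int_mono(1)[OF tq(1) _ AE_I2])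
      show "(\<lambda>x. \<phi> x *\<^sub>R b) \<in> borel_measurable lborel" using tq(1) by (auto simp: square_int_def)
    qed (use b in simp)
    have um[measurable]: "u \<in> borel_measurable borel" "g \<in> borel_measurable borel" "\<phi> \<in> borel_measurable borel" "dd \<phi> b \<in> borel_measurable borel"
      using s' tq by (auto simp: square_int_def)
    have "(\<integral>x. (indicator S x * ?w x) * dd \<phi> b x \<partial>lborel) = (\<integral>x. ?w x \<bullet> dd \<phi> b x \<partial>lborel)"
      by (rule Bochner_Integration.integral_cong[OF refl]) (use outS in \<open>auto split: split_indicator\<close>)
    also have "\<dots> = (\<integral>z. (\<integral>y. u (y + z) \<bullet> dd \<phi> b y \<partial>lborel) \<partial>\<mu>)" by (rule avg_inner[OF s'(1) tq(3)])
    also have "\<dots> = (\<integral>z. - (\<integral>y. g (y + z) \<bullet> (\<phi> y *\<^sub>R b) \<partial>lborel) \<partial>\<mu>)"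
    proof (rule integral_cong_AE)
      show "AE z in \<mu>. (\<integral>y. u (y + z) \<bullet> dd \<phi> b y \<partial>lborel) = - (\<integral>y. g (y + z) \<bullet> (\<phi> y *\<^sub>R b) \<partial>lborel)"
        using near by eventually_elim (simp add: shifted mult.commute)
    qed measurable
    also have "\<dots> = - (\<integral>z. (\<integral>y. g (y + z) \<bullet> (\<phi> y *\<^sub>R b) \<partial>lborel) \<partial>\<mu>)" by (rule integral_minus)
    also have "(\<integral>z. (\<integral>y. g (y + z) \<bullet> (\<phi> y *\<^sub>R b) \<partial>lborel) \<partial>\<mu>) = (\<integral>x. avg \<mu> g x \<bullet> (\<phi> x *\<^sub>R b) \<partial>lborel)"
      by (rule avg_inner[OF s'(2) pb, symmetric])
    also have "\<dots> = (\<integral>x. (?k x \<bullet> b) * \<phi> x \<partial>lborel)"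
      by (rule Bochner_Integration.integral_cong[OF refl]) (use outS in \<open>auto split: split_indicator\<close>)
    finally show "(\<integral>x. (indicator S x * ?w x) * dd \<phi> b x \<partial>lborel) = - (\<integral>x. (?k x \<bullet> b) * \<phi> x \<partial>lborel)" .
  qed auto
  ultimately show "\<exists>w k. cont_cs w \<and> sobolev S (\<lambda>x. indicator S x * w x) k \<and>
      sq_norm lborel (\<lambda>x. u x - indicator S x * w x) < \<epsilon> \<and> sq_norm lborel (\<lambda>x. g x - k x) < \<epsilon>" by blast
qed

lemma cutoff_grad_bounded:
  assumes "0 \<le> a" "a < b"
  obtains B where "\<And>x. norm (grad (cutoff c a b) x) \<le> B" "\<And>x. \<bar>cutoff c a b x\<bar> \<le> B"
proof -
  have k: "Ck (Suc 0) (cutoff c a b)" using cutoff_props(1)[OF assms] by blast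
  have "cutoff c a b x = 0" if "norm x > norm c + b" for x
  proof (rule cutoff_props(3)[OF assms])
    show "b \<le> norm (x - c)" using that norm_triangle_sub[of x c] by linarith
  qed
  then show ?thesis using grad_bounded[OF k, of "norm c + b"] that by blast
qed

lemma cutoff_grad_zero:
  assumes "0 \<le> a" "a < b" "norm (x - c) < a \<or> b < norm (x - c)"
  shows "grad (cutoff c a b) x = 0"
proof -
  have k: "Ck (Suc 0) (cutoff c a b)" using cutoff_props(1)[OF assms(1,2)] by blast
  from assms(3) show ?thesis
  proof
    assume "norm (x - c) < a"
    then have "grad (cutoff c a b) x = grad (\<lambda>x. 1) x"
      by (intro grad_cong_open[OF k, of "ball c a"] cutoff_props(2)[OF assms(1,2)]) (auto simp: dist_norm norm_minus_commute)
    then show ?thesis by (simp add: grad_const)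
  next
    assume "b < norm (x - c)"
    then show ?thesis
      by (intro grad_zero_outside[OF k, of "cball c b"] cutoff_props(3)[OF assms(1,2)]) (auto simp: dist_norm norm_minus_commute)
  qed
qed

text \<open>Instead of a partition of unity, one localized piece \<open>\<eta> u\<close> at a time is split off; the
  remainder vanishes on the corresponding ball. The balls are open because the gradient of the cut-off is
  known to vanish only in the interior of the region where the cut-off is one.\<close>

lemma H1_approx_finite_cover:
  fixes S :: "'a::euclidean_space set"
  assumes S: "open S" and "finite I" and r: "\<And>x. x \<in> I \<Longrightarrow> r x > 0"
    and seg: "\<And>x. x \<in> I \<Longrightarrow> \<exists>e. \<forall>y\<in>closure S \<inter> ball x (4 * r x). \<forall>t. 0 < t \<and> t < 1 \<longrightarrow> y + t *\<^sub>R e \<in> S"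
    and "sobolev S u g" "\<And>y. y \<notin> (\<Union>x\<in>I. ball x (r x)) \<Longrightarrow> u y = 0 \<and> g y = 0"
  shows "H1_approx S u g"
  using assms(2-)
proof (induction I arbitrary: u g rule: finite_induct)
  case empty
  then have "u = (\<lambda>x. 0)" "g = (\<lambda>x. 0)" by auto
  then show ?case using H1_approx_zero by simp
next
  case (insert x I)
  note s = insert.prems(3)
  have rx: "r x > 0" using insert.prems(1) by simp
  let ?a = "r x" and ?b = "2 * r x"
  have c: "0 \<le> ?a" "?a < ?b" using rx by auto
  let ?\<eta> = "cutoff x ?a ?b"
  obtain B where B: "\<And>y. norm (grad ?\<eta> y) \<le> B" "\<And>y. \<bar>?\<eta> y\<bar> \<le> B" using cutoff_grad_bounded[OF c] by metis
  let ?u = "\<lambda>y. ?\<eta> y * u y" and ?g = "\<lambda>y. ?\<eta> y *\<^sub>R g y + u y *\<^sub>R grad ?\<eta> y"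
  have s1: "sobolev S ?u ?g" by (rule sobolev_mult_smooth[OF s cutoff_props(1)[OF c] B(2,1)])
  from insert.prems(2)[OF insertI1] obtain e where
    e': "\<forall>y\<in>closure S \<inter> ball x (4 * r x). \<forall>t. 0 < t \<and> t < 1 \<longrightarrow> y + t *\<^sub>R e \<in> S" by blast
  have e: "y + t *\<^sub>R e \<in> S" if "y \<in> closure S \<inter> ball x (4 * r x)" "0 < t" "t < 1" for y t
    using e' that by blast
  have a1: "H1_approx S ?u ?g"
  proof (rule H1_approx_local[OF S s1 _ _ _ e])
    show "?u y = 0 \<and> ?g y = 0" if "y \<notin> cball x ?b" for y
    proof -
      have "?b < norm (y - x)" using that by (simp add: dist_norm norm_minus_commute)
      then show ?thesis using cutoff_props(3)[OF c, of y x] cutoff_grad_zero[OF c, of y x] by simp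
    qed
  qed (use rx in auto)
  have a2: "H1_approx S (\<lambda>y. u y - ?u y) (\<lambda>y. g y - ?g y)"
  proof (rule insert.IH[OF _ _ sobolev_diff[OF s s1]])
    fix y assume y: "y \<notin> (\<Union>x\<in>I. ball x (r x))"
    show "u y - ?u y = 0 \<and> g y - ?g y = 0"
    proof (cases "y \<in> ball x (r x)")
      case True
      then have "norm (y - x) < ?a" by (simp add: dist_norm norm_minus_commute)
      then show ?thesis using cutoff_props(2)[OF c, of y x] cutoff_grad_zero[OF c, of y x] by simp
    next
      case False
      then have "u y = 0 \<and> g y = 0" using insert.prems(4)[of y] y by auto
      then show ?thesis by simp
    qed
  qed (use insert.prems in auto)
  show ?case using H1_approx_add[OF a1 a2] by simp
qed

lemma H1_approx_bounded_support:
  fixes S :: "'a::euclidean_space set"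
  assumes S: "open S" "segment_property S" and s: "sobolev S u g" and out: "\<And>x. norm x > R \<Longrightarrow> u x = 0 \<and> g x = 0"
  shows "H1_approx S u g"
proof -
  have "\<exists>r>0. \<exists>e. \<forall>y\<in>closure S \<inter> ball x (4 * r). \<forall>t. 0 < t \<and> t < 1 \<longrightarrow> y + t *\<^sub>R e \<in> S" if x: "x \<in> closure S" for x
  proof -
    obtain r where "r > 0" "\<exists>e. \<forall>y\<in>closure S \<inter> ball x r. \<forall>t. 0 < t \<and> t < 1 \<longrightarrow> y + t *\<^sub>R e \<in> S"
      using S(2) x unfolding segment_property_def by blast
    then show ?thesis by (intro exI[of _ "r / 4"]) auto
  qed
  then obtain r where r: "\<And>x. x \<in> closure S \<Longrightarrow> r x > 0"
    "\<And>x. x \<in> closure S \<Longrightarrow> \<exists>e. \<forall>y\<in>closure S \<inter> ball x (4 * r x). \<forall>t. 0 < t \<and> t < 1 \<longrightarrow> y + t *\<^sub>R e \<in> S"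
    by metis
  let ?K = "closure S \<inter> cball 0 R"
  have "compact ?K" by (simp add: closed_Int_compact)
  then obtain I where I: "I \<subseteq> ?K" "finite I" "?K \<subseteq> (\<Union>x\<in>I. ball x (r x))"
  proof (rule compactE_image[of ?K ?K "\<lambda>x. ball x (r x)"])
    show "?K \<subseteq> (\<Union>x\<in>?K. ball x (r x))" using r(1) by force
  qed (auto intro: that)
  show ?thesis
  proof (rule H1_approx_finite_cover[OF S(1) I(2) _ _ s])
    show "u y = 0 \<and> g y = 0" if "y \<notin> (\<Union>x\<in>I. ball x (r x))" for y
    proof (cases "y \<in> S")
      case True
      then have "y \<notin> cball 0 R" using that I(3) closure_subset by blast
      then show ?thesis using out by simp
    qed (use sobolevD(3,4)[OF s] in auto)
  qed (use I(1) r in auto)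
qed

text \<open>Truncation with the cut-offs \<open>\<eta>(x / n)\<close> reduces the general case to bounded support.\<close>

proposition sobolev_approx:
  fixes S :: "'a::euclidean_space set"
  assumes S: "open S" "segment_property S" and s: "sobolev S u g"
  shows "H1_approx S u g"
proof -
  let ?\<eta> = "cutoff (0::'a) 1 2"
  have c: "0 \<le> (1::real)" "(1::real) < 2" by auto
  obtain B where B: "\<And>y. norm (grad ?\<eta> y) \<le> B" "\<And>y. \<bar>?\<eta> y\<bar> \<le> B" using cutoff_grad_bounded[OF c] by metis
  have B0: "0 \<le> B" using B(1)[of 0] norm_ge_zero order_trans by blast
  have k: "Ck k ?\<eta>" for k using cutoff_props(1)[OF c] by blast
  define a where "a n = 1 / real (Suc n)" for n
  have a: "0 < a n" "a n \<le> 1" for n by (auto simp: a_def)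
  define \<eta> where "\<eta> n x = ?\<eta> (a n *\<^sub>R x + 0)" for n x
  have \<eta>k: "smooth (\<eta> n)" for n unfolding \<eta>_def[abs_def] by (intro allI Ck_affine k)
  have \<eta>g: "grad (\<eta> n) x = a n *\<^sub>R grad ?\<eta> (a n *\<^sub>R x)" for n x
    unfolding \<eta>_def[abs_def] by (subst grad_affine[OF k[of "Suc 0"]]) simp
  have \<eta>B: "\<bar>\<eta> n x\<bar> \<le> B" "norm (grad (\<eta> n) x) \<le> B" for n x
  proof -
    show "\<bar>\<eta> n x\<bar> \<le> B" using B(2) by (simp add: \<eta>_def)
    have "norm (grad (\<eta> n) x) \<le> 1 * B"
      unfolding \<eta>g norm_scaleR using a[of n] B(1) by (intro mult_mono) auto
    then show "norm (grad (\<eta> n) x) \<le> B" by simp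
  qed
  have ev: "\<forall>\<^sub>F n in sequentially. \<eta> n x = 1 \<and> grad (\<eta> n) x = 0" for x
  proof -
    obtain N where N: "norm x < real N" using reals_Archimedean2 by blast
    show ?thesis
      using eventually_ge_at_top[of N]
    proof eventually_elim
      case (elim n)
      have "norm (a n *\<^sub>R x - 0) < 1" using N elim by (simp add: a_def field_simps)
      then show ?case
        using cutoff_props(2)[OF c, of "a n *\<^sub>R x" 0] cutoff_grad_zero[OF c, of "a n *\<^sub>R x" 0] by (simp add: \<eta>g \<eta>_def)
    qed
  qed
  let ?u = "\<lambda>n x. \<eta> n x * u x" and ?g = "\<lambda>n x. \<eta> n x *\<^sub>R g x + u x *\<^sub>R grad (\<eta> n) x"
  have s1: "sobolev S (?u n) (?g n)" for n by (rule sobolev_mult_smooth[OF s \<eta>k \<eta>B])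
  note s' = sobolevD[OF s]
  have a1: "H1_approx S (?u n) (?g n)" for n
  proof (rule H1_approx_bounded_support[OF S s1, of "2 * real (Suc n)"])
    fix x :: 'a assume "norm x > 2 * real (Suc n)"
    then have "2 < norm (a n *\<^sub>R x - 0)" by (simp add: a_def field_simps)
    then show "?u n x = 0 \<and> ?g n x = 0"
      using cutoff_props(3)[OF c, of "a n *\<^sub>R x" 0] cutoff_grad_zero[OF c, of "a n *\<^sub>R x" 0] by (simp add: \<eta>g \<eta>_def)
  qed
  have l1: "(\<lambda>n. sq_norm lborel (\<lambda>x. ?u n x - u x)) \<longlonglongrightarrow> 0"
  proof (rule sq_norm_dominated_convergence(2)[OF square_int_meas[OF sobolevD(1)[OF s1]] square_int_meas[OF s'(1)] square_int_cmult(1)[OF s'(1), of B] AE_I2 AE_I2])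
    show "norm (?u n x) \<le> norm (B * u x)" for n x using \<eta>B(1)[of n x] B0 by (simp add: abs_mult mult_right_mono)
    show "(\<lambda>n. ?u n x) \<longlonglongrightarrow> u x" for x
      by (rule tendsto_eventually, use ev[of x] in eventually_elim) simp
  qed
  have w: "square_int lborel (\<lambda>x. B * (norm (g x) + \<bar>u x\<bar>))"
    using s'(1,2) by (intro square_int_cmult square_int_add) (auto simp: square_int_def)
  have l2: "(\<lambda>n. sq_norm lborel (\<lambda>x. ?g n x - g x)) \<longlonglongrightarrow> 0"
  proof (rule sq_norm_dominated_convergence(2)[OF square_int_meas[OF sobolevD(2)[OF s1]] square_int_meas[OF s'(2)] w AE_I2 AE_I2])
    show "norm (?g n x) \<le> norm (B * (norm (g x) + \<bar>u x\<bar>))" for n x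
    proof -
      have "norm (?g n x) \<le> \<bar>\<eta> n x\<bar> * norm (g x) + \<bar>u x\<bar> * norm (grad (\<eta> n) x)"
        using norm_triangle_ineq[of "\<eta> n x *\<^sub>R g x" "u x *\<^sub>R grad (\<eta> n) x"] by simp
      also have "\<dots> \<le> B * norm (g x) + \<bar>u x\<bar> * B" using \<eta>B[of n x] by (intro add_mono mult_right_mono mult_left_mono) auto
      finally show ?thesis using B0 by (simp add: abs_mult algebra_simps)
    qed
    show "(\<lambda>n. ?g n x) \<longlonglongrightarrow> g x" for x
      by (rule tendsto_eventually, use ev[of x] in eventually_elim) simp
  qed
  show ?thesis
  proof (rule H1_approx_closed[OF s])
    fix e :: real assume "e > 0"
    then have "\<forall>\<^sub>F n in sequentially. sq_norm lborel (\<lambda>x. ?u n x - u x) < e \<and> sq_norm lborel (\<lambda>x. ?g n x - g x) < e"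
      using order_tendstoD(2)[OF l1] order_tendstoD(2)[OF l2] by (intro eventually_conj) auto
    then obtain n where "sq_norm lborel (\<lambda>x. ?u n x - u x) < e" "sq_norm lborel (\<lambda>x. ?g n x - g x) < e"
      using eventually_happens trivial_limit_sequentially by blast
    moreover have "sq_norm lborel (\<lambda>x. ?u n x - u x) = sq_norm lborel (\<lambda>x. u x - ?u n x)"
      "sq_norm lborel (\<lambda>x. ?g n x - g x) = sq_norm lborel (\<lambda>x. g x - ?g n x)"
      by (simp_all add: sq_norm_def power2_commute norm_minus_commute)
    ultimately show "\<exists>v h. H1_approx S v h \<and> sq_norm lborel (\<lambda>x. u x - v x) < e \<and> sq_norm lborel (\<lambda>x. g x - h x) < e"
      using a1[of n] by (intro exI[of _ "?u n"] exI[of _ "?g n"]) simp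
  qed
qed

section \<open>Uniqueness of distributional gradients\<close>

lemma restricted_measurable_iff:
  fixes u :: "'a::euclidean_space \<Rightarrow> 'b::euclidean_space"
  assumes "S \<in> sets borel"
  shows "u \<in> borel_measurable (lborel_restricted S) \<longleftrightarrow> (\<lambda>x. indicator S x *\<^sub>R u x) \<in> borel_measurable borel"
  using assms by (subst borel_measurable_restrict_space_iff) auto

lemma restricted_integrable_iff:
  fixes u :: "'a::euclidean_space \<Rightarrow> real"
  assumes "S \<in> sets borel"
  shows "integrable (lborel_restricted S) u \<longleftrightarrow> integrable lborel (\<lambda>x. indicator S x * u x)"
  using assms by (subst integrable_restrict_space) auto

lemma restricted_integral:
  fixes u :: "'a::euclidean_space \<Rightarrow> real"
  assumes "S \<in> sets borel"
  shows "(\<integral>x. u x \<partial>lborel_restricted S) = (\<integral>x. indicator S x * u x \<partial>lborel)"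
  using assms by (subst integral_restrict_space) auto

lemma indicator_sq: "(norm (indicator S x *\<^sub>R (v::'b::real_normed_vector)))\<^sup>2 = indicator S x * (norm v)\<^sup>2"
  by (auto split: split_indicator)

text \<open>The gradient selected in the definition of the Dirichlet integral is a priori only locally integrable, so
  uniqueness is needed in this generality.\<close>

lemma weak_gradient_unique:
  fixes S :: "'a::euclidean_space set"
  assumes S: "open S" and g: "has_weak_gradient u g S" and h: "has_weak_gradient u h S"
  shows "AE x in lborel. x \<in> S \<longrightarrow> g x = h x"
proof (rule AE_Basis_eq)
  fix b :: 'a assume b: "b \<in> Basis"
  have Sb: "S \<in> sets borel" using S by simp
  let ?g = "\<lambda>x. indicator S x *\<^sub>R g x" and ?h = "\<lambda>x. indicator S x *\<^sub>R h x"
  have m[measurable]: "?g \<in> borel_measurable borel" "?h \<in> borel_measurable borel"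
    using g h unfolding has_weak_gradient_def restricted_measurable_iff[OF Sb] by auto
  let ?D = "\<lambda>x. ?g x \<bullet> b - ?h x \<bullet> b"
  have li: "integrable lborel (\<lambda>x. indicator K x *\<^sub>R k x)"
    if "compact K" "K \<subseteq> S" "has_weak_gradient u k S" for K k
    using that unfolding has_weak_gradient_def set_integrable_def by blast
  have ti: "integrable lborel (\<lambda>x. (k x \<bullet> b) * \<phi> x)"
    if p: "\<phi> \<in> test_functions S" and k: "has_weak_gradient u k S" for k \<phi>
  proof -
    obtain K R where K: "compact K" "K \<subseteq> S" "\<And>x. x \<notin> K \<Longrightarrow> \<phi> x = 0" "\<And>x. norm x > R \<Longrightarrow> \<phi> x = 0"
      using test_support[OF p] by metis
    obtain B where B: "\<And>x. \<bar>\<phi> x\<bar> \<le> B" using grad_bounded[OF test_smooth[OF p, of "Suc 0"] K(4)] by metis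
    note i = li[OF K(1,2) k]
    have "integrable lborel (\<lambda>x. \<phi> x * ((indicator K x *\<^sub>R k x) \<bullet> b))"
    proof (rule Bochner_Integration.integrable_bound[OF integrable_mult_right[OF integrable_norm[OF i], of B]])
      have "\<phi> \<in> borel_measurable lborel" using test_square_int(1)[OF p] by (simp add: square_int_def)
      moreover have "(\<lambda>x. (indicator K x *\<^sub>R k x) \<bullet> b) \<in> borel_measurable lborel"
        using borel_measurable_integrable[OF i] by (intro borel_measurable_inner) auto
      ultimately show "(\<lambda>x. \<phi> x * ((indicator K x *\<^sub>R k x) \<bullet> b)) \<in> borel_measurable lborel" by (rule borel_measurable_times)
      show "AE x in lborel. norm (\<phi> x * ((indicator K x *\<^sub>R k x) \<bullet> b)) \<le> norm (B * norm (indicator K x *\<^sub>R k x))"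
      proof (rule AE_I2)
        fix x
        have "\<bar>\<phi> x\<bar> * \<bar>(indicator K x *\<^sub>R k x) \<bullet> b\<bar> \<le> B * norm (indicator K x *\<^sub>R k x)"
          using B[of x] Basis_le_norm[OF b, of "indicator K x *\<^sub>R k x"] by (intro mult_mono) auto
        then show "norm (\<phi> x * ((indicator K x *\<^sub>R k x) \<bullet> b)) \<le> norm (B * norm (indicator K x *\<^sub>R k x))"
          using B[of x] unfolding real_norm_def abs_mult by simp
      qed
    qed
    moreover have "(\<lambda>x. \<phi> x * ((indicator K x *\<^sub>R k x) \<bullet> b)) = (\<lambda>x. (k x \<bullet> b) * \<phi> x)"
      using K(3) by (auto simp: fun_eq_iff split: split_indicator)
    ultimately show ?thesis by simp
  qed
  have "AE x in lborel. x \<in> S \<longrightarrow> ?D x = 0"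
  proof (rule du_Bois_Reymond[OF _ S])
    show "?D \<in> borel_measurable borel" by (intro borel_measurable_diff borel_measurable_inner m) auto
  next
    fix K assume K: "compact K" "K \<subseteq> S"
    have "integrable lborel (\<lambda>x. (indicator K x *\<^sub>R g x) \<bullet> b - (indicator K x *\<^sub>R h x) \<bullet> b)"
      by (intro Bochner_Integration.integrable_diff integrable_inner_left li[OF K g] li[OF K h])
    moreover have "(\<lambda>x. (indicator K x *\<^sub>R g x) \<bullet> b - (indicator K x *\<^sub>R h x) \<bullet> b) = (\<lambda>x. indicator K x * ?D x)"
      using K(2) by (auto simp: fun_eq_iff split: split_indicator)
    ultimately show "integrable lborel (\<lambda>x. indicator K x * ?D x)" by simp
  next
    fix \<phi> assume p: "\<phi> \<in> test_functions S"
    have out: "\<phi> x = 0" if "x \<notin> S" for x using p that by (auto simp: test_functions_def)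
    have rs: "(\<integral>x. (k x \<bullet> b) * \<phi> x \<partial>lborel_restricted S) = (\<integral>x. (k x \<bullet> b) * \<phi> x \<partial>lborel)" for k
      unfolding restricted_integral[OF Sb]
      by (rule Bochner_Integration.integral_cong[OF refl]) (use out in \<open>auto split: split_indicator\<close>)
    have wk: "(\<integral>x. u x * dd \<phi> b x \<partial>lborel_restricted S) = - (\<integral>x. (k x \<bullet> b) * \<phi> x \<partial>lborel_restricted S)"
      if "has_weak_gradient u k S" for k
      using that p b unfolding has_weak_gradient_def by blast
    have "(\<integral>x. (g x \<bullet> b) * \<phi> x \<partial>lborel) = (\<integral>x. (h x \<bullet> b) * \<phi> x \<partial>lborel)"
      using wk[OF g] wk[OF h] unfolding rs by linarith
    moreover have "(\<integral>x. ?D x * \<phi> x \<partial>lborel) = (\<integral>x. (g x \<bullet> b) * \<phi> x - (h x \<bullet> b) * \<phi> x \<partial>lborel)"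
      by (rule Bochner_Integration.integral_cong[OF refl]) (use out in \<open>auto simp: left_diff_distrib split: split_indicator\<close>)
    ultimately show "(\<integral>x. ?D x * \<phi> x \<partial>lborel) = 0"
      using ti[OF p g] ti[OF p h] by simp
  qed
  then show "AE x in lborel. x \<in> S \<longrightarrow> g x \<bullet> b = h x \<bullet> b" by eventually_elim auto
qed

section \<open>The Dirichlet integral on the closure\<close>

text \<open>Functions on the closure of \<open>\<Gamma>\<close> enter all integrals through \<open>ext0 u\<close>, their
  restriction to \<open>\<Gamma>\<close> extended by zero; this loses nothing since the boundary is a null
  set.\<close>

locale reflecting_domain =
  fixes \<Gamma> :: "'a::euclidean_space set"
  assumes open_domain: "open \<Gamma>" and segments: "segment_property \<Gamma>"
begin

abbreviation m :: "'a measure" where "m \<equiv> lborel_restricted (closure \<Gamma>)"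

abbreviation E :: "('a \<Rightarrow> real) \<Rightarrow> ('a \<Rightarrow> real) \<Rightarrow> real" where
  "E \<equiv> \<lambda>u v. 1 / 2 * dirichlet_integral \<Gamma> u v"

abbreviation ext0 :: "('a \<Rightarrow> real) \<Rightarrow> 'a \<Rightarrow> real" where
  "ext0 u \<equiv> \<lambda>x. indicator \<Gamma> x * u x"

lemma sets_domain [measurable, simp]: "\<Gamma> \<in> sets borel" "closure \<Gamma> \<in> sets borel"
  using open_domain by auto

lemma AE_closure: "AE x in lborel. x \<in> closure \<Gamma> \<longleftrightarrow> x \<in> \<Gamma>"
  using frontier_null[OF open_domain segments]
proof eventually_elim
  case (elim x)
  then show ?case using open_domain closure_subset by (auto simp: frontier_def interior_open)
qed

lemma measurable_mI:
  fixes u :: "'a \<Rightarrow> real"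
  shows "u \<in> borel_measurable borel \<Longrightarrow> u \<in> borel_measurable m"
  by (intro measurable_restrict_space1) simp

lemma ext0_measurable:
  assumes "u \<in> borel_measurable m" shows "ext0 u \<in> borel_measurable borel"
proof -
  have "(\<lambda>x. indicator (closure \<Gamma>) x *\<^sub>R u x) \<in> borel_measurable borel"
    using assms by (simp only: restricted_measurable_iff[OF sets_domain(2)])
  then have "(\<lambda>x. indicator \<Gamma> x * (indicator (closure \<Gamma>) x *\<^sub>R u x)) \<in> borel_measurable borel"
    by (intro borel_measurable_times borel_measurable_indicator) auto
  moreover have "(\<lambda>x. indicator \<Gamma> x * (indicator (closure \<Gamma>) x *\<^sub>R u x)) = ext0 u"
    using closure_subset[of \<Gamma>] by (auto simp: fun_eq_iff split: split_indicator)
  ultimately show ?thesis by simp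
qed

lemma measurable_domain:
  fixes u :: "'a \<Rightarrow> real"
  shows "u \<in> borel_measurable m \<Longrightarrow> u \<in> borel_measurable (lborel_restricted \<Gamma>)"
  unfolding restricted_measurable_iff[OF sets_domain(1)] using ext0_measurable by simp

lemma closure_measurable:
  fixes u :: "'a \<Rightarrow> real"
  assumes "u \<in> borel_measurable m" shows "(\<lambda>x. indicator (closure \<Gamma>) x * u x) \<in> borel_measurable borel"
  using assms by (simp add: restricted_measurable_iff[OF sets_domain(2)])

lemma L2_m_iff:
  assumes "u \<in> borel_measurable m"
  shows "u \<in> L2 m \<longleftrightarrow> square_int lborel (ext0 u)"
proof -
  have e: "indicator (closure \<Gamma>) x * (u x)\<^sup>2 = (indicator (closure \<Gamma>) x * u x)\<^sup>2" for x
    by (auto split: split_indicator)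
  have "integrable m (\<lambda>x. (u x)\<^sup>2) \<longleftrightarrow> integrable lborel (\<lambda>x. (indicator (closure \<Gamma>) x * u x)\<^sup>2)"
    unfolding restricted_integrable_iff[OF sets_domain(2)] e ..
  also have "\<dots> \<longleftrightarrow> integrable lborel (\<lambda>x. (norm (ext0 u x))\<^sup>2)"
    by (rule integrable_cong_AE)
      (use closure_measurable[OF assms] ext0_measurable[OF assms] AE_closure in \<open>auto elim!: eventually_mono split: split_indicator\<close>)
  finally show ?thesis using assms ext0_measurable[OF assms] by (simp add: L2_def square_int_def)
qed

lemma L2_norm_sq:
  assumes "u \<in> borel_measurable m"
  shows "(L2_norm m u)\<^sup>2 = sq_norm lborel (ext0 u)"
proof -
  have "(L2_norm m u)\<^sup>2 = (\<integral>x. (u x)\<^sup>2 \<partial>m)" unfolding L2_norm_def by simp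
  also have "\<dots> = (\<integral>x. (indicator (closure \<Gamma>) x * u x)\<^sup>2 \<partial>lborel)"
    unfolding restricted_integral[OF sets_domain(2)]
    by (rule Bochner_Integration.integral_cong[OF refl]) (auto split: split_indicator)
  also have "\<dots> = sq_norm lborel (ext0 u)"
    unfolding sq_norm_def
    by (rule integral_cong_AE)
      (use closure_measurable[OF assms] ext0_measurable[OF assms] AE_closure in \<open>auto elim!: eventually_mono split: split_indicator\<close>)
  finally show ?thesis .
qed

lemma sobolev_has_weak_gradient:
  assumes u: "u \<in> borel_measurable m" and s: "sobolev \<Gamma> (ext0 u) g"
  shows "has_weak_gradient u g \<Gamma>"
  unfolding has_weak_gradient_def
proof (intro conjI allI impI ballI)
  note s' = sobolevD[OF s]
  have g1: "indicator \<Gamma> x *\<^sub>R g x = g x" for x using s'(4)[of x] by (auto split: split_indicator)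
  show "u \<in> borel_measurable (lborel_restricted \<Gamma>)" by (rule measurable_domain[OF u])
  show "g \<in> borel_measurable (lborel_restricted \<Gamma>)"
    unfolding restricted_measurable_iff[OF sets_domain(1)] g1 using s'(2) by (simp add: square_int_def)
  { fix K assume K: "compact K \<and> K \<subseteq> \<Gamma>"
    have i: "square_int lborel (indicator K :: 'a \<Rightarrow> real)"
      using square_int_indicator[of K lborel 1] emeasure_compact_finite[of K] K by (simp add: borel_compact)
    have "(\<lambda>x. indicator K x *\<^sub>R u x) = (\<lambda>x. indicator K x * ext0 u x)"
      using K by (auto simp: fun_eq_iff split: split_indicator)
    then show "set_integrable lborel K u" unfolding set_integrable_def using mult_integrable[OF i s'(1)] by simp
    have ng: "square_int lborel (\<lambda>x. norm (g x))" using s'(2) by (auto simp: square_int_def)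
    have "integrable lborel (\<lambda>x. indicator K x *\<^sub>R g x)"
    proof (rule Bochner_Integration.integrable_bound[OF mult_integrable[OF i ng]])
      show "(\<lambda>x. indicator K x *\<^sub>R g x) \<in> borel_measurable lborel"
        using square_int_meas[OF i] square_int_meas[OF s'(2)] by (rule borel_measurable_scaleR)
    qed auto
    then show "set_integrable lborel K g" unfolding set_integrable_def . }
  fix \<phi> and b :: 'a assume p: "\<phi> \<in> test_functions \<Gamma>" "b \<in> Basis"
  have "(\<integral>x. u x * dd \<phi> b x \<partial>lborel_restricted \<Gamma>) = (\<integral>x. ext0 u x * dd \<phi> b x \<partial>lborel)"
    unfolding restricted_integral[OF sets_domain(1)] by (simp add: mult.assoc)
  moreover have "(\<integral>x. (g x \<bullet> b) * \<phi> x \<partial>lborel_restricted \<Gamma>) = (\<integral>x. (g x \<bullet> b) * \<phi> x \<partial>lborel)"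
    unfolding restricted_integral[OF sets_domain(1)]
    by (rule Bochner_Integration.integral_cong[OF refl]) (use s'(4) in \<open>auto split: split_indicator\<close>)
  ultimately show "(\<integral>x. u x * dd \<phi> b x \<partial>lborel_restricted \<Gamma>) = - (\<integral>x. (g x \<bullet> b) * \<phi> x \<partial>lborel_restricted \<Gamma>)"
    using s'(5)[OF p] by simp
qed

lemma H1_closure_iff: "u \<in> H1_closure \<Gamma> \<longleftrightarrow> u \<in> borel_measurable m \<and> (\<exists>g. sobolev \<Gamma> (ext0 u) g)"
proof
  assume u: "u \<in> H1_closure \<Gamma>"
  then have um: "u \<in> borel_measurable m" and uL: "u \<in> L2 m" by (auto simp: H1_closure_def L2_def)
  obtain g where g: "has_weak_gradient u g \<Gamma>" "integrable (lborel_restricted \<Gamma>) (\<lambda>x. (norm (g x))\<^sup>2)"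
    using u by (auto simp: H1_closure_def H1_def)
  let ?g = "\<lambda>x. indicator \<Gamma> x *\<^sub>R g x"
  have "sobolev \<Gamma> (ext0 u) ?g"
    unfolding sobolev_def
  proof (intro conjI allI impI ballI)
    show "square_int lborel (ext0 u)" using uL L2_m_iff[OF um] by simp
    have "?g \<in> borel_measurable borel"
      using g(1) unfolding has_weak_gradient_def restricted_measurable_iff[OF sets_domain(1)] by blast
    moreover have "integrable lborel (\<lambda>x. (norm (?g x))\<^sup>2)"
      using g(2) unfolding restricted_integrable_iff[OF sets_domain(1)] indicator_sq .
    ultimately show "square_int lborel ?g" by (simp add: square_int_def)
    fix \<phi> and b :: 'a assume p: "\<phi> \<in> test_functions \<Gamma>" "b \<in> Basis"
    have "(\<integral>x. u x * dd \<phi> b x \<partial>lborel_restricted \<Gamma>) = - (\<integral>x. (g x \<bullet> b) * \<phi> x \<partial>lborel_restricted \<Gamma>)"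
      using g(1) p unfolding has_weak_gradient_def by blast
    then show "(\<integral>x. ext0 u x * dd \<phi> b x \<partial>lborel) = - (\<integral>x. (?g x \<bullet> b) * \<phi> x \<partial>lborel)"
      unfolding restricted_integral[OF sets_domain(1)] by (simp add: mult.assoc)
  qed auto
  then show "u \<in> borel_measurable m \<and> (\<exists>g. sobolev \<Gamma> (ext0 u) g)" using um by blast
next
  assume "u \<in> borel_measurable m \<and> (\<exists>g. sobolev \<Gamma> (ext0 u) g)"
  then obtain g where um: "u \<in> borel_measurable m" and s: "sobolev \<Gamma> (ext0 u) g" by blast
  note s' = sobolevD[OF s]
  have "u \<in> L2 m" using L2_m_iff[OF um] s'(1) by simp
  moreover have "integrable (lborel_restricted \<Gamma>) (\<lambda>x. (u x)\<^sup>2)"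
  proof -
    have "indicator \<Gamma> x * (u x)\<^sup>2 = (norm (ext0 u x))\<^sup>2" for x by (auto split: split_indicator)
    then show ?thesis unfolding restricted_integrable_iff[OF sets_domain(1)] using s'(1) by (simp add: square_int_def)
  qed
  then have "u \<in> L2 (lborel_restricted \<Gamma>)" using measurable_domain[OF um] by (simp add: L2_def)
  moreover have "integrable (lborel_restricted \<Gamma>) (\<lambda>x. (norm (g x))\<^sup>2)"
  proof -
    have e: "indicator \<Gamma> x * (norm (g x))\<^sup>2 = (norm (g x))\<^sup>2" for x using s'(4)[of x] by (auto split: split_indicator)
    show ?thesis unfolding restricted_integrable_iff[OF sets_domain(1)] e using s'(2) by (simp add: square_int_def)
  qed
  ultimately show "u \<in> H1_closure \<Gamma>"
    using sobolev_has_weak_gradient[OF um s] unfolding H1_closure_def H1_def by blast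
qed

lemma dirichlet_integral_eq:
  assumes u: "u \<in> borel_measurable m" "sobolev \<Gamma> (ext0 u) g" and v: "v \<in> borel_measurable m" "sobolev \<Gamma> (ext0 v) h"
  shows "dirichlet_integral \<Gamma> u v = (\<integral>x. g x \<bullet> h x \<partial>lborel)"
proof -
  have *: "has_weak_gradient w (weak_gradient \<Gamma> w) \<Gamma>" "AE x in lborel. x \<in> \<Gamma> \<longrightarrow> weak_gradient \<Gamma> w x = k x"
    if "w \<in> borel_measurable m" "sobolev \<Gamma> (ext0 w) k" for w k
  proof -
    have k: "has_weak_gradient w k \<Gamma>" by (rule sobolev_has_weak_gradient[OF that])
    then show w: "has_weak_gradient w (weak_gradient \<Gamma> w) \<Gamma>" 
      unfolding weak_gradient_def by (rule someI[of "\<lambda>g. has_weak_gradient w g \<Gamma>"])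
    show "AE x in lborel. x \<in> \<Gamma> \<longrightarrow> weak_gradient \<Gamma> w x = k x" by (rule weak_gradient_unique[OF open_domain w k])
  qed
  have wm: "(\<lambda>x. indicator \<Gamma> x *\<^sub>R weak_gradient \<Gamma> w x) \<in> borel_measurable borel"
    if "has_weak_gradient w (weak_gradient \<Gamma> w) \<Gamma>" for w
    using that unfolding has_weak_gradient_def restricted_measurable_iff[OF sets_domain(1)] by blast
  have "dirichlet_integral \<Gamma> u v = (\<integral>x. (indicator \<Gamma> x *\<^sub>R weak_gradient \<Gamma> u x) \<bullet> (indicator \<Gamma> x *\<^sub>R weak_gradient \<Gamma> v x) \<partial>lborel)"
    unfolding dirichlet_integral_def restricted_integral[OF sets_domain(1)]
    by (rule Bochner_Integration.integral_cong[OF refl]) (auto split: split_indicator)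
  also have "\<dots> = (\<integral>x. g x \<bullet> h x \<partial>lborel)"
  proof (rule integral_cong_AE)
    show "(\<lambda>x. (indicator \<Gamma> x *\<^sub>R weak_gradient \<Gamma> u x) \<bullet> (indicator \<Gamma> x *\<^sub>R weak_gradient \<Gamma> v x)) \<in> borel_measurable lborel"
      by (rule borel_measurable_inner) (use wm[OF *(1)[OF u]] wm[OF *(1)[OF v]] in simp_all)
    show "(\<lambda>x. g x \<bullet> h x) \<in> borel_measurable lborel"
      using sobolevD(2)[OF u(2)] sobolevD(2)[OF v(2)] by (auto simp: square_int_def)
    show "AE x in lborel. (indicator \<Gamma> x *\<^sub>R weak_gradient \<Gamma> u x) \<bullet> (indicator \<Gamma> x *\<^sub>R weak_gradient \<Gamma> v x) = g x \<bullet> h x"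
      using *(2)[OF u] *(2)[OF v]
    proof eventually_elim
      case (elim x)
      then show ?case using sobolevD(4)[OF u(2), of x] by (cases "x \<in> \<Gamma>") auto
    qed
  qed
  finally show ?thesis .
qed

lemma E_self:
  assumes "u \<in> borel_measurable m" "sobolev \<Gamma> (ext0 u) g"
  shows "E u u = 1 / 2 * sq_norm lborel g"
  using dirichlet_integral_eq[OF assms assms] by (simp add: sq_norm_def power2_norm_eq_inner)

lemma form_norm_eq:
  assumes "u \<in> borel_measurable m" "sobolev \<Gamma> (ext0 u) g"
  shows "form_norm m E u = sqrt (1 / 2 * sq_norm lborel g + sq_norm lborel (ext0 u))"
  unfolding form_norm_def L2_norm_sq[OF assms(1)] E_self[OF assms] ..

lemma form_norm_diff:
  assumes "u \<in> borel_measurable m" "sobolev \<Gamma> (ext0 u) g" "v \<in> borel_measurable m" "sobolev \<Gamma> (ext0 v) h"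
  shows "form_norm m E (\<lambda>x. u x - v x) = sqrt (1 / 2 * sq_norm lborel (\<lambda>x. g x - h x) + sq_norm lborel (\<lambda>x. ext0 u x - ext0 v x))"
proof -
  have e: "ext0 (\<lambda>x. u x - v x) = (\<lambda>x. ext0 u x - ext0 v x)" by (simp add: fun_eq_iff right_diff_distrib)
  have "sobolev \<Gamma> (ext0 (\<lambda>x. u x - v x)) (\<lambda>x. g x - h x)" unfolding e by (rule sobolev_diff[OF assms(2,4)])
  moreover have "(\<lambda>x. u x - v x) \<in> borel_measurable m" using assms by (intro borel_measurable_diff)
  ultimately show ?thesis using form_norm_eq[of "\<lambda>x. u x - v x"] unfolding e by blast
qed

end

lemma sobolev_cong_AE:
  assumes s: "sobolev S u g" and v: "v \<in> borel_measurable borel" "AE x in lborel. u x = v x" "\<And>x. x \<notin> S \<Longrightarrow> v x = 0"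
  shows "sobolev S v g"
  unfolding sobolev_def
proof (intro conjI allI impI ballI)
  note s' = sobolevD[OF s]
  have ae: "AE x in lborel. norm (v x) \<le> norm (u x)" using v(2) by eventually_elim simp
  have vm: "v \<in> borel_measurable lborel" using v(1) by simp
  show "square_int lborel v" by (rule square_int_mono(1)[OF s'(1) vm ae])
  show "square_int lborel g" by (rule s'(2))
  fix \<phi> and b :: 'a assume p: "\<phi> \<in> test_functions S" "b \<in> Basis"
  have "(\<integral>x. v x * dd \<phi> b x \<partial>lborel) = (\<integral>x. u x * dd \<phi> b x \<partial>lborel)"
  proof (rule integral_cong_AE)
    show "(\<lambda>x. v x * dd \<phi> b x) \<in> borel_measurable lborel" "(\<lambda>x. u x * dd \<phi> b x) \<in> borel_measurable lborel"
      using square_int_meas[OF test_square_int(3)[OF p(1), of b]] vm square_int_meas[OF s'(1)]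
      by (auto intro: borel_measurable_times)
    show "AE x in lborel. v x * dd \<phi> b x = u x * dd \<phi> b x" using v(2) by eventually_elim simp
  qed
  then show "(\<integral>x. v x * dd \<phi> b x \<partial>lborel) = - (\<integral>x. (g x \<bullet> b) * \<phi> x \<partial>lborel)" using s'(5)[OF p] by simp
qed (use v sobolevD[OF s] in auto)

context reflecting_domain
begin

text \<open>A representative \<open>u\<close> on the closure together with the weak gradient of its restriction to the
  domain, extended by zero. Being measurable on the closure matters, as the values on the boundary are
  arbitrary.\<close>

definition h1_pair :: "('a \<Rightarrow> real) \<Rightarrow> ('a \<Rightarrow> 'a) \<Rightarrow> bool" where
  "h1_pair u g \<longleftrightarrow> u \<in> borel_measurable m \<and> sobolev \<Gamma> (ext0 u) g"

lemma H1_closure_pair: "u \<in> H1_closure \<Gamma> \<longleftrightarrow> (\<exists>g. h1_pair u g)"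
  by (simp add: H1_closure_iff h1_pair_def)

lemma h1_pair_sq:
  assumes "h1_pair u g"
  shows "square_int lborel (ext0 u)" "square_int lborel g"
  using assms sobolevD(1,2) unfolding h1_pair_def by blast+

lemma h1_pair_add:
  assumes "h1_pair u g" "h1_pair v h" shows "h1_pair (\<lambda>x. u x + v x) (\<lambda>x. g x + h x)"
proof -
  have "ext0 (\<lambda>x. u x + v x) = (\<lambda>x. ext0 u x + ext0 v x)" by (simp add: fun_eq_iff distrib_left)
  then show ?thesis using assms sobolev_add[of \<Gamma> "ext0 u" g "ext0 v" h] unfolding h1_pair_def by (simp add: borel_measurable_add)
qed

lemma h1_pair_cmult:
  assumes "h1_pair u g" shows "h1_pair (\<lambda>x. c * u x) (\<lambda>x. c *\<^sub>R g x)"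
proof -
  have "ext0 (\<lambda>x. c * u x) = (\<lambda>x. c * ext0 u x)" by (simp add: fun_eq_iff)
  then show ?thesis using assms sobolev_cmult[of \<Gamma> "ext0 u" g c] unfolding h1_pair_def by (simp add: borel_measurable_times)
qed

lemma ext0_clip: "ext0 (\<lambda>x. unit_clip (u x)) = (\<lambda>x. unit_clip (ext0 u x))"
  by (auto simp: fun_eq_iff split: split_indicator)

lemma h1_pair_clip:
  assumes "h1_pair u g" shows "h1_pair (\<lambda>x. unit_clip (u x)) (clip_gradient (ext0 u) g)"
  using assms sobolev_unit_clip[OF open_domain] unfolding h1_pair_def ext0_clip
  by (auto intro: borel_measurable_min borel_measurable_max)

lemma h1_pair_zero: "h1_pair (\<lambda>x. 0) (\<lambda>x. 0)"
  by (simp add: h1_pair_def sobolev_zero)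

lemma h1_pair_cong:
  assumes u: "h1_pair u g" and v: "v \<in> borel_measurable m" "AE x in m. u x = v x"
  shows "h1_pair v g"
  unfolding h1_pair_def
proof
  have "AE x in lborel. x \<in> closure \<Gamma> \<longrightarrow> u x = v x"
    using v(2) by (subst (asm) AE_restrict_space_iff) auto
  then have "AE x in lborel. ext0 u x = ext0 v x"
    by eventually_elim (use closure_subset[of \<Gamma>] in \<open>auto split: split_indicator\<close>)
  then show "sobolev \<Gamma> (ext0 v) g"
    using u ext0_measurable[OF v(1)] unfolding h1_pair_def by (intro sobolev_cong_AE[of \<Gamma> "ext0 u" g "ext0 v"]) auto
qed (rule v(1))

lemma h1_pair_E:
  assumes "h1_pair u g" "h1_pair v h" shows "E u v = 1 / 2 * (\<integral>x. g x \<bullet> h x \<partial>lborel)"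
  using dirichlet_integral_eq[of u g v h] assms by (simp add: h1_pair_def)

lemma h1_pair_form_norm:
  assumes "h1_pair u g" "h1_pair v h"
  shows "form_norm m E (\<lambda>x. u x - v x) = sqrt (1 / 2 * sq_norm lborel (\<lambda>x. g x - h x) + sq_norm lborel (\<lambda>x. ext0 u x - ext0 v x))"
  using form_norm_diff assms unfolding h1_pair_def by blast

lemma form_norm_less_iff:
  assumes "h1_pair u g" "h1_pair v h" "e > 0"
  shows "form_norm m E (\<lambda>x. u x - v x) < e \<longleftrightarrow>
    1 / 2 * sq_norm lborel (\<lambda>x. g x - h x) + sq_norm lborel (\<lambda>x. ext0 u x - ext0 v x) < e\<^sup>2"
proof -
  let ?s = "1 / 2 * sq_norm lborel (\<lambda>x. g x - h x) + sq_norm lborel (\<lambda>x. ext0 u x - ext0 v x)"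
  have "sqrt ?s < e \<longleftrightarrow> sqrt ?s < sqrt (e\<^sup>2)" using assms(3) by simp
  also have "\<dots> \<longleftrightarrow> ?s < e\<^sup>2" by (rule real_sqrt_less_iff)
  finally show ?thesis using h1_pair_form_norm[OF assms(1,2)] by simp
qed

section \<open>Regular Dirichlet forms generated by a core\<close>

definition form_closure :: "('a \<Rightarrow> real) set \<Rightarrow> ('a \<Rightarrow> real) set" where
  "form_closure C = {u \<in> H1_closure \<Gamma>. \<forall>e>0. \<exists>c\<in>C. form_norm m E (\<lambda>x. u x - c x) < e}"

lemma form_closureD:
  assumes u: "u \<in> form_closure C" and C: "C \<subseteq> H1_closure \<Gamma>" and g: "h1_pair u g" and e: "e > 0"
  obtains c k where "c \<in> C" "h1_pair c k" "sq_norm lborel (\<lambda>x. ext0 u x - ext0 c x) < e" "sq_norm lborel (\<lambda>x. g x - k x) < e"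
proof -
  have e2: "sqrt (e / 2) > 0" using e by simp
  obtain c where c: "c \<in> C" "form_norm m E (\<lambda>x. u x - c x) < sqrt (e / 2)"
    using u e2 unfolding form_closure_def by blast
  obtain k where k: "h1_pair c k" using c(1) C H1_closure_pair by blast
  have "1 / 2 * sq_norm lborel (\<lambda>x. g x - k x) + sq_norm lborel (\<lambda>x. ext0 u x - ext0 c x) < e / 2"
    using c(2) form_norm_less_iff[OF g k e2] e by simp
  moreover have "0 \<le> sq_norm lborel (\<lambda>x. g x - k x)" "0 \<le> sq_norm lborel (\<lambda>x. ext0 u x - ext0 c x)" by simp_all
  ultimately show ?thesis using that[OF c(1) k] e by linarith
qed

lemma form_closureI:
  assumes g: "h1_pair u g"
    and a: "\<And>e. e > 0 \<Longrightarrow> \<exists>c\<in>C. \<exists>k. h1_pair c k \<and> sq_norm lborel (\<lambda>x. ext0 u x - ext0 c x) < e \<and> sq_norm lborel (\<lambda>x. g x - k x) < e"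
  shows "u \<in> form_closure C"
  unfolding form_closure_def
proof (intro CollectI conjI allI impI)
  show "u \<in> H1_closure \<Gamma>" using g H1_closure_pair by blast
  fix e :: real assume e: "e > 0"
  then have "e\<^sup>2 / 2 > 0" by simp
  then obtain c k where c: "c \<in> C" "h1_pair c k" "sq_norm lborel (\<lambda>x. ext0 u x - ext0 c x) < e\<^sup>2 / 2" "sq_norm lborel (\<lambda>x. g x - k x) < e\<^sup>2 / 2"
    using a by blast
  then have "1 / 2 * sq_norm lborel (\<lambda>x. g x - k x) + sq_norm lborel (\<lambda>x. ext0 u x - ext0 c x) < e\<^sup>2"
    using sq_norm_nonneg[of lborel "\<lambda>x. g x - k x"] by linarith
  then show "\<exists>c\<in>C. form_norm m E (\<lambda>x. u x - c x) < e" using form_norm_less_iff[OF g c(2) e] c(1) by blast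
qed

lemma form_closure_seq:
  assumes u: "u \<in> form_closure C" and C: "C \<subseteq> H1_closure \<Gamma>" and g: "h1_pair u g"
  obtains c k where "\<And>n. c n \<in> C" "\<And>n. h1_pair (c n) (k n)"
    "(\<lambda>n. sq_norm lborel (\<lambda>x. ext0 (c n) x - ext0 u x)) \<longlonglongrightarrow> 0" "(\<lambda>n. sq_norm lborel (\<lambda>x. k n x - g x)) \<longlonglongrightarrow> 0"
proof -
  have "\<exists>c k. c \<in> C \<and> h1_pair c k \<and> sq_norm lborel (\<lambda>x. ext0 u x - ext0 c x) < 1 / real (Suc n) \<and> sq_norm lborel (\<lambda>x. g x - k x) < 1 / real (Suc n)" for n
  proof -
    have "1 / real (Suc n) > 0" by simp
    then show ?thesis by (rule form_closureD[OF u C g]) blast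
  qed
  from choice[OF allI[OF this]] obtain c where
    "\<forall>n. \<exists>k. c n \<in> C \<and> h1_pair (c n) k \<and> sq_norm lborel (\<lambda>x. ext0 u x - ext0 (c n) x) < 1 / real (Suc n) \<and> sq_norm lborel (\<lambda>x. g x - k x) < 1 / real (Suc n)" ..
  from choice[OF this] obtain k where
    "\<forall>n. c n \<in> C \<and> h1_pair (c n) (k n) \<and> sq_norm lborel (\<lambda>x. ext0 u x - ext0 (c n) x) < 1 / real (Suc n) \<and> sq_norm lborel (\<lambda>x. g x - k n x) < 1 / real (Suc n)" ..
  then have c: "\<And>n. c n \<in> C" "\<And>n. h1_pair (c n) (k n)"
    "\<And>n. sq_norm lborel (\<lambda>x. ext0 u x - ext0 (c n) x) < 1 / real (Suc n)" "\<And>n. sq_norm lborel (\<lambda>x. g x - k n x) < 1 / real (Suc n)"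
    by blast+
  have sw: "sq_norm lborel (\<lambda>x. ext0 (c n) x - ext0 u x) = sq_norm lborel (\<lambda>x. ext0 u x - ext0 (c n) x)"
    "sq_norm lborel (\<lambda>x. k n x - g x) = sq_norm lborel (\<lambda>x. g x - k n x)" for n
    by (simp_all add: sq_norm_def power2_commute norm_minus_commute)
  show ?thesis
  proof (rule that[OF c(1,2)])
    show "(\<lambda>n. sq_norm lborel (\<lambda>x. ext0 (c n) x - ext0 u x)) \<longlonglongrightarrow> 0"
      by (rule Lim_null_comparison[OF always_eventually LIMSEQ_Suc[OF lim_1_over_n]])
        (use c(3) in \<open>auto simp only: sw real_norm_def abs_of_nonneg[OF sq_norm_nonneg] intro: less_imp_le\<close>)
    show "(\<lambda>n. sq_norm lborel (\<lambda>x. k n x - g x)) \<longlonglongrightarrow> 0"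
      by (rule Lim_null_comparison[OF always_eventually LIMSEQ_Suc[OF lim_1_over_n]])
        (use c(4) in \<open>auto simp only: sw real_norm_def abs_of_nonneg[OF sq_norm_nonneg] intro: less_imp_le\<close>)
  qed
qed

text \<open>The unit contraction is continuous on \<open>H\<^sup>1\<close>: along an almost everywhere convergent
  subsequence the clipped gradients converge pointwise, on the level sets \<open>{u = 0}\<close> and \<open>{u = 1}\<close>
  because the limit gradient vanishes there.\<close>

lemma clip_tendsto:
  assumes u: "h1_pair u g" and c: "\<And>n. h1_pair (c n) (k n)"
    and lim: "(\<lambda>n. sq_norm lborel (\<lambda>x. ext0 (c n) x - ext0 u x)) \<longlonglongrightarrow> 0" "(\<lambda>n. sq_norm lborel (\<lambda>x. k n x - g x)) \<longlonglongrightarrow> 0"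
  obtains r where "strict_mono r"
    "(\<lambda>n. sq_norm lborel (\<lambda>x. clip_gradient (ext0 (c (r n))) (k (r n)) x - clip_gradient (ext0 u) g x)) \<longlonglongrightarrow> 0"
proof -
  note us = h1_pair_sq[OF u] and cs = h1_pair_sq[OF c]
  obtain r1 where r1: "strict_mono r1" "AE x in lborel. (\<lambda>n. ext0 (c (r1 n)) x) \<longlonglongrightarrow> ext0 u x"
    by (rule sq_norm_AE_subseq[OF cs(1) us(1) lim(1)])
  have lim2: "(\<lambda>n. sq_norm lborel (\<lambda>x. k (r1 n) x - g x)) \<longlonglongrightarrow> 0"
    using LIMSEQ_subseq_LIMSEQ[OF lim(2) r1(1)] by (simp add: comp_def)
  obtain r2 where r2: "strict_mono r2" "AE x in lborel. (\<lambda>n. k (r1 (r2 n)) x) \<longlonglongrightarrow> g x"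
    by (rule sq_norm_AE_subseq[OF cs(2) us(2) lim2])
  have lim3: "(\<lambda>n. sq_norm lborel (\<lambda>x. k (r1 (r2 n)) x - g x)) \<longlonglongrightarrow> 0"
    using LIMSEQ_subseq_LIMSEQ[OF lim2 r2(1)] by (simp add: comp_def)
  let ?f = "\<lambda>n. clip_gradient (ext0 (c (r1 (r2 n)))) (k (r1 (r2 n)))" and ?f' = "clip_gradient (ext0 u) g"
  have m1: "?f n \<in> borel_measurable lborel" "?f' \<in> borel_measurable lborel" for n
    using h1_pair_sq(2)[OF h1_pair_clip[OF c]] h1_pair_sq(2)[OF h1_pair_clip[OF u]] by (auto simp: square_int_def)
  have s: "sobolev \<Gamma> (ext0 u) g" using u by (simp add: h1_pair_def)
  have "AE x in lborel. (\<lambda>n. ?f n x) \<longlonglongrightarrow> ?f' x"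
    using r1(2) r2(2) gradient_zero_on_level_set[OF open_domain s, of 0] gradient_zero_on_level_set[OF open_domain s, of 1]
  proof eventually_elim
    case (elim x)
    have l1: "(\<lambda>n. ext0 (c (r1 (r2 n))) x) \<longlonglongrightarrow> ext0 u x"
      using LIMSEQ_subseq_LIMSEQ[OF elim(1) r2(1)] by (simp only: comp_def)
    consider "ext0 u x < 0" | "ext0 u x > 1" | "0 < ext0 u x" "ext0 u x < 1" | "ext0 u x = 0 \<or> ext0 u x = 1" by linarith
    then show ?case
    proof cases
      case 1
      have "\<forall>\<^sub>F n in sequentially. ?f n x = ?f' x"
        using order_tendstoD(2)[OF l1 1] by eventually_elim (use 1 in \<open>simp add: clip_gradient_def\<close>)
      then show ?thesis by (rule tendsto_eventually)
    next
      case 2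
      have "\<forall>\<^sub>F n in sequentially. ?f n x = ?f' x"
        using order_tendstoD(1)[OF l1 2] by eventually_elim (use 2 in \<open>simp add: clip_gradient_def\<close>)
      then show ?thesis by (rule tendsto_eventually)
    next
      case 3
      have "\<forall>\<^sub>F n in sequentially. ?f n x = k (r1 (r2 n)) x"
        using order_tendstoD(1)[OF l1 3(1)] order_tendstoD(2)[OF l1 3(2)] by eventually_elim (simp add: clip_gradient_def)
      then have "((\<lambda>n. ?f n x) \<longlonglongrightarrow> g x) = ((\<lambda>n. k (r1 (r2 n)) x) \<longlonglongrightarrow> g x)" by (rule tendsto_cong)
      moreover have "?f' x = g x" using 3 by (simp add: clip_gradient_def)
      ultimately show ?thesis using elim(2) by (simp only:)
    next
      case 4
      then have g0: "g x = 0" using elim(3,4) by blast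
      have z: "(\<lambda>n. norm (k (r1 (r2 n)) x)) \<longlonglongrightarrow> 0" using tendsto_norm[OF elim(2)] by (simp add: g0)
      have "(\<lambda>n. ?f n x) \<longlonglongrightarrow> 0"
        by (rule Lim_null_comparison[OF always_eventually z]) (simp add: clip_gradient_def)
      moreover have "?f' x = 0" using g0 by (simp add: clip_gradient_def)
      ultimately show ?thesis by (simp only:)
    qed
  qed
  then have "(\<lambda>n. sq_norm lborel (\<lambda>x. ?f n x - ?f' x)) \<longlonglongrightarrow> 0"
    by (intro sq_norm_moving_dominated_convergence[OF m1 cs(2) us(2) lim3])
      (auto intro!: AE_I2 simp: clip_gradient_def)
  moreover have "strict_mono (\<lambda>n. r1 (r2 n))" using strict_mono_compose[OF r1(1) r2(1)] by (simp add: comp_def)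
  ultimately show ?thesis using that[of "\<lambda>n. r1 (r2 n)"] by simp
qed

text \<open>Completeness of \<open>H\<^sup>1\<close>: functions and gradients converge in \<open>L\<^sup>2\<close>, and
  the limits inherit the integration by parts formula.\<close>

lemma h1_complete:
  assumes u: "\<And>n. h1_pair (u n) (g n)"
    and cau: "\<And>e. e > 0 \<Longrightarrow> \<exists>N. \<forall>k\<ge>N. \<forall>n\<ge>N. form_norm m E (\<lambda>x. u k x - u n x) < e"
  obtains v h where "h1_pair v h" "(\<lambda>n. sq_norm lborel (\<lambda>x. ext0 (u n) x - ext0 v x)) \<longlonglongrightarrow> 0"
    "(\<lambda>n. sq_norm lborel (\<lambda>x. g n x - h x)) \<longlonglongrightarrow> 0"
proof -
  note us = h1_pair_sq[OF u]
  have sf: "sigma_finite_measure (lborel :: 'a measure)" ..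
  have cau2: "\<exists>N. \<forall>k\<ge>N. \<forall>n\<ge>N. sq_norm lborel (\<lambda>x. ext0 (u k) x - ext0 (u n) x) < e \<and> sq_norm lborel (\<lambda>x. g k x - g n x) < e" if "e > 0" for e
  proof -
    have e: "sqrt (e / 2) > 0" using that by simp
    obtain N where N: "\<forall>k\<ge>N. \<forall>n\<ge>N. form_norm m E (\<lambda>x. u k x - u n x) < sqrt (e / 2)" using cau[OF e] by blast
    have "sq_norm lborel (\<lambda>x. ext0 (u k) x - ext0 (u n) x) < e \<and> sq_norm lborel (\<lambda>x. g k x - g n x) < e" if kn: "k \<ge> N" "n \<ge> N" for k n
    proof -
      have "1 / 2 * sq_norm lborel (\<lambda>x. g k x - g n x) + sq_norm lborel (\<lambda>x. ext0 (u k) x - ext0 (u n) x) < e / 2"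
        using N kn form_norm_less_iff[OF u u e, of k n] \<open>e > 0\<close> by simp
      moreover have "0 \<le> sq_norm lborel (\<lambda>x. g k x - g n x)" "0 \<le> sq_norm lborel (\<lambda>x. ext0 (u k) x - ext0 (u n) x)" by simp_all
      ultimately show ?thesis using \<open>e > 0\<close> by linarith
    qed
    then show ?thesis by blast
  qed
  obtain v0 where v0: "square_int lborel v0" "(\<lambda>n. sq_norm lborel (\<lambda>x. ext0 (u n) x - v0 x)) \<longlonglongrightarrow> 0"
    by (rule square_int_complete[of lborel "\<lambda>n. ext0 (u n)", OF sf us(1)]) (use cau2 in blast)
  obtain h0 where h0: "square_int lborel h0" "(\<lambda>n. sq_norm lborel (\<lambda>x. g n x - h0 x)) \<longlonglongrightarrow> 0"
    by (rule square_int_complete[of lborel g, OF sf us(2)]) (use cau2 in blast)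
  let ?v = "ext0 v0" and ?h = "\<lambda>x. indicator \<Gamma> x *\<^sub>R h0 x"
  have im: "(indicator \<Gamma> :: 'a \<Rightarrow> real) \<in> borel_measurable lborel" by simp
  have vs: "square_int lborel ?v" using square_int_bounded_mult[OF v0(1) im, of 1] by simp
  have hs: "square_int lborel ?h" by (rule square_int_bounded_mult[OF h0(1) im, of 1]) simp
  have s: "sobolev \<Gamma> (ext0 (u n)) (g n)" for n using u by (simp add: h1_pair_def)
  have l1: "(\<lambda>n. sq_norm lborel (\<lambda>x. ext0 (u n) x - ?v x)) \<longlonglongrightarrow> 0"
  proof (rule Lim_null_comparison[OF always_eventually v0(2)], rule allI)
    fix n
    have "sq_norm lborel (\<lambda>x. ext0 (u n) x - ?v x) \<le> sq_norm lborel (\<lambda>x. ext0 (u n) x - v0 x)"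
      by (rule square_int_mono(2)[OF square_int_diff[OF us(1) v0(1)] square_int_meas[OF square_int_diff[OF us(1) vs]] AE_I2])
        (auto split: split_indicator)
    then show "norm (sq_norm lborel (\<lambda>x. ext0 (u n) x - ?v x)) \<le> sq_norm lborel (\<lambda>x. ext0 (u n) x - v0 x)"
      by (simp only: real_norm_def abs_of_nonneg[OF sq_norm_nonneg])
  qed
  have l2: "(\<lambda>n. sq_norm lborel (\<lambda>x. g n x - ?h x)) \<longlonglongrightarrow> 0"
  proof (rule Lim_null_comparison[OF always_eventually h0(2)], rule allI)
    fix n
    have "sq_norm lborel (\<lambda>x. g n x - ?h x) \<le> sq_norm lborel (\<lambda>x. g n x - h0 x)"
      by (rule square_int_mono(2)[OF square_int_diff[OF us(2) h0(1)] square_int_meas[OF square_int_diff[OF us(2) hs]] AE_I2])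
        (use sobolevD(4)[OF s] in \<open>auto split: split_indicator\<close>)
    then show "norm (sq_norm lborel (\<lambda>x. g n x - ?h x)) \<le> sq_norm lborel (\<lambda>x. g n x - h0 x)"
      by (simp only: real_norm_def abs_of_nonneg[OF sq_norm_nonneg])
  qed
  have "sobolev \<Gamma> ?v ?h" by (rule sobolev_limit[OF s vs hs _ l1 l2]) simp
  moreover have zz: "indicator \<Gamma> x * ?v x = ?v x" for x by (auto split: split_indicator)
  moreover have "?v \<in> borel_measurable m" using vs by (intro measurable_mI) (simp add: square_int_def)
  ultimately have "h1_pair ?v ?h" unfolding h1_pair_def zz by blast
  then show ?thesis by (rule that[of ?v ?h]) (unfold zz, rule l1, rule l2)
qed

end

text \<open>In \<open>core_dense\<close> the radius \<open>R\<close> is uniform in \<open>e\<close>. Hence uniform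
  approximation by elements of the core is also approximation in \<open>L\<^sup>2\<close>.\<close>

locale dirichlet_core = reflecting_domain +
  fixes C :: "('a \<Rightarrow> real) set"
  assumes core_sub: "C \<subseteq> H1_closure \<Gamma>" "C \<subseteq> Cc (closure \<Gamma>)"
    and core_zero: "(\<lambda>x. 0) \<in> C"
    and core_add: "\<And>c d. c \<in> C \<Longrightarrow> d \<in> C \<Longrightarrow> (\<lambda>x. c x + d x) \<in> C"
    and core_scale: "\<And>a c. c \<in> C \<Longrightarrow> (\<lambda>x. a * c x) \<in> C"
    and core_clip: "\<And>c. c \<in> C \<Longrightarrow> (\<lambda>x. unit_clip (c x)) \<in> C"
    and core_dense: "\<And>f. f \<in> Cc (closure \<Gamma>) \<Longrightarrow>
      \<exists>R. \<forall>e>0. \<exists>c\<in>C. \<forall>x\<in>closure \<Gamma>. \<bar>f x - c x\<bar> < e \<and> (norm x > R \<longrightarrow> c x = 0)"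
begin

lemma core_subset_closure: "C \<subseteq> form_closure C"
proof
  fix c assume c: "c \<in> C"
  then obtain k where k: "h1_pair c k" using core_sub(1) H1_closure_pair by blast
  show "c \<in> form_closure C" by (rule form_closureI[OF k]) (use c k in \<open>auto intro!: bexI[of _ c] exI[of _ k]\<close>)
qed

lemma core_L2_dense:
  assumes u: "u \<in> L2 m" and e: "e > 0"
  shows "\<exists>c\<in>C. L2_norm m (\<lambda>x. u x - c x) < e"
proof -
  have um: "u \<in> borel_measurable m" using u by (simp add: L2_def)
  have zu: "square_int lborel (ext0 u)" using u L2_m_iff[OF um] by simp
  have e2: "e\<^sup>2 / 4 > 0" using e by simp
  obtain \<phi> where p: "cont_cs \<phi>" "sq_norm lborel (\<lambda>x. ext0 u x - \<phi> x) < e\<^sup>2 / 4"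
    by (rule continuous_dense_in_L2[OF zu e2])
  obtain R where R: "\<And>x. norm x > R \<Longrightarrow> \<phi> x = 0" using p(1) by (auto simp: cont_cs_def)
  have "\<phi> \<in> Cc (closure \<Gamma>)"
    unfolding Cc_def
  proof (intro CollectI conjI exI[of _ "closure \<Gamma> \<inter> cball 0 R"])
    show "continuous_on (closure \<Gamma>) \<phi>" using p(1) continuous_on_subset unfolding cont_cs_def by blast
  qed (use R in \<open>auto simp: closed_Int_compact not_less[symmetric]\<close>)
  from core_dense[OF this] obtain R' where
    R': "\<And>e. e > 0 \<Longrightarrow> \<exists>c\<in>C. \<forall>x\<in>closure \<Gamma>. \<bar>\<phi> x - c x\<bar> < e \<and> (norm x > R' \<longrightarrow> c x = 0)" by blast
  define M where "M = max R R'"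
  let ?I = "\<lambda>x::'a. indicator (cball 0 M) x :: real"
  define V where "V = sq_norm lborel (indicator (cball (0::'a) M) :: 'a \<Rightarrow> real)"
  have V: "V \<ge> 0" by (simp add: V_def)
  \<comment> \<open>A uniform error \<open>d\<close> on a ball of volume \<open>V\<close>
    contributes \<open>d\<^sup>2 V < e\<^sup>2 / 4\<close>.\<close>
  define d where "d = e / (2 * sqrt (V + 1))"
  have d: "d > 0" using e V unfolding d_def by (intro divide_pos_pos mult_pos_pos) auto
  have dV: "d\<^sup>2 * V < e\<^sup>2 / 4"
  proof -
    define q where "q = V + 1"
    have q: "q > 0" using V by (simp add: q_def)
    have "d\<^sup>2 * V < d\<^sup>2 * q" using d by (simp add: q_def)
    also have "\<dots> = e\<^sup>2 / 4" using q by (simp add: d_def q_def[symmetric] power_divide power_mult_distrib)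
    finally show ?thesis .
  qed
  obtain c where c: "c \<in> C" "\<And>x. x \<in> closure \<Gamma> \<Longrightarrow> \<bar>\<phi> x - c x\<bar> < d" "\<And>x. x \<in> closure \<Gamma> \<Longrightarrow> norm x > R' \<Longrightarrow> c x = 0"
    using R'[OF d] by blast
  obtain k where k: "h1_pair c k" using core_sub(1) c(1) H1_closure_pair by blast
  have cm: "c \<in> borel_measurable m" using k by (simp add: h1_pair_def)
  have ps: "square_int lborel \<phi>" by (rule cont_cs_square_int[OF p(1)])
  have im: "(indicator \<Gamma> :: 'a \<Rightarrow> real) \<in> borel_measurable lborel" by simp
  have zp: "square_int lborel (ext0 \<phi>)" using square_int_bounded_mult[OF ps im, of 1] by simp
  note zc = h1_pair_sq(1)[OF k]
  have bs: "square_int lborel ?I"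
    using square_int_indicator[of "cball 0 M" lborel 1] emeasure_bounded_finite[OF bounded_cball, of 0 M] by simp
  have "sq_norm lborel (\<lambda>x. ext0 u x - ext0 \<phi> x) \<le> sq_norm lborel (\<lambda>x. ext0 u x - \<phi> x)"
    by (rule square_int_mono(2)[OF square_int_diff[OF zu ps] square_int_meas[OF square_int_diff[OF zu zp]] AE_I2])
      (auto split: split_indicator)
  moreover have "sq_norm lborel (\<lambda>x. ext0 \<phi> x - ext0 c x) \<le> sq_norm lborel (\<lambda>x. d * ?I x)"
  proof (rule square_int_mono(2)[OF square_int_cmult(1)[OF bs] square_int_meas[OF square_int_diff[OF zp zc]] AE_I2])
    fix x
    show "norm (ext0 \<phi> x - ext0 c x) \<le> norm (d * ?I x)"
    proof (cases "x \<in> \<Gamma>")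
      case True
      then have xc: "x \<in> closure \<Gamma>" using closure_subset by blast
      show ?thesis
      proof (cases "norm x \<le> M")
        case False
        then show ?thesis using R[of x] c(3)[OF xc] by (simp add: M_def)
      next
        case t: True
        then show ?thesis using True c(2)[OF xc] d by simp
      qed
    qed simp
  qed
  moreover have "sq_norm lborel (\<lambda>x. d * ?I x) = d\<^sup>2 * V" unfolding V_def by (rule square_int_cmult(2)[OF bs])
  moreover have "sq_norm lborel (\<lambda>x. ext0 u x - ext0 c x) \<le> 2 * sq_norm lborel (\<lambda>x. ext0 u x - ext0 \<phi> x) + 2 * sq_norm lborel (\<lambda>x. ext0 \<phi> x - ext0 c x)"
    by (rule sq_norm_triangle[OF zu zp zc])
  ultimately have lt: "sq_norm lborel (\<lambda>x. ext0 u x - ext0 c x) < e\<^sup>2" using p(2) dV by linarith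
  have ez: "ext0 (\<lambda>x. u x - c x) = (\<lambda>x. ext0 u x - ext0 c x)" by (simp add: fun_eq_iff right_diff_distrib)
  have "(L2_norm m (\<lambda>x. u x - c x))\<^sup>2 < e\<^sup>2"
    unfolding L2_norm_sq[OF borel_measurable_diff[OF um cm]] ez by (rule lt)
  then have "L2_norm m (\<lambda>x. u x - c x) < e" using e by (simp add: power2_less_imp_less)
  then show ?thesis using c(1) by blast
qed

lemma form_closure_pair: "u \<in> form_closure C \<Longrightarrow> \<exists>g. h1_pair u g"
  unfolding form_closure_def H1_closure_pair by blast

lemma symmetric_form_closure: "symmetric_form m E (form_closure C)"
  unfolding symmetric_form_def
proof (intro conjI)
  note D = form_closureD[OF _ core_sub(1)]
  show "form_closure C \<subseteq> L2 m" by (auto simp: form_closure_def H1_closure_def)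
  show "\<forall>u\<in>form_closure C. \<forall>v\<in>L2 m. (AE x in m. u x = v x) \<longrightarrow> v \<in> form_closure C \<and> (\<forall>w\<in>form_closure C. E u w = E v w)"
  proof (intro ballI impI conjI)
    fix u v assume u: "u \<in> form_closure C" and v: "v \<in> L2 m" and eq: "AE x in m. u x = v x"
    obtain g where g: "h1_pair u g" using form_closure_pair[OF u] by blast
    have vm: "v \<in> borel_measurable m" using v by (simp add: L2_def)
    note g' = h1_pair_cong[OF g vm eq]
    show "v \<in> form_closure C"
    proof (rule form_closureI[OF g'])
      fix e :: real assume "e > 0"
      then obtain c k where c: "c \<in> C" "h1_pair c k" "sq_norm lborel (\<lambda>x. ext0 u x - ext0 c x) < e" "sq_norm lborel (\<lambda>x. g x - k x) < e"
        by (rule D[OF u g])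
      have "AE x in lborel. x \<in> closure \<Gamma> \<longrightarrow> u x = v x"
        using eq by (subst (asm) AE_restrict_space_iff) auto
      then have ae: "AE x in lborel. ext0 v x - ext0 c x = ext0 u x - ext0 c x"
        by eventually_elim (use closure_subset[of \<Gamma>] in \<open>auto split: split_indicator\<close>)
      have "sq_norm lborel (\<lambda>x. ext0 v x - ext0 c x) = sq_norm lborel (\<lambda>x. ext0 u x - ext0 c x)"
        by (rule sq_norm_cong_AE[OF ae square_int_meas[OF square_int_diff[OF h1_pair_sq(1)[OF g'] h1_pair_sq(1)[OF c(2)]]]
              square_int_meas[OF square_int_diff[OF h1_pair_sq(1)[OF g] h1_pair_sq(1)[OF c(2)]]]])
      then show "\<exists>c\<in>C. \<exists>k. h1_pair c k \<and> sq_norm lborel (\<lambda>x. ext0 v x - ext0 c x) < e \<and> sq_norm lborel (\<lambda>x. g x - k x) < e"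
        using c by (intro bexI[of _ c] exI[of _ k]) auto
    qed
    fix w assume "w \<in> form_closure C"
    then obtain h where h: "h1_pair w h" using form_closure_pair by blast
    show "E u w = E v w" using h1_pair_E[OF g h] h1_pair_E[OF g' h] by simp
  qed
  show "(\<lambda>x. 0) \<in> form_closure C" using core_zero core_subset_closure by blast
  show "\<forall>u\<in>form_closure C. \<forall>v\<in>form_closure C. (\<lambda>x. u x + v x) \<in> form_closure C"
  proof (intro ballI)
    fix u v assume u: "u \<in> form_closure C" and v: "v \<in> form_closure C"
    obtain g h where g: "h1_pair u g" and h: "h1_pair v h" using form_closure_pair u v by blast
    show "(\<lambda>x. u x + v x) \<in> form_closure C"
    proof (rule form_closureI[OF h1_pair_add[OF g h]])
      fix e :: real assume "e > 0"
      then have e: "e / 4 > 0" by simp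
      obtain c k where c: "c \<in> C" "h1_pair c k" "sq_norm lborel (\<lambda>x. ext0 u x - ext0 c x) < e / 4" "sq_norm lborel (\<lambda>x. g x - k x) < e / 4"
        using e by (rule D[OF u g])
      obtain c' k' where c': "c' \<in> C" "h1_pair c' k'" "sq_norm lborel (\<lambda>x. ext0 v x - ext0 c' x) < e / 4" "sq_norm lborel (\<lambda>x. h x - k' x) < e / 4"
        using e by (rule D[OF v h])
      note d = h1_pair_sq[OF g] h1_pair_sq[OF c(2)] h1_pair_sq[OF h] h1_pair_sq[OF c'(2)]
      have e1: "(ext0 u x - ext0 c x) + (ext0 v x - ext0 c' x) = ext0 (\<lambda>x. u x + v x) x - ext0 (\<lambda>x. c x + c' x) x"
        and e2: "(g x - k x) + (h x - k' x) = g x + h x - (k x + k' x)" for x by (simp_all add: algebra_simps)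
      have "sq_norm lborel (\<lambda>x. ext0 (\<lambda>x. u x + v x) x - ext0 (\<lambda>x. c x + c' x) x) < e"
        using sq_norm_add_le[OF square_int_diff[OF d(1,3)] square_int_diff[OF d(5,7)]] c(3) c'(3) unfolding e1 by linarith
      moreover have "sq_norm lborel (\<lambda>x. g x + h x - (k x + k' x)) < e"
        using sq_norm_add_le[OF square_int_diff[OF d(2,4)] square_int_diff[OF d(6,8)]] c(4) c'(4) unfolding e2 by linarith
      ultimately show "\<exists>ca\<in>C. \<exists>ka. h1_pair ca ka \<and> sq_norm lborel (\<lambda>x. ext0 (\<lambda>x. u x + v x) x - ext0 ca x) < e \<and> sq_norm lborel (\<lambda>x. g x + h x - ka x) < e"
        using core_add[OF c(1) c'(1)] h1_pair_add[OF c(2) c'(2)]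
        by (intro bexI[of _ "\<lambda>x. c x + c' x"] exI[of _ "\<lambda>x. k x + k' x"]) auto
    qed
  qed
  show "\<forall>a. \<forall>u\<in>form_closure C. (\<lambda>x. a * u x) \<in> form_closure C"
  proof (intro allI ballI)
    fix a u assume u: "u \<in> form_closure C"
    obtain g where g: "h1_pair u g" using form_closure_pair u by blast
    show "(\<lambda>x. a * u x) \<in> form_closure C"
    proof (rule form_closureI[OF h1_pair_cmult[OF g]])
      fix e :: real assume e: "e > 0"
      have a1: "a\<^sup>2 + 1 > 0" using zero_le_power2[of a] by linarith
      then have e': "e / (a\<^sup>2 + 1) > 0" using e by (intro divide_pos_pos)
      obtain c k where c: "c \<in> C" "h1_pair c k" "sq_norm lborel (\<lambda>x. ext0 u x - ext0 c x) < e / (a\<^sup>2 + 1)" "sq_norm lborel (\<lambda>x. g x - k x) < e / (a\<^sup>2 + 1)"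
        using e' by (rule D[OF u g])
      have sc: "a\<^sup>2 * s < e" if "s < e / (a\<^sup>2 + 1)" "0 \<le> s" for s
      proof -
        have "a\<^sup>2 * s \<le> s * (a\<^sup>2 + 1)" using that(2) by (simp add: algebra_simps)
        also have "\<dots> < e" using that(1) a1 by (simp add: pos_less_divide_eq)
        finally show ?thesis .
      qed
      note d = h1_pair_sq[OF g] h1_pair_sq[OF c(2)]
      have "sq_norm lborel (\<lambda>x. a * (ext0 u x - ext0 c x)) < e"
        unfolding square_int_cmult(2)[OF square_int_diff[OF d(1,3)]] by (rule sc[OF c(3)]) simp
      moreover have "(\<lambda>x. a * (ext0 u x - ext0 c x)) = (\<lambda>x. ext0 (\<lambda>x. a * u x) x - ext0 (\<lambda>x. a * c x) x)"
        by (simp add: fun_eq_iff algebra_simps)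
      moreover have "sq_norm lborel (\<lambda>x. a *\<^sub>R (g x - k x)) < e"
        unfolding square_int_scaleR(2)[OF square_int_diff[OF d(2,4)]] by (rule sc[OF c(4)]) simp
      ultimately show "\<exists>ca\<in>C. \<exists>ka. h1_pair ca ka \<and> sq_norm lborel (\<lambda>x. ext0 (\<lambda>x. a * u x) x - ext0 ca x) < e \<and> sq_norm lborel (\<lambda>x. a *\<^sub>R g x - ka x) < e"
        using core_scale[OF c(1)] h1_pair_cmult[OF c(2)]
        by (intro bexI[of _ "\<lambda>x. a * c x"] exI[of _ "\<lambda>x. a *\<^sub>R k x"]) (auto simp: scaleR_diff_right)
    qed
  qed
  show "\<forall>u\<in>L2 m. \<forall>\<epsilon>>0. \<exists>v\<in>form_closure C. L2_norm m (\<lambda>x. u x - v x) < \<epsilon>"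
    using core_L2_dense core_subset_closure by blast
  show "\<forall>u\<in>form_closure C. \<forall>v\<in>form_closure C. E u v = E v u"
  proof (intro ballI)
    fix u v assume uv: "u \<in> form_closure C" "v \<in> form_closure C"
    obtain g h where g: "h1_pair u g" and h: "h1_pair v h" using form_closure_pair uv by blast
    show "E u v = E v u" using h1_pair_E[OF g h] h1_pair_E[OF h g] by (simp add: inner_commute)
  qed
  show "\<forall>u\<in>form_closure C. \<forall>v\<in>form_closure C. \<forall>w\<in>form_closure C. E (\<lambda>x. u x + v x) w = E u w + E v w"
  proof (intro ballI)
    fix u v w assume uv: "u \<in> form_closure C" "v \<in> form_closure C" "w \<in> form_closure C"
    obtain g h l where g: "h1_pair u g" and h: "h1_pair v h" and l: "h1_pair w l" using form_closure_pair uv by meson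
    show "E (\<lambda>x. u x + v x) w = E u w + E v w"
      unfolding h1_pair_E[OF h1_pair_add[OF g h] l] h1_pair_E[OF g l] h1_pair_E[OF h l]
      using inner_integrable[OF h1_pair_sq(2)[OF g] h1_pair_sq(2)[OF l]] inner_integrable[OF h1_pair_sq(2)[OF h] h1_pair_sq(2)[OF l]]
      by (simp add: inner_add_left)
  qed
  show "\<forall>a. \<forall>u\<in>form_closure C. \<forall>w\<in>form_closure C. E (\<lambda>x. a * u x) w = a * E u w"
  proof (intro allI ballI)
    fix a u w assume uv: "u \<in> form_closure C" "w \<in> form_closure C"
    obtain g l where g: "h1_pair u g" and l: "h1_pair w l" using form_closure_pair uv by blast
    show "E (\<lambda>x. a * u x) w = a * E u w"
      unfolding h1_pair_E[OF h1_pair_cmult[OF g] l] h1_pair_E[OF g l] by simp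
  qed
  show "\<forall>u\<in>form_closure C. 0 \<le> E u u"
  proof
    fix u assume u: "u \<in> form_closure C"
    obtain g where g: "h1_pair u g" using form_closure_pair u by blast
    show "0 \<le> E u u" unfolding h1_pair_E[OF g g] by (simp add: Bochner_Integration.integral_nonneg)
  qed
qed

lemma closed_form_closure: "closed_form m E (form_closure C)"
  unfolding closed_form_def
proof (intro allI impI, elim conjE)
  fix u :: "nat \<Rightarrow> 'a \<Rightarrow> real"
  assume u: "\<forall>n. u n \<in> form_closure C"
    and cau: "\<forall>\<epsilon>>0. \<exists>N. \<forall>k\<ge>N. \<forall>n\<ge>N. form_norm m E (\<lambda>x. u k x - u n x) < \<epsilon>"
  have "\<exists>g. h1_pair (u n) g" for n using form_closure_pair u by blast
  then obtain g where g: "\<And>n. h1_pair (u n) (g n)" by metis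
  obtain v h where v: "h1_pair v h" "(\<lambda>n. sq_norm lborel (\<lambda>x. ext0 (u n) x - ext0 v x)) \<longlonglongrightarrow> 0"
    "(\<lambda>n. sq_norm lborel (\<lambda>x. g n x - h x)) \<longlonglongrightarrow> 0"
    by (rule h1_complete[of u g, OF g]) (use cau in blast)
  have "v \<in> form_closure C"
  proof (rule form_closureI[OF v(1)])
    fix e :: real assume "e > 0"
    then have e: "e / 4 > 0" by simp
    have "\<forall>\<^sub>F n in sequentially. sq_norm lborel (\<lambda>x. ext0 (u n) x - ext0 v x) < e / 4 \<and> sq_norm lborel (\<lambda>x. g n x - h x) < e / 4"
      using order_tendstoD(2)[OF v(2) e] order_tendstoD(2)[OF v(3) e] by (rule eventually_conj)
    then obtain n where n: "sq_norm lborel (\<lambda>x. ext0 (u n) x - ext0 v x) < e / 4" "sq_norm lborel (\<lambda>x. g n x - h x) < e / 4"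
      using eventually_happens trivial_limit_sequentially by blast
    have "u n \<in> form_closure C" using u by blast
    from this g[of n] e obtain c k where c: "c \<in> C" "h1_pair c k"
      "sq_norm lborel (\<lambda>x. ext0 (u n) x - ext0 c x) < e / 4" "sq_norm lborel (\<lambda>x. g n x - k x) < e / 4"
      by (rule form_closureD[OF _ core_sub(1)])
    note d = h1_pair_sq[OF v(1)] h1_pair_sq[OF g[of n]] h1_pair_sq[OF c(2)]
    have sw: "sq_norm lborel (\<lambda>x. ext0 v x - ext0 (u n) x) = sq_norm lborel (\<lambda>x. ext0 (u n) x - ext0 v x)"
      "sq_norm lborel (\<lambda>x. h x - g n x) = sq_norm lborel (\<lambda>x. g n x - h x)"
      by (simp_all add: sq_norm_def power2_commute norm_minus_commute)
    have "sq_norm lborel (\<lambda>x. ext0 v x - ext0 c x) < e"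
      using sq_norm_triangle[OF d(1,3,5)] n(1) c(3) unfolding sw by linarith
    moreover have "sq_norm lborel (\<lambda>x. h x - k x) < e"
      using sq_norm_triangle[OF d(2,4,6)] n(2) c(4) unfolding sw by linarith
    ultimately show "\<exists>c\<in>C. \<exists>k. h1_pair c k \<and> sq_norm lborel (\<lambda>x. ext0 v x - ext0 c x) < e \<and> sq_norm lborel (\<lambda>x. h x - k x) < e"
      using c by blast
  qed
  moreover have "(\<lambda>n. form_norm m E (\<lambda>x. u n x - v x)) \<longlonglongrightarrow> 0"
  proof -
    have "(\<lambda>n. sqrt (1 / 2 * sq_norm lborel (\<lambda>x. g n x - h x) + sq_norm lborel (\<lambda>x. ext0 (u n) x - ext0 v x))) \<longlonglongrightarrow> sqrt (1 / 2 * 0 + 0)"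
      by (intro tendsto_intros v)
    then show ?thesis unfolding h1_pair_form_norm[OF g v(1)] by simp
  qed
  ultimately show "\<exists>v\<in>form_closure C. (\<lambda>n. form_norm m E (\<lambda>x. u n x - v x)) \<longlonglongrightarrow> 0" by blast
qed

lemma markovian_form_closure: "markovian_form E (form_closure C)"
  unfolding markovian_form_def Let_def
proof (intro ballI conjI)
  fix u assume u: "u \<in> form_closure C"
  obtain g where g: "h1_pair u g" using form_closure_pair u by blast
  note gc = h1_pair_clip[OF g]
  obtain c k where c: "\<And>n. c n \<in> C" "\<And>n. h1_pair (c n) (k n)"
    "(\<lambda>n. sq_norm lborel (\<lambda>x. ext0 (c n) x - ext0 u x)) \<longlonglongrightarrow> 0" "(\<lambda>n. sq_norm lborel (\<lambda>x. k n x - g x)) \<longlonglongrightarrow> 0"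
    by (rule form_closure_seq[OF u core_sub(1) g]) blast
  obtain r where r: "strict_mono r"
    "(\<lambda>n. sq_norm lborel (\<lambda>x. clip_gradient (ext0 (c (r n))) (k (r n)) x - clip_gradient (ext0 u) g x)) \<longlonglongrightarrow> 0"
    by (rule clip_tendsto[OF g c(2-4)])
  have l: "(\<lambda>n. sq_norm lborel (\<lambda>x. ext0 (c (r n)) x - ext0 u x)) \<longlonglongrightarrow> 0"
    using LIMSEQ_subseq_LIMSEQ[OF c(3) r(1)] by (simp only: comp_def)
  show "(\<lambda>x. unit_clip (u x)) \<in> form_closure C"
  proof (rule form_closureI[OF gc])
    fix e :: real assume e: "e > 0"
    let ?c = "\<lambda>n x. unit_clip (c (r n) x)" and ?k = "\<lambda>n. clip_gradient (ext0 (c (r n))) (k (r n))"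
    have "\<forall>\<^sub>F n in sequentially. sq_norm lborel (\<lambda>x. ext0 (c (r n)) x - ext0 u x) < e \<and> sq_norm lborel (\<lambda>x. ?k n x - clip_gradient (ext0 u) g x) < e"
      using order_tendstoD(2)[OF l e] order_tendstoD(2)[OF r(2) e] by (rule eventually_conj)
    then obtain n where n: "sq_norm lborel (\<lambda>x. ext0 (c (r n)) x - ext0 u x) < e" "sq_norm lborel (\<lambda>x. ?k n x - clip_gradient (ext0 u) g x) < e"
      using eventually_happens trivial_limit_sequentially by blast
    note kc = h1_pair_clip[OF c(2), of "r n"]
    have "sq_norm lborel (\<lambda>x. ext0 (\<lambda>x. unit_clip (u x)) x - ext0 (?c n) x) \<le> sq_norm lborel (\<lambda>x. ext0 (c (r n)) x - ext0 u x)"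
    proof (rule square_int_mono(2)[OF square_int_diff[OF h1_pair_sq(1)[OF c(2)] h1_pair_sq(1)[OF g]]
          square_int_meas[OF square_int_diff[OF h1_pair_sq(1)[OF gc] h1_pair_sq(1)[OF kc]]] AE_I2])
      fix x
      have "\<bar>unit_clip (u x) - unit_clip (c (r n) x)\<bar> \<le> \<bar>c (r n) x - u x\<bar>"
        using unit_clip_lipschitz[of "u x" "c (r n) x"] by (simp only: abs_minus_commute)
      then show "norm (ext0 (\<lambda>x. unit_clip (u x)) x - ext0 (?c n) x) \<le> norm (ext0 (c (r n)) x - ext0 u x)"
        by (auto split: split_indicator)
    qed
    then have "sq_norm lborel (\<lambda>x. ext0 (\<lambda>x. unit_clip (u x)) x - ext0 (?c n) x) < e" using n(1) by linarith
    moreover have "sq_norm lborel (\<lambda>x. clip_gradient (ext0 u) g x - ?k n x) < e"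
      using n(2) by (simp only: sq_norm_def norm_minus_commute)
    ultimately show "\<exists>c\<in>C. \<exists>k. h1_pair c k \<and> sq_norm lborel (\<lambda>x. ext0 (\<lambda>x. unit_clip (u x)) x - ext0 c x) < e \<and> sq_norm lborel (\<lambda>x. clip_gradient (ext0 u) g x - k x) < e"
      using core_clip[OF c(1), of "r n"] kc by blast
  qed
  have "sq_norm lborel (clip_gradient (ext0 u) g) \<le> sq_norm lborel g"
    by (rule square_int_mono(2)[OF h1_pair_sq(2)[OF g] square_int_meas[OF h1_pair_sq(2)[OF gc]] AE_I2])
      (simp add: clip_gradient_def)
  then show "E (\<lambda>x. unit_clip (u x)) (\<lambda>x. unit_clip (u x)) \<le> E u u"
    unfolding h1_pair_E[OF gc gc] h1_pair_E[OF g g] by (simp add: sq_norm_def power2_norm_eq_inner)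
qed

text \<open>The closure is closed by completeness of \<open>H\<^sup>1\<close>, Markovian by continuity of the unit
  contraction, and regular because the core lies in it.\<close>

theorem regular_form_closure: "regular_dirichlet_form m E (form_closure C)"
  unfolding regular_dirichlet_form_def dirichlet_form_def
proof (intro conjI symmetric_form_closure closed_form_closure markovian_form_closure)
  have sp: "space m = closure \<Gamma>" by (simp add: space_restrict_space)
  have CC: "C \<subseteq> form_closure C \<inter> Cc (space m)" using core_subset_closure core_sub(2) sp by auto
  show "\<forall>u\<in>form_closure C. \<forall>\<epsilon>>0. \<exists>v\<in>form_closure C \<inter> Cc (space m). form_norm m E (\<lambda>x. u x - v x) < \<epsilon>"
    using CC unfolding form_closure_def by blast
  show "\<forall>f\<in>Cc (space m). \<forall>\<epsilon>>0. \<exists>v\<in>form_closure C \<inter> Cc (space m). \<forall>x\<in>space m. \<bar>f x - v x\<bar> < \<epsilon>"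
  proof (intro ballI allI impI)
    fix f and \<epsilon> :: real assume f: "f \<in> Cc (space m)" and \<epsilon>: "\<epsilon> > 0"
    then obtain c where "c \<in> C" "\<forall>x\<in>closure \<Gamma>. \<bar>f x - c x\<bar> < \<epsilon>" using core_dense[of f] sp by metis
    then show "\<exists>v\<in>form_closure C \<inter> Cc (space m). \<forall>x\<in>space m. \<bar>f x - v x\<bar> < \<epsilon>" using CC sp by auto
  qed
qed

end

section \<open>Functions that are constant across a set of levels of one coordinate\<close>

context reflecting_domain
begin

definition flat_core :: "real set \<Rightarrow> 'a \<Rightarrow> ('a \<Rightarrow> real) set" where
  "flat_core A b = {c \<in> Cc (closure \<Gamma>). \<exists>k. h1_pair c k \<and> (AE x in lborel. x \<bullet> b \<in> A \<longrightarrow> k x \<bullet> b = 0)}"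

lemma Cc_add: "f \<in> Cc S \<Longrightarrow> g \<in> Cc S \<Longrightarrow> (\<lambda>x. f x + g x) \<in> Cc S" for f :: "'a \<Rightarrow> real"
proof -
  assume "f \<in> Cc S" "g \<in> Cc S"
  then obtain K L where K: "continuous_on S f" "compact K" "K \<subseteq> S" "\<forall>x\<in>S - K. f x = 0"
    and L: "continuous_on S g" "compact L" "L \<subseteq> S" "\<forall>x\<in>S - L. g x = 0" unfolding Cc_def by blast
  then show ?thesis unfolding Cc_def
    by (intro CollectI conjI continuous_on_add exI[of _ "K \<union> L"] compact_Un) auto
qed

lemma Cc_compose: "f \<in> Cc S \<Longrightarrow> continuous_on UNIV h \<Longrightarrow> h 0 = 0 \<Longrightarrow> (\<lambda>x. h (f x)) \<in> Cc S"
  for f :: "'a \<Rightarrow> real" and h :: "real \<Rightarrow> real"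
proof -
  assume f: "f \<in> Cc S" and h: "continuous_on UNIV h" "h 0 = 0"
  obtain K where K: "continuous_on S f" "compact K" "K \<subseteq> S" "\<forall>x\<in>S - K. f x = 0" using f unfolding Cc_def by blast
  then show ?thesis unfolding Cc_def
    by (intro CollectI conjI continuous_on_compose2[OF h(1)] exI[of _ K]) (auto simp: h)
qed

lemma dirichlet_core_flat:
  assumes "\<And>f. f \<in> Cc (closure \<Gamma>) \<Longrightarrow>
      \<exists>R. \<forall>e>0. \<exists>c\<in>flat_core A b. \<forall>x\<in>closure \<Gamma>. \<bar>f x - c x\<bar> < e \<and> (norm x > R \<longrightarrow> c x = 0)"
  shows "dirichlet_core \<Gamma> (flat_core A b)"
proof (intro dirichlet_core.intro dirichlet_core_axioms.intro)
  show "reflecting_domain \<Gamma>" by (rule reflecting_domain_axioms)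
  show "flat_core A b \<subseteq> H1_closure \<Gamma>" unfolding flat_core_def H1_closure_pair[abs_def] using H1_closure_pair by blast
  show "flat_core A b \<subseteq> Cc (closure \<Gamma>)" unfolding flat_core_def by blast
  show "(\<lambda>x. 0) \<in> flat_core A b"
    unfolding flat_core_def
  proof (intro CollectI conjI exI)
    show "(\<lambda>x. 0) \<in> Cc (closure \<Gamma>)" unfolding Cc_def by (auto intro!: exI[of _ "{}"])
    show "h1_pair (\<lambda>x. 0) (\<lambda>x. 0)" by (rule h1_pair_zero)
  qed simp
  show "(\<lambda>x. c x + d x) \<in> flat_core A b" if cd: "c \<in> flat_core A b" "d \<in> flat_core A b" for c d
  proof -
    obtain k l where k: "h1_pair c k" "AE x in lborel. x \<bullet> b \<in> A \<longrightarrow> k x \<bullet> b = 0"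
      and l: "h1_pair d l" "AE x in lborel. x \<bullet> b \<in> A \<longrightarrow> l x \<bullet> b = 0" using cd unfolding flat_core_def by blast
    have "AE x in lborel. x \<bullet> b \<in> A \<longrightarrow> (k x + l x) \<bullet> b = 0"
      using k(2) l(2) by eventually_elim (simp add: inner_add_left)
    then show ?thesis using h1_pair_add[OF k(1) l(1)] Cc_add cd unfolding flat_core_def by blast
  qed
  show "(\<lambda>x. a * c x) \<in> flat_core A b" if c: "c \<in> flat_core A b" for a c
  proof -
    obtain k where k: "h1_pair c k" "AE x in lborel. x \<bullet> b \<in> A \<longrightarrow> k x \<bullet> b = 0" using c unfolding flat_core_def by blast
    have "AE x in lborel. x \<bullet> b \<in> A \<longrightarrow> (a *\<^sub>R k x) \<bullet> b = 0" using k(2) by eventually_elim simp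
    moreover have "(\<lambda>x. a * c x) \<in> Cc (closure \<Gamma>)"
      using c Cc_compose[of c "closure \<Gamma>" "\<lambda>t. a * t"] unfolding flat_core_def by (auto intro: continuous_intros)
    ultimately show ?thesis using h1_pair_cmult[OF k(1)] unfolding flat_core_def by blast
  qed
  show "(\<lambda>x. unit_clip (c x)) \<in> flat_core A b" if c: "c \<in> flat_core A b" for c
  proof -
    obtain k where k: "h1_pair c k" "AE x in lborel. x \<bullet> b \<in> A \<longrightarrow> k x \<bullet> b = 0" using c unfolding flat_core_def by blast
    have "AE x in lborel. x \<bullet> b \<in> A \<longrightarrow> clip_gradient (ext0 c) k x \<bullet> b = 0"
      using k(2) by eventually_elim (simp add: clip_gradient_def)
    moreover have "(\<lambda>x. unit_clip (c x)) \<in> Cc (closure \<Gamma>)"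
    proof (rule Cc_compose[of c "closure \<Gamma>" unit_clip])
      show "continuous_on UNIV unit_clip"
        by (intro continuous_on_min continuous_on_max continuous_on_const continuous_on_id)
    qed (use c in \<open>auto simp: flat_core_def\<close>)
    ultimately show ?thesis using h1_pair_clip[OF k(1)] unfolding flat_core_def by blast
  qed
qed (rule assms)

lemma flat_core_mono: "flat_core A b \<subseteq> flat_core {} b"
  unfolding flat_core_def by auto

text \<open>With no levels prescribed the core is \<open>H\<^sup>1 \<inter> C\<^sub>c\<close>, and mollification shows that it is dense.\<close>

lemma form_closure_flat_core_empty: "form_closure (flat_core {} b) = H1_closure \<Gamma>"
proof
  show "form_closure (flat_core {} b) \<subseteq> H1_closure \<Gamma>" by (auto simp: form_closure_def)
  show "H1_closure \<Gamma> \<subseteq> form_closure (flat_core {} b)"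
  proof
    fix u assume "u \<in> H1_closure \<Gamma>"
    then obtain g where g: "h1_pair u g" using H1_closure_pair by blast
    then have a: "H1_approx \<Gamma> (ext0 u) g" using sobolev_approx[OF open_domain segments] by (simp add: h1_pair_def)
    show "u \<in> form_closure (flat_core {} b)"
    proof (rule form_closureI[OF g])
      fix e :: real assume "e > 0"
      then obtain w k where w: "cont_cs w" "sobolev \<Gamma> (ext0 w) k"
        "sq_norm lborel (\<lambda>x. ext0 u x - ext0 w x) < e" "sq_norm lborel (\<lambda>x. g x - k x) < e"
        using a unfolding H1_approx_def by blast
      have "h1_pair w k"
        unfolding h1_pair_def using w(1,2) by (auto simp: cont_cs_def intro!: measurable_mI borel_measurable_continuous_onI)
      moreover obtain R where R: "\<And>x. norm x > R \<Longrightarrow> w x = 0" using w(1) by (auto simp: cont_cs_def)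
      have "w \<in> Cc (closure \<Gamma>)"
        unfolding Cc_def
      proof (intro CollectI conjI exI[of _ "closure \<Gamma> \<inter> cball 0 R"])
        show "continuous_on (closure \<Gamma>) w" using w(1) continuous_on_subset unfolding cont_cs_def by blast
      qed (use R in \<open>auto simp: closed_Int_compact not_less[symmetric]\<close>)
      ultimately show "\<exists>c\<in>flat_core {} b. \<exists>k. h1_pair c k \<and> sq_norm lborel (\<lambda>x. ext0 u x - ext0 c x) < e \<and> sq_norm lborel (\<lambda>x. g x - k x) < e"
        using w(3,4) unfolding flat_core_def by blast
    qed
  qed
qed

text \<open>Flatness is a closed condition: on the levels in \<open>A\<close> the derivative of \<open>u\<close> equals
  its difference from the vanishing derivatives of the approximants.\<close>

lemma flat_core_gradient:
  assumes u: "u \<in> form_closure (flat_core A b)" "h1_pair u g" and A: "A \<in> sets borel" and b: "b \<in> Basis"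
  shows "AE x in lborel. x \<bullet> b \<in> A \<longrightarrow> g x \<bullet> b = 0"
proof -
  have sub: "flat_core A b \<subseteq> H1_closure \<Gamma>" unfolding flat_core_def using H1_closure_pair by blast
  note gs = h1_pair_sq(2)[OF u(2)]
  let ?P = "\<lambda>x. indicator A (x \<bullet> b) * (g x \<bullet> b)"
  have "(\<lambda>x. x \<bullet> b) \<in> borel_measurable borel" by simp
  then have "(\<lambda>x. indicator A (x \<bullet> b) :: real) \<in> borel_measurable borel"
    by (rule measurable_compose) (use A in simp)
  moreover have "(\<lambda>x. g x \<bullet> b) \<in> borel_measurable borel" using square_int_inner[OF gs, of b] by (simp add: square_int_def)
  ultimately have Pm: "?P \<in> borel_measurable lborel" by (simp add: borel_measurable_times)
  have le: "norm (?P x) \<le> norm (g x)" for x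
    using Basis_le_norm[OF b, of "g x"] by (auto split: split_indicator)
  have Ps: "square_int lborel ?P" by (rule square_int_mono(1)[OF gs Pm AE_I2]) (rule le)
  have small: "sq_norm lborel ?P \<le> e" if e: "e > 0" for e
  proof -
    have e2: "sqrt (e / 2) > 0" using e by simp
    obtain c where c: "c \<in> flat_core A b" "form_norm m E (\<lambda>x. u x - c x) < sqrt (e / 2)"
      using u(1) e2 unfolding form_closure_def by blast
    obtain k where k: "h1_pair c k" "AE x in lborel. x \<bullet> b \<in> A \<longrightarrow> k x \<bullet> b = 0" using c(1) unfolding flat_core_def by blast
    have "1 / 2 * sq_norm lborel (\<lambda>x. g x - k x) + sq_norm lborel (\<lambda>x. ext0 u x - ext0 c x) < e / 2"
      using c(2) form_norm_less_iff[OF u(2) k(1) e2] e by simp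
    moreover have "0 \<le> sq_norm lborel (\<lambda>x. ext0 u x - ext0 c x)" by simp
    moreover have "sq_norm lborel ?P \<le> sq_norm lborel (\<lambda>x. g x - k x)"
    proof (rule square_int_mono(2)[OF square_int_diff[OF gs h1_pair_sq(2)[OF k(1)]] Pm])
      show "AE x in lborel. norm (?P x) \<le> norm (g x - k x)"
        using k(2)
      proof eventually_elim
        case (elim x)
        show ?case
        proof (cases "x \<bullet> b \<in> A")
          case True
          then have "?P x = (g x - k x) \<bullet> b" using elim by (simp add: inner_diff_left)
          then show ?thesis using Basis_le_norm[OF b, of "g x - k x"] by simp
        qed simp
      qed
    qed
    ultimately show ?thesis by linarith
  qed
  have "sq_norm lborel ?P \<le> 0"
  proof (rule field_le_epsilon)
    fix e :: real assume "0 < e"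
    then show "sq_norm lborel ?P \<le> 0 + e" unfolding add_0 by (rule small)
  qed
  then have "sq_norm lborel ?P = 0" using sq_norm_nonneg[of lborel ?P] by linarith
  then have "AE x in lborel. ?P x = 0" using sq_norm_eq_0_iff[OF Ps] by simp
  then show ?thesis by eventually_elim auto
qed

end

section \<open>Flattening a coordinate\<close>

text \<open>A fat Cantor set of levels: the rational levels fill only a null set of the ball, so by outer
  regularity they have an open neighbourhood that leaves out a part of positive measure.\<close>

lemma fat_level_set:
  fixes p b :: "'a::euclidean_space"
  assumes a: "a > 0" and b: "b \<in> Basis"
  obtains A :: "real set" where "compact A" "A \<noteq> {}" "\<forall>s t. s < t \<longrightarrow> (\<exists>q. s < q \<and> q < t \<and> q \<notin> A)"
    "\<not> (AE x in lborel. \<not> (x \<in> ball p a \<and> x \<bullet> b \<in> A))"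
proof -
  define \<nu> where "\<nu> = distr (density lborel (\<lambda>x. ennreal (indicator (ball p a) x))) borel (\<lambda>x. x \<bullet> b)"
  have \<nu>: "emeasure \<nu> B = emeasure lborel (ball p a \<inter> {x. x \<bullet> b \<in> B})" if B: "B \<in> sets borel" for B
  proof -
    have m: "{x. x \<bullet> b \<in> B} \<in> sets borel"
      using measurable_sets[of "\<lambda>x. x \<bullet> b" borel borel B] B by (simp add: vimage_def)
    have "emeasure \<nu> B = emeasure (density lborel (\<lambda>x. ennreal (indicator (ball p a) x))) {x. x \<bullet> b \<in> B}"
      unfolding \<nu>_def using B by (subst emeasure_distr) (auto simp: vimage_def)
    also have "\<dots> = (\<integral>\<^sup>+x. ennreal (indicator (ball p a) x) * indicator {x. x \<bullet> b \<in> B} x \<partial>lborel)"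
      using m by (subst emeasure_density) (auto intro!: borel_measurable_indicator)
    also have "\<dots> = (\<integral>\<^sup>+x. indicator (ball p a \<inter> {x. x \<bullet> b \<in> B}) x \<partial>lborel)"
      by (rule nn_integral_cong) (auto split: split_indicator)
    also have "\<dots> = emeasure lborel (ball p a \<inter> {x. x \<bullet> b \<in> B})" using m by simp
    finally show ?thesis .
  qed
  have fin: "emeasure \<nu> (space \<nu>) \<noteq> \<infinity>"
    using \<nu>[of UNIV] emeasure_bounded_finite[OF bounded_ball, of p a] by (simp add: \<nu>_def)
  have pos: "emeasure lborel (ball p a) > 0"
  proof (rule ccontr)
    assume "\<not> emeasure lborel (ball p a) > 0"
    then have "ball p a \<in> null_sets lborel" by (auto simp: null_sets_def)
    then have "ball p a \<in> null_sets lebesgue" by (simp add: null_sets_completionI)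
    then show False using a open_not_negligible[of "ball p a"] by (simp add: negligible_iff_null_sets)
  qed
  have "negligible (\<Union>q\<in>\<rat>. {x::'a. x \<bullet> b = q})"
    by (intro negligible_countable_Union countable_image countable_rat) (use negligible_standard_hyperplane[OF b] in auto)
  moreover have "ball p a \<inter> {x. x \<bullet> b \<in> \<rat>} \<subseteq> (\<Union>q\<in>\<rat>. {x. x \<bullet> b = q})" by auto
  ultimately have "negligible (ball p a \<inter> {x. x \<bullet> b \<in> \<rat>})" by (rule negligible_subset)
  moreover have Qb: "\<rat> \<in> sets (borel :: real measure)" by (rule sets.countable[OF _ countable_rat]) simp
  then have "ball p a \<inter> {x. x \<bullet> b \<in> \<rat>} \<in> sets borel"
    using measurable_sets[of "\<lambda>x. x \<bullet> b" borel borel \<rat>] by (auto simp: vimage_def)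
  ultimately have "emeasure lborel (ball p a \<inter> {x. x \<bullet> b \<in> \<rat>}) = 0"
    by (simp add: negligible_iff_emeasure0)
  then have "emeasure \<nu> \<rat> = 0" using \<nu>[OF Qb] by simp
  moreover have "emeasure \<nu> \<rat> = (INF U\<in>{U. \<rat> \<subseteq> U \<and> open U}. emeasure \<nu> U)"
    by (rule outer_regular[OF _ fin Qb]) (simp add: \<nu>_def)
  ultimately have "(INF U\<in>{U. \<rat> \<subseteq> U \<and> open U}. emeasure \<nu> U) < emeasure lborel (ball p a)" using pos by simp
  then obtain U where U: "\<rat> \<subseteq> U" "open U" "emeasure \<nu> U < emeasure lborel (ball p a)"
    unfolding INF_less_iff by blast
  define A where "A = cball (p \<bullet> b) a - U"
  have Ac: "compact A" unfolding A_def using U(2) by (intro compact_diff) auto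
  have split: "ball p a \<subseteq> (ball p a \<inter> {x. x \<bullet> b \<in> U}) \<union> {x. x \<in> ball p a \<and> x \<bullet> b \<in> A}"
  proof
    fix x assume x: "x \<in> ball p a"
    have "\<bar>(p - x) \<bullet> b\<bar> \<le> norm (p - x)" by (rule Basis_le_norm[OF b])
    then have "x \<bullet> b \<in> cball (p \<bullet> b) a" using x by (simp add: dist_norm inner_diff_left)
    then show "x \<in> (ball p a \<inter> {x. x \<bullet> b \<in> U}) \<union> {x. x \<in> ball p a \<and> x \<bullet> b \<in> A}" using x by (auto simp: A_def)
  qed
  have sU: "ball p a \<inter> {x. x \<bullet> b \<in> U} \<in> sets borel"
    using measurable_sets[of "\<lambda>x. x \<bullet> b" borel borel U] U(2) by (auto simp: vimage_def)
  have sA: "{x. x \<in> ball p a \<and> x \<bullet> b \<in> A} \<in> sets borel"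
    using measurable_sets[of "\<lambda>x. x \<bullet> b" borel borel A] borel_compact[OF Ac]
    by (auto simp: vimage_def Collect_conj_eq)
  have notnull: "\<not> (AE x in lborel. \<not> (x \<in> ball p a \<and> x \<bullet> b \<in> A))"
  proof
    assume "AE x in lborel. \<not> (x \<in> ball p a \<and> x \<bullet> b \<in> A)"
    then have z: "emeasure lborel {x. x \<in> ball p a \<and> x \<bullet> b \<in> A} = 0"
      using AE_iff_measurable[of "{x. x \<in> ball p a \<and> x \<bullet> b \<in> A}" lborel "\<lambda>x. \<not> (x \<in> ball p a \<and> x \<bullet> b \<in> A)"] sA by simp
    have "emeasure lborel (ball p a) \<le> emeasure lborel ((ball p a \<inter> {x. x \<bullet> b \<in> U}) \<union> {x. x \<in> ball p a \<and> x \<bullet> b \<in> A})"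
      by (rule emeasure_mono[OF split]) (use sU sA in simp)
    also have "\<dots> \<le> emeasure lborel (ball p a \<inter> {x. x \<bullet> b \<in> U}) + emeasure lborel {x. x \<in> ball p a \<and> x \<bullet> b \<in> A}"
      by (rule emeasure_subadditive) (use sU sA in simp_all)
    also have "\<dots> = emeasure \<nu> U" using z \<nu>[of U] U(2) by simp
    finally show False using U(3) by simp
  qed
  moreover have "A \<noteq> {}" using notnull by auto
  moreover have "\<exists>q. s < q \<and> q < t \<and> q \<notin> A" if "s < t" for s t
    using Rats_dense_in_real[OF that] U(1) by (auto simp: A_def)
  ultimately show ?thesis using that Ac by blast
qed

text \<open>\<open>s' = min 1 (infdist \<cdot> A)\<close> vanishes exactly on \<open>A\<close> and equals one far away from it. Since \<open>A\<close>
  contains no interval, the primitive \<open>s\<close> is nevertheless strictly increasing.\<close>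

lemma flattening:
  fixes A :: "real set"
  assumes A: "compact A" "A \<noteq> {}" "\<forall>s t. s < t \<longrightarrow> (\<exists>q. s < q \<and> q < t \<and> q \<notin> A)"
  obtains s s' :: "real \<Rightarrow> real" where "\<forall>t. (s has_real_derivative s' t) (at t)" "continuous_on UNIV s'"
    "\<forall>t\<in>A. s' t = 0" "strict_mono s" "\<forall>M. \<exists>B. \<forall>t. \<bar>s t\<bar> \<le> M \<longrightarrow> \<bar>t\<bar> \<le> B"
proof -
  \<comment> \<open>\<open>\<kappa> = 1 - s'\<close> has compact support, so that \<open>s\<close>
    can be written as \<open>t\<close> minus an integral with a fixed lower limit.\<close>
  define \<kappa> where "\<kappa> t = max 0 (1 - infdist t A)" for t
  have \<kappa>c: "continuous_on T \<kappa>" for T unfolding \<kappa>_def by (intro continuous_intros)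
  have \<kappa>01: "0 \<le> \<kappa> t" "\<kappa> t \<le> 1" for t by (auto simp: \<kappa>_def infdist_nonneg)
  obtain L where L: "\<And>t. t \<in> A \<Longrightarrow> \<bar>t\<bar> \<le> L" using compact_imp_bounded[OF A(1)] by (auto simp: bounded_iff)
  have \<kappa>0: "\<kappa> t = 0" if "\<bar>t\<bar> \<ge> L + 1" for t
  proof -
    obtain y where y: "y \<in> A" "infdist t A = dist t y" using infdist_attains_inf[OF compact_imp_closed[OF A(1)] A(2)] by metis
    have "dist t y \<ge> 1" using L[OF y(1)] that by (simp add: dist_real_def)
    then show ?thesis using y by (simp add: \<kappa>_def)
  qed
  define J where "J t = integral {- L - 2..t} \<kappa>" for t
  have J: "(J has_real_derivative \<kappa> t) (at t)" for t
  proof (cases "t < - L - 1")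
    case True
    have J0: "J x = 0" if "x < - L - 1" for x
    proof -
      have "integral {- L - 2..x} \<kappa> = integral {- L - 2..x} (\<lambda>_. 0)"
        by (rule Henstock_Kurzweil_Integration.integral_cong) (use that in \<open>auto intro!: \<kappa>0\<close>)
      then show ?thesis by (simp add: J_def)
    qed
    have "((\<lambda>x. 0) has_real_derivative 0) (at t)" by simp
    then have "(J has_real_derivative 0) (at t)"
      by (rule has_field_derivative_transform_within_open[where S="{..<- L - 1}"]) (use True J0 in auto)
    moreover have "\<kappa> t = 0" by (rule \<kappa>0) (use True in linarith)
    ultimately show ?thesis by simp
  next
    case False
    have "((\<lambda>x. integral {- L - 2..x} \<kappa>) has_real_derivative \<kappa> t) (at t within {- L - 2..t + 1})"
      by (rule integral_has_real_derivative[OF \<kappa>c]) (use False in auto)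
    moreover have "at t within {- L - 2..t + 1} = at t" by (rule at_within_Icc_at) (use False in auto)
    ultimately show ?thesis by (simp add: J_def[abs_def])
  qed
  define s where "s t = t - J t" for t
  define s' where "s' t = 1 - \<kappa> t" for t
  have s: "(s has_real_derivative s' t) (at t)" for t
    unfolding s_def[abs_def] s'_def by (intro derivative_intros J)
  have s'0: "0 \<le> s' t" for t using \<kappa>01(2)[of t] by (simp add: s'_def)
  have mono: "s x \<le> s y" if "x \<le> y" for x y
    using DERIV_nonneg_imp_nondecreasing[OF that, of s] s s'0 by blast
  have strict: "s x < s y" if xy: "x < y" for x y
  proof -
    obtain q where q: "x < q" "q < y" "q \<notin> A" using A(3) xy by blast
    have "infdist q A > 0" by (rule infdist_pos_not_in_closed[OF compact_imp_closed[OF A(1)] A(2) q(3)])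
    then have "s' q > 0" by (simp add: s'_def \<kappa>_def)
    from DERIV_pos_inc_right[OF s this] obtain d where d: "d > 0" "\<And>h. h > 0 \<Longrightarrow> h < d \<Longrightarrow> s q < s (q + h)" by blast
    define h where "h = min (d / 2) ((y - q) / 2)"
    have h: "h > 0" "h < d" "q + h \<le> y" using d q by (auto simp: h_def min_def field_simps)
    show ?thesis using d(2)[OF h(1,2)] mono[of x q] mono[OF h(3)] q(1) by linarith
  qed
  have bounded: "\<exists>B. \<forall>t. \<bar>s t\<bar> \<le> M \<longrightarrow> \<bar>t\<bar> \<le> B" for M
  proof (intro exI[of _ "max (L + 1) (M + \<bar>s (L + 1)\<bar> + \<bar>s (- L - 1)\<bar> + \<bar>L + 1\<bar>)"] allI impI)
    fix t assume t: "\<bar>s t\<bar> \<le> M"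
    consider "t > L + 1" | "t < - L - 1" | "\<bar>t\<bar> \<le> L + 1" by linarith
    then show "\<bar>t\<bar> \<le> max (L + 1) (M + \<bar>s (L + 1)\<bar> + \<bar>s (- L - 1)\<bar> + \<bar>L + 1\<bar>)"
    proof cases
      case 1
      have "0 \<le> L" using A(2) L by (meson abs_ge_zero ex_in_conv order_trans)
      obtain z where z: "L + 1 < z" "z < t" "s t - s (L + 1) = (t - (L + 1)) * s' z"
        using MVT2[OF 1, of s s'] s by blast
      moreover have "s' z = 1" using z(1) by (simp add: s'_def \<kappa>0)
      ultimately have "s t - s (L + 1) = t - (L + 1)" by simp
      then show ?thesis unfolding le_max_iff_disj using t 1 \<open>0 \<le> L\<close> by (intro disjI2) linarith
    next
      case 2
      have "0 \<le> L" using A(2) L by (meson abs_ge_zero ex_in_conv order_trans)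
      obtain z where z: "t < z" "z < - L - 1" "s (- L - 1) - s t = (- L - 1 - t) * s' z"
        using MVT2[OF 2, of s s'] s by blast
      moreover have "s' z = 1" using z(2) by (simp add: s'_def \<kappa>0)
      ultimately have "s (- L - 1) - s t = - L - 1 - t" by simp
      then show ?thesis unfolding le_max_iff_disj using t 2 \<open>0 \<le> L\<close> by (intro disjI2) linarith
    qed simp
  qed
  show ?thesis
  proof (rule that)
    show "\<forall>t. (s has_real_derivative s' t) (at t)" using s by blast
    show "\<forall>M. \<exists>B. \<forall>t. \<bar>s t\<bar> \<le> M \<longrightarrow> \<bar>t\<bar> \<le> B" using bounded by blast
    show "continuous_on UNIV s'" unfolding s'_def[abs_def] by (intro continuous_intros \<kappa>c)
    show "\<forall>t\<in>A. s' t = 0" by (simp add: s'_def \<kappa>_def)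
    show "strict_mono s" using strict by (simp add: strict_mono_def)
  qed
qed

text \<open>The coordinate \<open>x \<bullet> b\<close> is replaced by \<open>s (x \<bullet> b)\<close>, the other
  coordinates are kept.\<close>

definition flatten :: "(real \<Rightarrow> real) \<Rightarrow> 'a::euclidean_space \<Rightarrow> 'a \<Rightarrow> 'a" where
  "flatten s b x = x + (s (x \<bullet> b) - x \<bullet> b) *\<^sub>R b"

lemma flatten_inner: "b \<in> Basis \<Longrightarrow> flatten s b x \<bullet> b = s (x \<bullet> b)"
  by (simp add: flatten_def inner_add_left)

lemma flatten_inj:
  assumes "strict_mono s" "b \<in> Basis" "flatten s b x = flatten s b y" shows "x = y"
proof -
  have "s (x \<bullet> b) = s (y \<bullet> b)" using flatten_inner[OF assms(2), of s x] flatten_inner[OF assms(2), of s y] assms(3) by simp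
  then have "x \<bullet> b = y \<bullet> b" using strict_mono_eq[OF assms(1)] by blast
  then show ?thesis using assms(3) by (simp add: flatten_def)
qed

lemma continuous_flatten:
  assumes "\<And>t. (s has_real_derivative s' t) (at t)"
  shows "continuous_on T (flatten s b)"
proof -
  have "continuous_on UNIV s" using assms by (intro continuous_at_imp_continuous_on) (auto intro: DERIV_isCont)
  then have "continuous_on T (\<lambda>x. s (x \<bullet> b))" by (rule continuous_on_compose2) (auto intro: continuous_intros)
  then show ?thesis unfolding flatten_def[abs_def] by (intro continuous_intros)
qed

lemma flatten_C1:
  fixes f :: "'a::euclidean_space \<Rightarrow> real"
  assumes s: "\<And>t. (s has_real_derivative s' t) (at t)" "continuous_on UNIV s'" and b: "b \<in> Basis" and f: "Ck (Suc 0) f"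
  shows "Ck (Suc 0) (\<lambda>x. f (flatten s b x))" "dd (\<lambda>x. f (flatten s b x)) b x = s' (x \<bullet> b) * dd f b (flatten s b x)"
proof -
  define D where "D x v = dd f v (flatten s b x) + (s' (x \<bullet> b) - 1) * (v \<bullet> b) * dd f b (flatten s b x)" for x v
  have d: "((\<lambda>x. f (flatten s b x)) has_derivative D x) (at x)" for x
  proof -
    have si: "((\<lambda>x. s (x \<bullet> b)) has_derivative (\<lambda>v. s' (x \<bullet> b) * (v \<bullet> b))) (at x)"
    proof -
      have "((\<lambda>x. x \<bullet> b) has_derivative (\<lambda>v. v \<bullet> b)) (at x)" by (auto intro!: derivative_eq_intros)
      moreover have "(s has_derivative (\<lambda>h. s' (x \<bullet> b) * h)) (at (x \<bullet> b))"
        using s(1)[of "x \<bullet> b"] by (simp add: has_field_derivative_def)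
      ultimately show ?thesis by (rule has_derivative_compose)
    qed
    have "(flatten s b has_derivative (\<lambda>v. v + (s' (x \<bullet> b) * (v \<bullet> b) - v \<bullet> b) *\<^sub>R b)) (at x)"
      unfolding flatten_def[abs_def] by (auto intro!: derivative_eq_intros si)
    from has_derivative_compose[OF this Ck_Suc_deriv[OF f]]
    have "((\<lambda>x. f (flatten s b x)) has_derivative (\<lambda>v. dd f (v + (s' (x \<bullet> b) * (v \<bullet> b) - v \<bullet> b) *\<^sub>R b) (flatten s b x))) (at x)" .
    moreover have "dd f (v + (s' (x \<bullet> b) * (v \<bullet> b) - v \<bullet> b) *\<^sub>R b) (flatten s b x) = D x v" for v
      unfolding D_def by (simp flip: grad_inner[OF f] add: inner_add_right algebra_simps)
    ultimately show ?thesis by simp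
  qed
  note fc = continuous_flatten[OF s(1)]
  show "Ck (Suc 0) (\<lambda>x. f (flatten s b x))"
  proof (rule Ck_SucI[OF d])
    fix v
    have c: "continuous_on UNIV (\<lambda>x. dd f w (flatten s b x))" for w
      by (rule continuous_on_compose2[OF Ck_continuous[OF Ck_dd[OF f]] fc]) auto
    have "continuous_on UNIV (\<lambda>x. s' (x \<bullet> b))"
      by (rule continuous_on_compose2[OF s(2)]) (auto intro: continuous_intros)
    then show "Ck 0 (\<lambda>x. D x v)" unfolding D_def Ck.simps(1) by (intro continuous_intros c)
  qed
  have "dd (\<lambda>x. f (flatten s b x)) b x = D x b" by (rule dd_eq[OF d])
  then show "dd (\<lambda>x. f (flatten s b x)) b x = s' (x \<bullet> b) * dd f b (flatten s b x)"
    using b by (simp add: D_def algebra_simps)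
qed

text \<open>Preimages of bounded sets are bounded, so a cut-off composed with flattening has compact support.\<close>

lemma flatten_coercive:
  assumes s: "\<And>M. \<exists>B. \<forall>t. \<bar>s t\<bar> \<le> M \<longrightarrow> \<bar>t\<bar> \<le> B" and b: "b \<in> Basis"
  obtains R where "\<forall>x. norm (flatten s b x) \<le> N \<longrightarrow> norm x \<le> R"
proof -
  obtain B where B: "\<And>t. \<bar>s t\<bar> \<le> N \<Longrightarrow> \<bar>t\<bar> \<le> B" using s by metis
  have "norm x \<le> N + (N + B)" if x: "norm (flatten s b x) \<le> N" for x
  proof -
    have "\<bar>s (x \<bullet> b)\<bar> \<le> N" using Basis_le_norm[OF b, of "flatten s b x"] x unfolding flatten_inner[OF b] by linarith
    then have "\<bar>s (x \<bullet> b) - x \<bullet> b\<bar> \<le> N + B" using B[of "s (x \<bullet> b)"] B[of "x \<bullet> b"] by linarith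
    then have "norm ((s (x \<bullet> b) - x \<bullet> b) *\<^sub>R b) \<le> N + B" using b by simp
    moreover have "x = flatten s b x - (s (x \<bullet> b) - x \<bullet> b) *\<^sub>R b" by (simp add: flatten_def)
    then have "norm x \<le> norm (flatten s b x) + norm ((s (x \<bullet> b) - x \<bullet> b) *\<^sub>R b)" by (metis norm_triangle_ineq4)
    ultimately show ?thesis using x by linarith
  qed
  then show ?thesis using that by blast
qed

context reflecting_domain
begin

lemma C1_h1_pair:
  assumes f: "Ck (Suc k) f" "\<And>x. norm x > R \<Longrightarrow> f x = 0"
  shows "h1_pair f (\<lambda>x. indicator \<Gamma> x *\<^sub>R grad f x)"
  unfolding h1_pair_def
proof
  show "f \<in> borel_measurable m"
    by (intro measurable_mI borel_measurable_continuous_onI Ck_continuous[OF f(1)])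
  show "sobolev \<Gamma> (ext0 f) (\<lambda>x. indicator \<Gamma> x *\<^sub>R grad f x)"
    by (rule sobolev_C1[OF sets_domain(1) f(1)]) (rule f(2))
qed

lemma C1_Cc:
  assumes f: "Ck k f" "\<And>x. norm x > R \<Longrightarrow> f x = 0"
  shows "f \<in> Cc (closure \<Gamma>)"
  unfolding Cc_def
proof (intro CollectI conjI exI[of _ "closure \<Gamma> \<inter> cball 0 R"])
  show "continuous_on (closure \<Gamma>) f" by (rule continuous_on_subset[OF Ck_continuous[OF f(1)]]) simp
qed (use f(2) in \<open>auto simp: closed_Int_compact not_less[symmetric]\<close>)

text \<open>The functions \<open>p \<circ> flatten s b\<close> with smooth \<open>p\<close> form an algebra that separates points, because
  flattening is injective. Their derivative in the direction \<open>b\<close> carries the factor \<open>s'\<close>.\<close>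

lemma flat_core_dense:
  assumes s: "\<And>t. (s has_real_derivative s' t) (at t)" "continuous_on UNIV s'" "\<forall>t\<in>A. s' t = 0"
      "strict_mono s" "\<And>M. \<exists>B. \<forall>t. \<bar>s t\<bar> \<le> M \<longrightarrow> \<bar>t\<bar> \<le> B" and b: "b \<in> Basis"
    and f: "f \<in> Cc (closure \<Gamma>)"
  shows "\<exists>R. \<forall>e>0. \<exists>c\<in>flat_core A b. \<forall>x\<in>closure \<Gamma>. \<bar>f x - c x\<bar> < e \<and> (norm x > R \<longrightarrow> c x = 0)"
proof -
  let ?\<Psi> = "flatten s b :: 'a \<Rightarrow> 'a"
  obtain K where K: "continuous_on (closure \<Gamma>) f" "compact K" "K \<subseteq> closure \<Gamma>" "\<And>x. x \<in> closure \<Gamma> \<Longrightarrow> x \<notin> K \<Longrightarrow> f x = 0"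
    using f unfolding Cc_def by blast
  have \<Psi>c: "continuous_on T ?\<Psi>" for T by (rule continuous_flatten[OF s(1)])
  have "bounded (?\<Psi> ` K)" by (rule compact_imp_bounded[OF compact_continuous_image[OF \<Psi>c K(2)]])
  then obtain M0 where M0: "\<And>x. x \<in> K \<Longrightarrow> norm (?\<Psi> x) \<le> M0" by (auto simp: bounded_iff)
  define M where "M = max M0 0"
  have M: "0 \<le> M" "M < M + 1" "\<And>x. x \<in> K \<Longrightarrow> norm (?\<Psi> x) \<le> M" using M0 by (auto simp: M_def intro: max.coboundedI1)
  let ?\<eta> = "cutoff (0::'a) M (M + 1)"
  note \<eta> = cutoff_props[OF M(1,2), where c=0]
  obtain R where R': "\<forall>x. norm (?\<Psi> x) \<le> M + 1 \<longrightarrow> norm x \<le> R" by (rule flatten_coercive[where N="M + 1", OF s(5) b])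
  then have R: "norm x \<le> R" if "norm (?\<Psi> x) \<le> M + 1" for x using that by blast
  define X where "X = closure \<Gamma> \<inter> {x. norm (?\<Psi> x) \<le> M + 1}"
  have "closed {x. norm (?\<Psi> x) \<le> M + 1}"
    by (intro closed_Collect_le continuous_intros \<Psi>c)
  then have "closed X" unfolding X_def by (intro closed_Int) auto
  moreover have "bounded X" unfolding bounded_iff X_def using R by blast
  ultimately have Xc: "compact X" by (simp add: compact_eq_bounded_closed)
  let ?Ring = "{q. \<exists>p. smooth p \<and> q = (\<lambda>x. p (?\<Psi> x))}"
  have ring: "function_ring_on ?Ring X"
  proof
    show "compact X" by (rule Xc)
    show "continuous_on X q" if q: "q \<in> ?Ring" for q
    proof -
      obtain p where p: "smooth p" "q = (\<lambda>x. p (?\<Psi> x))" using q by blast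
      show ?thesis unfolding p(2) by (rule continuous_on_compose2[OF Ck_continuous[OF spec[OF p(1), of 0]] \<Psi>c]) simp
    qed
    show "(\<lambda>x. q x + r x) \<in> ?Ring" if qr: "q \<in> ?Ring" "r \<in> ?Ring" for q r
    proof -
      obtain p p' where "smooth p" "q = (\<lambda>x. p (?\<Psi> x))" "smooth p'" "r = (\<lambda>x. p' (?\<Psi> x))" using qr by blast
      then show ?thesis by (intro CollectI exI[of _ "\<lambda>z. p z + p' z"]) (simp add: Ck_add)
    qed
    show "(\<lambda>x. q x * r x) \<in> ?Ring" if qr: "q \<in> ?Ring" "r \<in> ?Ring" for q r
    proof -
      obtain p p' where "smooth p" "q = (\<lambda>x. p (?\<Psi> x))" "smooth p'" "r = (\<lambda>x. p' (?\<Psi> x))" using qr by blast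
      then show ?thesis by (intro CollectI exI[of _ "\<lambda>z. p z * p' z"]) (simp add: Ck_mult)
    qed
    show "(\<lambda>_. c) \<in> ?Ring" for c by (intro CollectI exI[of _ "\<lambda>_. c"]) (simp add: Ck_const)
    show "\<exists>q\<in>?Ring. q x \<noteq> q y" if xy: "x \<in> X" "y \<in> X" "x \<noteq> y" for x y
    proof -
      have "?\<Psi> x \<noteq> ?\<Psi> y" using flatten_inj[OF s(4) b] xy(3) by blast
      then obtain i where i: "?\<Psi> x \<bullet> i \<noteq> ?\<Psi> y \<bullet> i" using euclidean_eqI by metis
      show ?thesis
      proof (rule bexI[of _ "\<lambda>x. ?\<Psi> x \<bullet> i"])
        show "(\<lambda>x. ?\<Psi> x \<bullet> i) \<in> ?Ring" by (intro CollectI exI[of _ "\<lambda>z. z \<bullet> i"]) (simp add: Ck_inner)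
      qed (rule i)
    qed
  qed
  have fX: "continuous_on X f" using K(1) by (rule continuous_on_subset) (auto simp: X_def)
  show ?thesis
  proof (intro exI[of _ R] allI impI)
    fix e :: real assume e: "e > 0"
    from function_ring_on.Stone_Weierstrass_basic[OF ring fX e]
    obtain q where q1: "q \<in> ?Ring" and q2: "\<forall>x\<in>X. \<bar>f x - q x\<bar> < e" by (rule bexE)
    note q = q1 bspec[OF q2]
    obtain p where p: "smooth p" "q = (\<lambda>x. p (?\<Psi> x))" using q(1) by blast
    let ?p = "\<lambda>z. ?\<eta> z * p z" and ?c = "\<lambda>x. ?\<eta> (?\<Psi> x) * q x"
    have pk: "Ck (Suc 0) ?p" by (rule Ck_mult[OF spec[OF \<eta>(1)] spec[OF p(1)]])
    have ceq: "?c = (\<lambda>x. ?p (?\<Psi> x))" unfolding p(2) ..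
    have ck: "Ck (Suc 0) ?c" unfolding ceq by (rule flatten_C1(1)[OF s(1,2) b pk])
    have cb: "dd ?c b x = s' (x \<bullet> b) * dd ?p b (?\<Psi> x)" for x
      unfolding ceq by (rule flatten_C1(2)[OF s(1,2) b pk])
    have far: "?c x = 0" if "norm x > R" for x
    proof -
      have "\<not> norm (?\<Psi> x) \<le> M + 1" using R[of x] that by auto
      then have "?\<eta> (?\<Psi> x) = 0" by (intro \<eta>(3)) simp
      then show ?thesis by simp
    qed
    have "?c \<in> flat_core A b"
      unfolding flat_core_def
    proof (intro CollectI conjI exI)
      show "?c \<in> Cc (closure \<Gamma>)" by (rule C1_Cc[OF ck]) (rule far)
      show "h1_pair ?c (\<lambda>x. indicator \<Gamma> x *\<^sub>R grad ?c x)" by (rule C1_h1_pair[OF ck]) (rule far)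
      show "AE x in lborel. x \<bullet> b \<in> A \<longrightarrow> (indicator \<Gamma> x *\<^sub>R grad ?c x) \<bullet> b = 0"
      proof (intro AE_I2 impI)
        fix x assume "x \<bullet> b \<in> A"
        then show "(indicator \<Gamma> x *\<^sub>R grad ?c x) \<bullet> b = 0"
          unfolding inner_scaleR_left grad_inner_Basis[OF b] cb using s(3) by simp
      qed
    qed
    moreover have "\<bar>f x - ?c x\<bar> < e" if x: "x \<in> closure \<Gamma>" for x
    proof (cases "x \<in> K")
      case True
      have n: "norm (?\<Psi> x - 0) \<le> M" using M(3)[OF True] by simp
      then have "x \<in> X" using x by (simp add: X_def)
      then show ?thesis using q(2)[of x] \<eta>(2)[OF n] by simp
    next
      case False
      then have f0: "f x = 0" using K(4) x by blast
      show ?thesis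
      proof (cases "x \<in> X")
        case True
        have "\<bar>?c x\<bar> \<le> 1 * \<bar>q x\<bar>" unfolding abs_mult using \<eta>(4,5)[of "?\<Psi> x"] by (intro mult_right_mono) auto
        then show ?thesis using q(2)[OF True] f0 by simp
      next
        case False
        then have "M + 1 \<le> norm (?\<Psi> x - 0)" using x by (simp add: X_def)
        then show ?thesis using \<eta>(3)[of "?\<Psi> x"] f0 e by simp
      qed
    qed
    ultimately show "\<exists>c\<in>flat_core A b. \<forall>x\<in>closure \<Gamma>. \<bar>f x - c x\<bar> < e \<and> (norm x > R \<longrightarrow> c x = 0)"
      using far by (intro bexI[of _ ?c]) auto
  qed
qed

text \<open>A cut-off of the coordinate \<open>x \<bullet> b\<close> has derivative one in the direction \<open>b\<close> near \<open>x0\<close>.\<close>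

lemma coordinate_not_flat:
  assumes ball: "ball x0 a \<subseteq> \<Gamma>" and a: "a > 0" and b: "b \<in> Basis" and A: "A \<in> sets borel"
    and fat: "\<not> (AE x in lborel. \<not> (x \<in> ball x0 a \<and> x \<bullet> b \<in> A))"
  shows "form_closure (flat_core A b) \<noteq> H1_closure \<Gamma>"
proof
  assume eq: "form_closure (flat_core A b) = H1_closure \<Gamma>"
  have c: "0 \<le> a" "a < 2 * a" using a by auto
  let ?\<eta> = "cutoff x0 a (2 * a)"
  let ?f = "\<lambda>x. ?\<eta> x * (x \<bullet> b)"
  have fk: "Ck (Suc 0) ?f" using cutoff_props(1)[OF c] by (intro Ck_mult Ck_inner) blast
  have "?f x = 0" if "norm x > norm x0 + 2 * a" for x
  proof -
    have "2 * a \<le> norm (x - x0)" using that norm_triangle_sub[of x x0] by linarith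
    then show ?thesis using cutoff_props(3)[OF c, of x x0] by simp
  qed
  then have pair: "h1_pair ?f (\<lambda>x. indicator \<Gamma> x *\<^sub>R grad ?f x)" by (rule C1_h1_pair[OF fk])
  then have "?f \<in> form_closure (flat_core A b)" unfolding eq H1_closure_pair by blast
  from flat_core_gradient[OF this pair A b]
  have "AE x in lborel. \<not> (x \<in> ball x0 a \<and> x \<bullet> b \<in> A)"
  proof eventually_elim
    case (elim x)
    show ?case
    proof
      assume x: "x \<in> ball x0 a \<and> x \<bullet> b \<in> A"
      have ik: "Ck (Suc 0) (\<lambda>x. x \<bullet> b)" by (rule Ck_inner)
      have "grad (\<lambda>x. x \<bullet> b) x = grad ?f x"
      proof (rule grad_cong_open[OF ik, of "ball x0 a"])
        show "y \<bullet> b = ?f y" if "y \<in> ball x0 a" for y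
          using cutoff_props(2)[OF c, of y x0] that by (simp add: dist_norm norm_minus_commute)
      qed (use x in auto)
      moreover have "((\<lambda>x. x \<bullet> b) has_derivative (\<lambda>v. v \<bullet> b)) (at x)" by (auto intro!: derivative_eq_intros)
      then have "grad (\<lambda>x. x \<bullet> b) x \<bullet> b = 1" unfolding grad_inner_Basis[OF b] using b by (simp add: dd_eq)
      ultimately have "grad ?f x \<bullet> b = 1" by simp
      moreover have "x \<in> \<Gamma>" using x ball by blast
      ultimately show False using elim x by simp
    qed
  qed
  with fat show False by blast
qed

theorem proper_subspace_exists:
  assumes "\<Gamma> \<noteq> {}"
  shows "\<exists>F'. proper_regular_subspace m E (H1_closure \<Gamma>) E F'"
proof -
  obtain x0 where "x0 \<in> \<Gamma>" using assms by blast
  then obtain a where a: "a > 0" "ball x0 a \<subseteq> \<Gamma>" using open_domain open_contains_ball by metis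
  obtain b :: 'a where b: "b \<in> Basis" using nonempty_Basis by blast
  obtain A where A: "compact A" "A \<noteq> {}" "\<forall>s t. s < t \<longrightarrow> (\<exists>q. s < q \<and> q < t \<and> q \<notin> A)"
    "\<not> (AE x in lborel. \<not> (x \<in> ball x0 a \<and> x \<bullet> b \<in> A))"
    by (rule fat_level_set[where p=x0, OF a(1) b])
  obtain s s' where s: "\<forall>t. (s has_real_derivative s' t) (at t)" "continuous_on UNIV s'"
    "\<forall>t\<in>A. s' t = 0" "strict_mono s" "\<forall>M. \<exists>B. \<forall>t. \<bar>s t\<bar> \<le> M \<longrightarrow> \<bar>t\<bar> \<le> B"
    by (rule flattening[OF A(1-3)])
  note dense = flat_core_dense[OF s(1)[rule_format] s(2) s(3) s(4) s(5)[rule_format] b]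
  have coreA: "dirichlet_core \<Gamma> (flat_core A b)" by (rule dirichlet_core_flat) (rule dense)
  have core0: "dirichlet_core \<Gamma> (flat_core {} b)"
  proof (rule dirichlet_core_flat)
    fix f :: "'a \<Rightarrow> real" assume "f \<in> Cc (closure \<Gamma>)"
    from dense[OF this] obtain R where
      R: "\<forall>e>0. \<exists>c\<in>flat_core A b. \<forall>x\<in>closure \<Gamma>. \<bar>f x - c x\<bar> < e \<and> (norm x > R \<longrightarrow> c x = 0)" ..
    show "\<exists>R. \<forall>e>0. \<exists>c\<in>flat_core {} b. \<forall>x\<in>closure \<Gamma>. \<bar>f x - c x\<bar> < e \<and> (norm x > R \<longrightarrow> c x = 0)"
    proof (intro exI[of _ R] allI impI)
      fix e :: real assume "e > 0"
      with R obtain c where "c \<in> flat_core A b" "\<forall>x\<in>closure \<Gamma>. \<bar>f x - c x\<bar> < e \<and> (norm x > R \<longrightarrow> c x = 0)" by blast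
      then show "\<exists>c\<in>flat_core {} b. \<forall>x\<in>closure \<Gamma>. \<bar>f x - c x\<bar> < e \<and> (norm x > R \<longrightarrow> c x = 0)"
        using flat_core_mono[of A b] by (intro bexI[of _ c]) auto
    qed
  qed
  have "regular_dirichlet_form m E (H1_closure \<Gamma>)"
    using dirichlet_core.regular_form_closure[OF core0] unfolding form_closure_flat_core_empty .
  moreover have "regular_dirichlet_form m E (form_closure (flat_core A b))"
    by (rule dirichlet_core.regular_form_closure[OF coreA])
  moreover have "form_closure (flat_core A b) \<subseteq> H1_closure \<Gamma>" by (auto simp: form_closure_def)
  moreover have "form_closure (flat_core A b) \<noteq> H1_closure \<Gamma>"
    by (rule coordinate_not_flat[OF a(2,1) b _ A(4)]) (rule borel_compact[OF A(1)])
  ultimately show ?thesis unfolding proper_regular_subspace_def regular_subspace_def by blast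
qed

end

theorem proposition3p10:
  fixes \<Gamma> :: "'a::euclidean_space set"
  assumes "open \<Gamma>" and "connected \<Gamma>" and "\<Gamma> \<noteq> {}"
    and "continuous_boundary \<Gamma>"
  shows "\<exists>\<E>' \<F>'. proper_regular_subspace (lborel_restricted (closure \<Gamma>))
           (\<lambda>u v. 1 / 2 * dirichlet_integral \<Gamma> u v) (H1_closure \<Gamma>) \<E>' \<F>'"
proof -
  interpret reflecting_domain \<Gamma>
    by (rule reflecting_domain.intro[OF assms(1) continuous_boundary_segment_property[OF assms(1,4)]])
  show ?thesis using proper_subspace_exists[OF assms(3)] by blast
qed

end
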